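(* Let $\hat T\in\mathcal B(V_n)$. For any $f\in\mathcal{SM}_L(\sigma_S(\hat T))$, the integral $$f(\hat T):=\frac1{2\pi}\int_{\partial(U\cap\mathbb C_j)}S_L^{-1}(s,\hat T)\,ds_j\,f(s)$$ is independent of the choice of the imaginary unit $j\in\mathbb S$ and of the bounded slice Cauchy domain $U\subset\mathbb R^{n+1}$ with $\sigma_S(\hat T)\subset U$ and $\overline U\subset\mathrm{dom}(f)$. Similarly, for any $f\in\mathcal{SM}_R(\sigma_S(\hat T))$, the integral $$f(\hat T):=\frac1{2\pi}\int_{\partial(U\cap\mathbb C_j)}f(s)\,ds_j\,S_R^{-1}(s,\hat T)$$ is independent of the choice of such $U$ and of $j\in\mathbb S$.
   Context: $\mathbb R_n$ ($n\ge1$) is the real Clifford algebra generated by $e_1,\dots,e_n$ with $e_\ell e_m+e_me_\ell=0$ for $\ell\ne m$ and $e_\ell^2=-1$; a real basis is $e_A=e_{\ell_1}\cdots e_{\ell_r}$, $A=(\ell_1<\dots<\ell_r)$, $e_\emptyset=1$. $\mathbb R^{n+1}$ is identified with the set of paravectors $s=s_0+\sum_{\ell=1}^ns_\ell e_\ell\in\mathbb R_n$; $\bar s=s_0-\sum s_\ell e_\ell$, $\mathrm{Re}(s)=s_0$, $|s|^2=\sum_{\ell=0}^n s_\ell^2$. $\mathbb S=\{\sum_{\ell=1}^n x_\ell e_\ell:\sum x_\ell^2=1\}$; $\mathbb C_j=\mathbb R+j\mathbb R$ for $j\in\mathbb S$, so $\mathbb R^{n+1}=\bigcup_{j\in\mathbb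 S}\mathbb C_j$. For $x=u+j_xv$, $[x]=\{u+jv:j\in\mathbb S\}$; $U\subseteq\mathbb R^{n+1}$ is axially symmetric if $[x]\subset U$ for all $x\in U$. $V$ is a real Banach space, $V_n=V\otimes_{\mathbb R}\mathbb R_n$ (a two-sided $\mathbb R_n$-module). Given bounded linear operators $T_A\in\mathcal B(V)$, the full Clifford operator $\hat T=\sum_AT_Ae_A$ acts by $\hat T(\sum_Bv_Be_B)=\sum_{A,B}T_A(v_B)e_Ae_B$; $\mathcal B(V_n)$ is the algebra of all such (right-linear) operators with norm $\|\hat T\|=\sum_A\|T_A\|_{\mathcal B(V)}$ and identity $\mathcal I$. For $a\in\mathbb R_n$: $(a\hat T)(v)=a(\hat Tv)$, $(\hat Ta)(v)=\hat T(av)$. For $s\in\mathbb R^{n+1}$: $\mathcal Q_s(\hat T)=\hat T^2-2\mathrm{Re}(s)\hat T+|s|^2\mathcal I$; $\rho_S(\hat T)=\{s\in\mathbb R^{n+1}:\mathcal Q_s(\hat T)\text{ invertible in }\mathcal B(V_n)\}$, $\sigma_S(\hat T)=\mathbb R^{n+1}\setminus\rho_S(\hat T)$; for $s\in\rho_S(\hat T)$: $S_L^{-1}(s,\hat T)=-\mathcal Q_s(\hat T)^{-1}(\hat T-\bar s\,\mathcal I)$, $S_R^{-1}(s,\hat T)=-(\hat T-\bar s\,\mathcal I)\mathcal Q_s(\hat T)^{-1}$. A function $f:U\to\mathbb R_n$ on an axially symmetric open set $U\subseteq\mathbb R^{n+1}$ is left (resp. right) slice monogenic if $f(u+jv)=f_0(u,v)+jf_1(u,v)$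 (resp. $f_0(u,v)+f_1(u,v)j$) for all $u+jv\in U$, $j\in\mathbb S$, with $f_0,f_1$ of class $C^1$, $\mathbb R_n$-valued, $f_0(u,-v)=f_0(u,v)$, $f_1(u,-v)=-f_1(u,v)$, $\partial_uf_0=\partial_vf_1$, $\partial_vf_0=-\partial_uf_1$. $\mathcal{SM}_L(\sigma_S(\hat T))$ (resp. $\mathcal{SM}_R(\sigma_S(\hat T))$) is the set of left (resp. right) slice monogenic functions whose axially symmetric open domain $\mathrm{dom}(f)$ contains $\sigma_S(\hat T)$. A slice Cauchy domain is an axially symmetric open set $U$ such that for each $j\in\mathbb S$ the boundary $\partial(U\cap\mathbb C_j)$ is a finite union of non-intersecting piecewise $C^1$ Jordan curves in $\mathbb C_j$ (positively oriented in integrals). $ds_j=ds(-j)$. *)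

theory Defs
  imports "HOL-Complex_Analysis.Winding_Numbers"
begin

section \<open>The real Clifford algebra\<close>

text \<open>
  The generators are indexed by a finite linearly ordered type \<open>'n\<close>, so \<open>n = CARD('n) \<ge> 1\<close>.
  \<open>'a \<otimes> \<real>\<^sub>n\<close> is the type \<^typ>\<open>'a ^ ('n set)\<close>: the coefficient of \<open>e\<^sub>A\<close> is the component at the
  set \<open>A\<close>, and \<open>axis A x\<close> is \<open>x e\<^sub>A\<close>. In particular \<open>\<real>\<^sub>n\<close> is \<^typ>\<open>real ^ ('n set)\<close> and \<open>V\<^sub>n\<close> is
  \<^typ>\<open>'v ^ ('n set)\<close>. The library's product on this type is componentwise and is not used.

  Sorting \<open>e\<^sub>A e\<^sub>B\<close> moves each \<open>e\<^sub>b\<close> past every \<open>e\<^sub>a\<close> with \<open>a > b\<close> and then cancels a square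
  \<open>e\<^sub>a\<^sup>2 = -1\<close> for each \<open>a \<in> A \<inter> B\<close>. This gives \<open>e\<^sub>A e\<^sub>B = csgn A B e\<^bsub>A \<triangle> B\<^esub>\<close> with \<open>csgn\<close> as follows.
\<close>

definition csgn :: "'n::{finite,linorder} set \<Rightarrow> 'n set \<Rightarrow> real" where
  "csgn A B = (-1) ^ card {(a, b). a \<in> A \<and> b \<in> B \<and> b \<le> a}"

text \<open>Left multiplication of \<open>V\<^sub>n\<close> by \<open>\<real>\<^sub>n\<close>; for \<open>'v = real\<close> it is the product of \<open>\<real>\<^sub>n\<close>.\<close>

definition cmult :: "real ^ ('n::{finite,linorder} set) \<Rightarrow> 'v::real_vector ^ ('n set) \<Rightarrow> 'v ^ ('n set)"
    (infixr \<open>\<odot>\<close> 70) where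
  "a \<odot> v = (\<Sum>A\<in>UNIV. \<Sum>B\<in>UNIV. axis (sym_diff A B) (csgn A B *\<^sub>R (a $ A) *\<^sub>R (v $ B)))"

section \<open>Full Clifford operators\<close>

definition full_op :: "('n::{finite,linorder} set \<Rightarrow> ('v::real_normed_vector \<Rightarrow>\<^sub>L 'v)) \<Rightarrow>
    'v ^ ('n set) \<Rightarrow> 'v ^ ('n set)" where
  "full_op T v =
     (\<Sum>A\<in>UNIV. \<Sum>B\<in>UNIV. axis (sym_diff A B) (csgn A B *\<^sub>R blinfun_apply (T A) (v $ B)))"

typedef (overloaded) ('v::real_normed_vector, 'n::"{finite,linorder}") clifford_op =
  "range full_op :: ('v ^ ('n set) \<Rightarrow> 'v ^ ('n set)) set"
  morphisms op_apply Abs_clifford_op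
  by blast

setup_lifting type_definition_clifford_op

lemma sum_sym_diff_axis:
  fixes g :: "'n::finite set \<Rightarrow> 'n set \<Rightarrow> 'v::real_vector"
  shows "(\<Sum>A\<in>UNIV. \<Sum>B\<in>UNIV. axis (sym_diff A B) (g A B)) $ C
           = (\<Sum>A\<in>UNIV. g A (sym_diff A C))"
proof -
  have "(\<Sum>B\<in>UNIV. axis (sym_diff A B) (g A B) $ C) = g A (sym_diff A C)" for A
  proof -
    have "(\<Sum>B\<in>UNIV. axis (sym_diff A B) (g A B) $ C)
            = (\<Sum>B\<in>UNIV. if B = sym_diff A C then g A B else 0)"
      by (rule sum.cong) (auto simp: axis_def)
    then show ?thesis by simp
  qed
  then show ?thesis by simp
qed

lemma full_op_nth:
  "full_op T v $ C = (\<Sum>A\<in>UNIV. csgn A (sym_diff A C) *\<^sub>R T A (v $ sym_diff A C))"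
  unfolding full_op_def by (rule sum_sym_diff_axis)

lemma cmult_nth:
  "(a \<odot> v) $ C = (\<Sum>A\<in>UNIV. csgn A (sym_diff A C) *\<^sub>R (a $ A) *\<^sub>R (v $ sym_diff A C))"
  unfolding cmult_def by (rule sum_sym_diff_axis)

lemma csgn_empty [simp]: "csgn {} B = 1" "csgn A {} = 1"
  by (auto simp: csgn_def)

lemma csgn_prod: "csgn A B = (\<Prod>a\<in>A. \<Prod>b\<in>B. if b \<le> a then -1 else 1)"
proof -
  have "{(a, b). a \<in> A \<and> b \<in> B \<and> b \<le> a} = (SIGMA a:A. {b\<in>B. b \<le> a})" by auto
  then have "card {(a, b). a \<in> A \<and> b \<in> B \<and> b \<le> a} = (\<Sum>a\<in>A. card {b\<in>B. b \<le> a})"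
    by (simp add: card_SigmaI)
  then have "csgn A B = (\<Prod>a\<in>A. (-1) ^ card {b\<in>B. b \<le> a})"
    unfolding csgn_def by (simp add: power_sum)
  also have "\<dots> = (\<Prod>a\<in>A. \<Prod>b\<in>B. if b \<le> a then -1 else 1)"
    by (rule prod.cong) (simp_all add: prod.If_cases Int_def)
  finally show ?thesis .
qed

lemma prod_sym_diff_sign:
  fixes h :: "'n::finite \<Rightarrow> real"
  assumes "\<And>x. h x * h x = 1"
  shows "prod h (sym_diff A B) = prod h A * prod h B"
proof -
  have 1: "prod h A = prod h (A - B) * prod h (A \<inter> B)"
    by (metis Int_Diff_Un Int_Diff_disjoint finite mult.commute prod.union_disjoint)
  have 2: "prod h B = prod h (B - A) * prod h (A \<inter> B)"
    by (metis Int_Diff_Un Int_Diff_disjoint Int_commute finite mult.commute prod.union_disjoint)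
  have 3: "prod h (sym_diff A B) = prod h (A - B) * prod h (B - A)"
    by (rule prod.union_disjoint) auto
  have 4: "prod h (A \<inter> B) * prod h (A \<inter> B) = 1"
    by (simp add: prod.distrib[symmetric] assms)
  have "prod h A * prod h B
          = prod h (A - B) * prod h (B - A) * (prod h (A \<inter> B) * prod h (A \<inter> B))"
    unfolding 1 2 by (simp only: mult_ac)
  then show ?thesis using 3 4 by simp
qed

lemma csgn_sym_diff_left: "csgn (sym_diff A B) C = csgn A C * csgn B C"
  unfolding csgn_prod
  by (rule prod_sym_diff_sign) (auto simp: prod.distrib[symmetric] intro!: prod.neutral)

lemma csgn_sym_diff_right: "csgn A (sym_diff B C) = csgn A B * csgn A C"
proof -
  have "(\<Prod>b\<in>sym_diff B C. if b \<le> a then -1 else 1)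
      = (\<Prod>b\<in>B. if b \<le> a then -1 else 1) * (\<Prod>b\<in>C. if b \<le> a then -1 else 1::real)" for a
    by (rule prod_sym_diff_sign) auto
  then show ?thesis unfolding csgn_prod by (simp add: prod.distrib)
qed

lemma csgn_cocycle:
  "csgn A B * csgn (sym_diff A B) C = csgn A (sym_diff B C) * csgn B C"
  by (simp add: csgn_sym_diff_left csgn_sym_diff_right)

lemma abs_csgn [simp]: "\<bar>csgn A B\<bar> = 1"
  by (simp add: csgn_def power_abs)

lemma sym_diff_sym_diff [simp]: "sym_diff A (sym_diff A B) = B"
  by auto

lemma sym_diff_assoc: "sym_diff (sym_diff A B) C = sym_diff A (sym_diff B C)"
  by auto

lemma sum_sym_diff_reindex:
  "(\<Sum>B\<in>UNIV. g (sym_diff A B)) = (\<Sum>B\<in>(UNIV :: 'n::finite set set). g B)"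
  by (rule sum.reindex_bij_witness[of _ "sym_diff A" "sym_diff A"]) auto

lemma csgn_compose:
  "csgn A (sym_diff A C) * csgn B (sym_diff B (sym_diff A C))
     = csgn A B * csgn (sym_diff A B) (sym_diff (sym_diff A B) C)"
proof -
  have "sym_diff B (sym_diff B (sym_diff A C)) = sym_diff A C"
    and "sym_diff B (sym_diff A C) = sym_diff (sym_diff A B) C" by auto
  then show ?thesis using csgn_cocycle[of A B "sym_diff B (sym_diff A C)"] by metis
qed

definition comp_coeff ::
  "('n::{finite,linorder} set \<Rightarrow> ('v::real_normed_vector \<Rightarrow>\<^sub>L 'v)) \<Rightarrow> ('n set \<Rightarrow> ('v \<Rightarrow>\<^sub>L 'v)) \<Rightarrow>
     'n set \<Rightarrow> ('v \<Rightarrow>\<^sub>L 'v)" where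
  "comp_coeff S T = (\<lambda>C. \<Sum>A\<in>UNIV. csgn A (sym_diff A C) *\<^sub>R (S A o\<^sub>L T (sym_diff A C)))"

lemma full_op_comp: "full_op S (full_op T v) = full_op (comp_coeff S T) v"
proof (subst vec_eq_iff, intro allI)
  fix C
  have "full_op S (full_op T v) $ C
      = (\<Sum>A\<in>UNIV. \<Sum>B\<in>UNIV. (csgn A (sym_diff A C) * csgn B (sym_diff B (sym_diff A C)))
            *\<^sub>R S A (T B (v $ sym_diff B (sym_diff A C))))"
    by (simp only: full_op_nth blinfun.sum_right blinfun.scaleR_right scaleR_sum_right scaleR_scaleR)
  also have "\<dots> = (\<Sum>A\<in>UNIV. \<Sum>B\<in>UNIV. (csgn A B * csgn (sym_diff A B) (sym_diff (sym_diff A B) C))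
            *\<^sub>R S A (T B (v $ sym_diff (sym_diff A B) C)))"
  proof (intro sum.cong refl)
    fix A B
    have "sym_diff B (sym_diff A C) = sym_diff (sym_diff A B) C" by auto
    then show "(csgn A (sym_diff A C) * csgn B (sym_diff B (sym_diff A C)))
            *\<^sub>R S A (T B (v $ sym_diff B (sym_diff A C)))
       = (csgn A B * csgn (sym_diff A B) (sym_diff (sym_diff A B) C))
            *\<^sub>R S A (T B (v $ sym_diff (sym_diff A B) C))"
      using csgn_compose[of A C B] by metis
  qed
  also have "\<dots> = (\<Sum>A\<in>UNIV. \<Sum>D\<in>UNIV. (csgn A (sym_diff A D) * csgn D (sym_diff D C))
            *\<^sub>R S A (T (sym_diff A D) (v $ sym_diff D C)))"
  proof (rule sum.cong[OF refl])
    fix A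
    show "(\<Sum>B\<in>UNIV. (csgn A B * csgn (sym_diff A B) (sym_diff (sym_diff A B) C))
            *\<^sub>R S A (T B (v $ sym_diff (sym_diff A B) C)))
       = (\<Sum>D\<in>UNIV. (csgn A (sym_diff A D) * csgn D (sym_diff D C))
            *\<^sub>R S A (T (sym_diff A D) (v $ sym_diff D C)))"
      using sum_sym_diff_reindex[of "\<lambda>B. (csgn A B * csgn (sym_diff A B) (sym_diff (sym_diff A B) C))
            *\<^sub>R S A (T B (v $ sym_diff (sym_diff A B) C))" A]
      by (simp only: sym_diff_sym_diff)
  qed
  also have "\<dots> = (\<Sum>D\<in>UNIV. \<Sum>A\<in>UNIV. (csgn A (sym_diff A D) * csgn D (sym_diff D C))
            *\<^sub>R S A (T (sym_diff A D) (v $ sym_diff D C)))"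
    by (rule sum.swap)
  also have "\<dots> = full_op (comp_coeff S T) v $ C"
    by (simp only: full_op_nth comp_coeff_def blinfun.sum_left blinfun.scaleR_left
        blinfun_apply_blinfun_compose scaleR_sum_right scaleR_scaleR mult.commute)
  finally show "full_op S (full_op T v) $ C = full_op (comp_coeff S T) v $ C" .
qed

text \<open>The defining relations of the Clifford algebra.\<close>

lemma cmult_axis: "axis A 1 \<odot> axis B x = axis (sym_diff A B) (csgn A B *\<^sub>R x)"
proof (subst vec_eq_iff, intro allI)
  fix C
  have eq: "sym_diff A C = B \<longleftrightarrow> C = sym_diff A B" by auto
  have "(axis A 1 \<odot> axis B x) $ C
      = (\<Sum>D\<in>UNIV. if D = A then csgn D (sym_diff D C) *\<^sub>R (axis B x $ sym_diff D C) else 0)"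
    unfolding cmult_nth by (rule sum.cong) (auto simp: axis_def)
  also have "\<dots> = csgn A (sym_diff A C) *\<^sub>R (axis B x $ sym_diff A C)" by simp
  also have "\<dots> = axis (sym_diff A B) (csgn A B *\<^sub>R x) $ C"
    unfolding axis_def using eq by auto
  finally show "(axis A 1 \<odot> axis B x) $ C = axis (sym_diff A B) (csgn A B *\<^sub>R x) $ C" .
qed

lemma cmult_one:
  fixes a :: "real ^ ('n::{finite,linorder} set)" and v :: "'v::real_vector ^ ('n set)"
  shows "axis {} 1 \<odot> v = v" "a \<odot> axis {} (1::real) = a"
proof -
  have "csgn D (sym_diff D C) *\<^sub>R (axis {} 1 $ D) *\<^sub>R (v $ sym_diff D C)
      = (if D = {} then v $ C else 0)" for C D :: "'n set"
    by (simp add: axis_def)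
  then show "axis {} 1 \<odot> v = v" by (simp add: vec_eq_iff cmult_nth)
  have "csgn D (sym_diff D C) *\<^sub>R (a $ D) *\<^sub>R (axis {} (1::real) $ sym_diff D C)
      = (if D = C then a $ D else 0)" for C D :: "'n set"
  proof -
    have "sym_diff D C = {} \<longleftrightarrow> D = C" by blast
    then show ?thesis unfolding axis_def by (cases "D = C") (simp_all only: vec_lambda_beta if_True if_False, simp_all)
  qed
  then show "a \<odot> axis {} 1 = a" by (simp add: vec_eq_iff cmult_nth)
qed

lemma generator_square: "axis {l} 1 \<odot> axis {l} 1 = - axis {} (1::real)"
proof -
  have "csgn {l} {l} = -1" by (simp add: csgn_prod)
  then show ?thesis unfolding cmult_axis by (simp add: axis_def vec_eq_iff)
qed

lemma generator_anticommute:
  assumes "l \<noteq> m"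
  shows "axis {l} 1 \<odot> axis {m} 1 + axis {m} 1 \<odot> axis {l} (1::real) = 0"
proof -
  have "csgn {l} {m} = - csgn {m} {l}"
    unfolding csgn_prod using assms by (cases l m rule: linorder_cases) auto
  then have "axis {l} 1 \<odot> axis {m} 1 = - axis (sym_diff {l} {m}) (csgn {m} {l})"
    unfolding cmult_axis by (simp add: axis_def vec_eq_iff)
  moreover have "axis {m} 1 \<odot> axis {l} (1::real) = axis (sym_diff {l} {m}) (csgn {m} {l})"
    unfolding cmult_axis by (metis Un_commute mult.right_neutral real_scaleR_def)
  ultimately show ?thesis by simp
qed

lemma basis_product:
  assumes "\<And>a. a \<in> A \<Longrightarrow> l < a"
  shows "axis {l} 1 \<odot> axis A 1 = axis (insert l A) (1::real)"
proof -
  have "{(a, b). a \<in> {l} \<and> b \<in> A \<and> b \<le> a} = {}" using assms by force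
  then have "csgn {l} A = 1" unfolding csgn_def by (simp only: card.empty power_0)
  moreover have "sym_diff {l} A = insert l A" using assms by auto
  ultimately show ?thesis by (simp add: cmult_axis)
qed

lemma full_op_scalar:
  "full_op (\<lambda>A. (a $ A) *\<^sub>R (id_blinfun :: 'v::real_normed_vector \<Rightarrow>\<^sub>L 'v)) v = a \<odot> v"
  by (auto simp: vec_eq_iff cmult_nth full_op_nth blinfun.scaleR_left)

lemma cmult_assoc: "a \<odot> (b \<odot> v) = (a \<odot> b) \<odot> (v :: 'v::real_normed_vector ^ ('n::{finite,linorder} set))"
proof -
  have eq: "comp_coeff (\<lambda>A. (a $ A) *\<^sub>R (id_blinfun :: 'v \<Rightarrow>\<^sub>L 'v)) (\<lambda>A. (b $ A) *\<^sub>R id_blinfun)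
      = (\<lambda>C. ((a \<odot> b) $ C) *\<^sub>R id_blinfun)"
    by (intro ext blinfun_eqI)
      (simp add: comp_coeff_def cmult_nth blinfun.sum_left blinfun.scaleR_left scaleR_sum_left)
  show ?thesis
    by (simp only: full_op_comp eq flip: full_op_scalar)
qed

lemma full_op_axis: "full_op T (axis {} x) $ A = T A x"
proof -
  have "full_op T (axis {} x) $ A
      = (\<Sum>B\<in>UNIV. if B = A then csgn B (sym_diff B A) *\<^sub>R T B x else 0)"
    unfolding full_op_nth by (rule sum.cong) (auto simp: axis_def)
  then show ?thesis by simp
qed

lemma full_op_inject: "full_op S = full_op T \<longleftrightarrow> S = T"
proof
  assume "full_op S = full_op T"
  then have "S A x = T A x" for A x
    by (metis full_op_axis)
  then show "S = T"
    by (intro ext blinfun_eqI)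
qed simp

text \<open>The coefficients \<open>T\<^sub>A\<close> of an operator; by the preceding lemma they are unique.\<close>

definition op_coeff :: "('v::real_normed_vector, 'n::{finite,linorder}) clifford_op \<Rightarrow>
    'n set \<Rightarrow> ('v \<Rightarrow>\<^sub>L 'v)" where
  "op_coeff T = (THE TA. op_apply T = full_op TA)"

definition op_of :: "('n::{finite,linorder} set \<Rightarrow> ('v::real_normed_vector \<Rightarrow>\<^sub>L 'v)) \<Rightarrow>
    ('v, 'n) clifford_op" where
  "op_of TA = Abs_clifford_op (full_op TA)"

lemma op_apply_op_of [simp]: "op_apply (op_of TA) = full_op TA"
  unfolding op_of_def by (simp add: Abs_clifford_op_inverse)

lemma full_op_op_coeff [simp]: "full_op (op_coeff T) = op_apply T"
proof -
  obtain TA where "op_apply T = full_op TA" using op_apply[of T] by blast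
  then show ?thesis unfolding op_coeff_def by (simp add: full_op_inject)
qed

lemma op_coeff_eqI: "op_apply T = full_op TA \<Longrightarrow> op_coeff T = TA"
  by (metis full_op_inject full_op_op_coeff)

lemma op_coeff_op_of [simp]: "op_coeff (op_of TA) = TA"
  by (rule op_coeff_eqI) simp

lemma op_apply_nth:
  "op_apply T v $ C
     = (\<Sum>A\<in>UNIV. csgn A (sym_diff A C) *\<^sub>R op_coeff T A (v $ sym_diff A C))"
  by (subst full_op_op_coeff[symmetric]) (rule full_op_nth)

lemma op_eq_iff: "S = T \<longleftrightarrow> op_coeff S = op_coeff T"
  by (metis full_op_op_coeff op_apply_inject)

lemma op_of_op_coeff [simp]: "op_of (op_coeff T) = T"
  by (simp add: op_eq_iff)

instantiation clifford_op :: (real_normed_vector, "{finite,linorder}") real_vector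
begin

lift_definition zero_clifford_op :: "('a, 'b) clifford_op" is "\<lambda>v. 0"
proof -
  have "(\<lambda>v. 0) = full_op (\<lambda>A. 0 :: 'a \<Rightarrow>\<^sub>L 'a)" by (auto simp: vec_eq_iff full_op_nth)
  then show "(\<lambda>v::'a ^ 'b set. 0 :: 'a ^ 'b set) \<in> range full_op" by blast
qed

lift_definition plus_clifford_op ::
  "('a, 'b) clifford_op \<Rightarrow> ('a, 'b) clifford_op \<Rightarrow> ('a, 'b) clifford_op" is "\<lambda>S T v. S v + T v"
proof -
  fix S T :: "'a ^ 'b set \<Rightarrow> 'a ^ 'b set"
  assume "S \<in> range full_op" "T \<in> range full_op"
  then obtain SA TA where "S = full_op SA" "T = full_op TA" by blast
  then have "(\<lambda>v. S v + T v) = full_op (\<lambda>A. SA A + TA A)"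
    by (auto simp: vec_eq_iff full_op_nth blinfun.add_left scaleR_add_right sum.distrib)
  then show "(\<lambda>v. S v + T v) \<in> range full_op" by blast
qed

lift_definition scaleR_clifford_op :: "real \<Rightarrow> ('a, 'b) clifford_op \<Rightarrow> ('a, 'b) clifford_op"
  is "\<lambda>r T v. r *\<^sub>R T v"
proof -
  fix r and T :: "'a ^ 'b set \<Rightarrow> 'a ^ 'b set"
  assume "T \<in> range full_op"
  then obtain TA where "T = full_op TA" by blast
  then have "(\<lambda>v. r *\<^sub>R T v) = full_op (\<lambda>A. r *\<^sub>R TA A)"
    by (auto simp: vec_eq_iff full_op_nth blinfun.scaleR_left scaleR_sum_right mult.commute)
  then show "(\<lambda>v. r *\<^sub>R T v) \<in> range full_op" by blast
qed

definition uminus_clifford_op :: "('a, 'b) clifford_op \<Rightarrow> ('a, 'b) clifford_op" where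
  "uminus_clifford_op T = (-1) *\<^sub>R T"

definition minus_clifford_op ::
  "('a, 'b) clifford_op \<Rightarrow> ('a, 'b) clifford_op \<Rightarrow> ('a, 'b) clifford_op" where
  "minus_clifford_op S T = S + (-1) *\<^sub>R T"

instance
  by standard
    (auto simp: uminus_clifford_op_def minus_clifford_op_def algebra_simps
      op_apply_inject[symmetric] plus_clifford_op.rep_eq zero_clifford_op.rep_eq
      scaleR_clifford_op.rep_eq fun_eq_iff)

end

lemma op_coeff_zero: "op_coeff 0 = (\<lambda>A. 0)"
  by (rule op_coeff_eqI) (auto simp: zero_clifford_op.rep_eq vec_eq_iff full_op_nth)

lemma op_coeff_add: "op_coeff (S + T) = (\<lambda>A. op_coeff S A + op_coeff T A)"
  by (rule op_coeff_eqI)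
    (auto simp: plus_clifford_op.rep_eq vec_eq_iff full_op_nth op_apply_nth blinfun.add_left
      scaleR_add_right sum.distrib)

lemma op_coeff_scaleR: "op_coeff (r *\<^sub>R T) = (\<lambda>A. r *\<^sub>R op_coeff T A)"
  by (rule op_coeff_eqI)
    (auto simp: scaleR_clifford_op.rep_eq vec_eq_iff full_op_nth op_apply_nth blinfun.scaleR_left
      scaleR_sum_right mult.commute)

lemma op_coeff_uminus: "op_coeff (- T) = (\<lambda>A. - op_coeff T A)"
  unfolding uminus_clifford_op_def op_coeff_scaleR by simp

lemma op_coeff_diff: "op_coeff (S - T) = (\<lambda>A. op_coeff S A - op_coeff T A)"
  unfolding minus_clifford_op_def op_coeff_add op_coeff_scaleR by simp

instantiation clifford_op :: (real_normed_vector, "{finite,linorder}") real_normed_vector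
begin

definition norm_clifford_op :: "('a, 'b) clifford_op \<Rightarrow> real" where
  "norm_clifford_op T = (\<Sum>A\<in>UNIV. norm (op_coeff T A))"

definition dist_clifford_op :: "('a, 'b) clifford_op \<Rightarrow> ('a, 'b) clifford_op \<Rightarrow> real" where
  "dist_clifford_op S T = norm (S - T)"

definition sgn_clifford_op :: "('a, 'b) clifford_op \<Rightarrow> ('a, 'b) clifford_op" where
  "sgn_clifford_op T = inverse (norm T) *\<^sub>R T"

definition uniformity_clifford_op :: "(('a, 'b) clifford_op \<times> ('a, 'b) clifford_op) filter" where
  "uniformity_clifford_op = (INF e\<in>{0 <..}. principal {(S, T). dist S T < e})"

definition open_clifford_op :: "('a, 'b) clifford_op set \<Rightarrow> bool" where
  "open_clifford_op U = (\<forall>S\<in>U. eventually (\<lambda>(S', T). S' = S \<longrightarrow> T \<in> U) uniformity)"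

instance
proof
  fix S T :: "('a, 'b) clifford_op" and r :: real
  show "norm T = 0 \<longleftrightarrow> T = 0"
    by (auto simp: norm_clifford_op_def sum_nonneg_eq_0_iff op_eq_iff op_coeff_zero fun_eq_iff)
  show "norm (S + T) \<le> norm S + norm T"
    unfolding norm_clifford_op_def sum.distrib[symmetric]
    by (intro sum_mono) (simp add: op_coeff_add norm_triangle_ineq)
  show "norm (r *\<^sub>R T) = \<bar>r\<bar> * norm T"
    by (simp add: norm_clifford_op_def op_coeff_scaleR sum_distrib_left)
qed (simp_all add: dist_clifford_op_def sgn_clifford_op_def uniformity_clifford_op_def
    open_clifford_op_def)

end

lemma norm_op_coeff_le: "norm (op_coeff T A) \<le> norm T"
  unfolding norm_clifford_op_def by (rule member_le_sum) auto

instance clifford_op :: (banach, "{finite,linorder}") banach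
proof
  fix X :: "nat \<Rightarrow> ('a, 'b) clifford_op"
  assume X: "Cauchy X"
  have "Cauchy (\<lambda>k. op_coeff (X k) A)" for A
  proof (rule CauchyI)
    fix e :: real assume "e > 0"
    with X obtain M where M: "\<And>m n. m \<ge> M \<Longrightarrow> n \<ge> M \<Longrightarrow> norm (X m - X n) < e"
      by (meson CauchyD)
    have "norm (op_coeff (X m) A - op_coeff (X n) A) < e" if "m \<ge> M" "n \<ge> M" for m n
      using M[OF that] norm_op_coeff_le[of "X m - X n" A] by (simp add: op_coeff_diff)
    then show "\<exists>M. \<forall>m\<ge>M. \<forall>n\<ge>M. norm (op_coeff (X m) A - op_coeff (X n) A) < e" by blast
  qed
  then have "\<forall>A. \<exists>L. (\<lambda>k. op_coeff (X k) A) \<longlonglongrightarrow> L"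
    by (simp add: Cauchy_convergent_iff convergent_def)
  then obtain L where L: "\<And>A. (\<lambda>k. op_coeff (X k) A) \<longlonglongrightarrow> L A" by metis
  have "(\<lambda>k. \<Sum>A\<in>UNIV. norm (op_coeff (X k) A - L A)) \<longlonglongrightarrow> (\<Sum>A\<in>UNIV. norm (L A - L A))"
    by (intro tendsto_sum tendsto_norm tendsto_diff L tendsto_const)
  then have "(\<lambda>k. norm (X k - op_of L)) \<longlonglongrightarrow> 0"
    by (simp add: norm_clifford_op_def op_coeff_diff)
  then have "X \<longlonglongrightarrow> op_of L"
    by (simp add: LIM_zero_iff tendsto_norm_zero_iff flip: tendsto_norm_zero_iff[of "\<lambda>k. X k - op_of L"])
  then show "convergent X" by (auto simp: convergent_def)
qed

text \<open>The product is composition and the unit is the identity operator.\<close>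

instantiation clifford_op :: (real_normed_vector, "{finite,linorder}") "{real_normed_algebra,monoid_mult}"
begin

lift_definition times_clifford_op ::
  "('a, 'b) clifford_op \<Rightarrow> ('a, 'b) clifford_op \<Rightarrow> ('a, 'b) clifford_op" is "\<lambda>S T v. S (T v)"
proof -
  fix S T :: "'a ^ 'b set \<Rightarrow> 'a ^ 'b set"
  assume "S \<in> range full_op" "T \<in> range full_op"
  then obtain SA TA where "S = full_op SA" "T = full_op TA" by blast
  then have "(\<lambda>v. S (T v)) = full_op (comp_coeff SA TA)"
    by (simp add: full_op_comp)
  then show "(\<lambda>v. S (T v)) \<in> range full_op" by blast
qed

lift_definition one_clifford_op :: "('a, 'b) clifford_op" is "\<lambda>v. v"
proof -
  have "full_op (\<lambda>A. if A = {} then id_blinfun else 0) v = v" for v :: "'a ^ 'b set"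
  proof (subst vec_eq_iff, intro allI)
    fix C
    have "full_op (\<lambda>A. if A = {} then id_blinfun else 0) v $ C
        = (\<Sum>A\<in>(UNIV :: 'b set set). if A = {} then v $ C else 0)"
      unfolding full_op_nth by (rule sum.cong) auto
    then show "full_op (\<lambda>A. if A = {} then id_blinfun else 0) v $ C = v $ C" by simp
  qed
  then show "(\<lambda>v::'a ^ 'b set. v) \<in> range full_op"
    by (intro image_eqI[where x = "\<lambda>A. if A = {} then id_blinfun else 0"]) auto
qed

lemma op_coeff_times: "op_coeff (S * T) = comp_coeff (op_coeff S) (op_coeff T)"
  for S T :: "('a, 'b) clifford_op"
  by (rule op_coeff_eqI) (auto simp: times_clifford_op.rep_eq simp flip: full_op_comp)

instance
proof
  fix R S T :: "('a, 'b) clifford_op" and r :: real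
  show "R * S * T = R * (S * T)" by transfer simp
  show "1 * T = T" by transfer simp
  show "T * 1 = T" by transfer simp
  show "(R + S) * T = R * T + S * T" by transfer simp
  have lin: "op_apply R (v + w) = op_apply R v + op_apply R w"
      "op_apply R (r *\<^sub>R v) = r *\<^sub>R op_apply R v" for R :: "('a, 'b) clifford_op" and r v w
    by (simp_all add: vec_eq_iff op_apply_nth blinfun.add_right blinfun.scaleR_right
        scaleR_add_right sum.distrib scaleR_sum_right mult.commute)
  show "R * (S + T) = R * S + R * T"
    by (auto simp: op_apply_inject[symmetric] plus_clifford_op.rep_eq times_clifford_op.rep_eq lin)
  show "(r *\<^sub>R S) * T = r *\<^sub>R (S * T)"
    by (auto simp: op_apply_inject[symmetric] scaleR_clifford_op.rep_eq times_clifford_op.rep_eq)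
  show "S * (r *\<^sub>R T) = r *\<^sub>R (S * T)"
    by (auto simp: op_apply_inject[symmetric] scaleR_clifford_op.rep_eq times_clifford_op.rep_eq lin)
  have "norm (S * T) \<le> (\<Sum>C\<in>UNIV. \<Sum>A\<in>UNIV. norm (op_coeff S A) * norm (op_coeff T (sym_diff A C)))"
    unfolding norm_clifford_op_def op_coeff_times comp_coeff_def
  proof (intro sum_mono order_trans[OF norm_sum])
    fix A C
    show "norm (csgn A (sym_diff A C) *\<^sub>R (op_coeff S A o\<^sub>L op_coeff T (sym_diff A C)))
        \<le> norm (op_coeff S A) * norm (op_coeff T (sym_diff A C))"
      by (simp add: norm_blinfun_compose)
  qed
  also have "\<dots> = (\<Sum>A\<in>UNIV. \<Sum>C\<in>UNIV. norm (op_coeff S A) * norm (op_coeff T (sym_diff A C)))"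
    by (rule sum.swap)
  also have "\<dots> = norm S * norm T"
    unfolding norm_clifford_op_def sum_product
    by (rule sum.cong[OF refl], rule sum_sym_diff_reindex)
  finally show "norm (S * T) \<le> norm S * norm T" .
qed

end

text \<open>
  For \<open>a \<in> \<real>\<^sub>n\<close>, \<open>cscalar a\<close> is \<open>a \<I> = \<I> a\<close>, so that \<open>a T = cscalar a * T\<close> and
  \<open>T a = T * cscalar a\<close>.
\<close>

lift_definition cscalar :: "real ^ ('n::{finite,linorder} set) \<Rightarrow> ('v::real_normed_vector, 'n) clifford_op"
  is "\<lambda>a v. a \<odot> v"
proof -
  fix a :: "real ^ ('n set)"
  have "(\<lambda>v. a \<odot> v) = full_op (\<lambda>A. (a $ A) *\<^sub>R (id_blinfun :: 'v \<Rightarrow>\<^sub>L 'v))"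
    by (auto simp: vec_eq_iff cmult_nth full_op_nth blinfun.scaleR_left)
  then show "(\<lambda>v :: 'v ^ ('n set). a \<odot> v) \<in> range full_op" by blast
qed

lemma op_apply_cscalar_times [simp]:
  "op_apply (cscalar a * T) v = a \<odot> op_apply T v" "op_apply (T * cscalar a) v = op_apply T (a \<odot> v)"
  by (simp_all add: times_clifford_op.rep_eq cscalar.rep_eq)

section \<open>Paravectors\<close>

text \<open>
  \<open>\<real>\<^bsup>n+1\<^esup>\<close> is \<^typ>\<open>real \<times> (real ^ 'n)\<close>, whose product norm is the Euclidean one, and \<open>paravec\<close> is
  its identification with the set of paravectors. An element of \<open>\<S>\<close> is a unit vector \<open>j\<close> of
  \<^typ>\<open>real ^ 'n\<close>, and \<open>u + j v\<close> is the pair \<open>(u, v *\<^sub>R j)\<close>.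
\<close>

type_synonym 'n paravector = "real \<times> (real, 'n) vec"

definition paravec :: "('n::{finite,linorder}) paravector \<Rightarrow> real ^ ('n set)" where
  "paravec s = axis {} (fst s) + (\<Sum>l\<in>UNIV. axis {l} (snd s $ l))"

definition pconj :: "'n::finite paravector \<Rightarrow> 'n paravector" where
  "pconj s = (fst s, - snd s)"

abbreviation imag_units :: "(real ^ 'n) set" (\<open>\<S>\<close>) where
  "\<S> \<equiv> sphere 0 1"

definition slice_pt :: "real ^ 'n::finite \<Rightarrow> complex \<Rightarrow> 'n paravector" where
  "slice_pt j z = (Re z, Im z *\<^sub>R j)"

text \<open>\<open>slice U j\<close> is \<open>U \<inter> \<complex>\<^sub>j\<close>, with \<open>\<complex>\<^sub>j\<close> identified with \<open>\<complex>\<close> (isometrically) by \<open>slice_pt j\<close>.\<close>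

definition slice :: "'n::finite paravector set \<Rightarrow> real ^ 'n \<Rightarrow> complex set" where
  "slice U j = {z. slice_pt j z \<in> U}"

definition axially_symmetric :: "'n::finite paravector set \<Rightarrow> bool" where
  "axially_symmetric U \<longleftrightarrow>
     (\<forall>z. \<forall>i\<in>\<S>. slice_pt i z \<in> U \<longrightarrow> (\<forall>j\<in>\<S>. slice_pt j z \<in> U))"

section \<open>The S-spectrum and the S-resolvent operators\<close>

definition Q_op :: "('n::{finite,linorder}) paravector \<Rightarrow> ('v::real_normed_vector, 'n) clifford_op \<Rightarrow>
    ('v, 'n) clifford_op" where
  "Q_op s T = T ^ 2 - (2 * fst s) *\<^sub>R T + (norm s)\<^sup>2 *\<^sub>R 1"

definition op_inverse_of :: "('v::real_normed_vector, 'n::{finite,linorder}) clifford_op \<Rightarrow>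
    ('v, 'n) clifford_op \<Rightarrow> bool" where
  "op_inverse_of R P \<longleftrightarrow> P * R = 1 \<and> R * P = 1"

definition op_inv :: "('v::real_normed_vector, 'n::{finite,linorder}) clifford_op \<Rightarrow> ('v, 'n) clifford_op" where
  "op_inv P = (THE R. op_inverse_of R P)"

definition S_resolvent_set :: "('v::real_normed_vector, 'n::{finite,linorder}) clifford_op \<Rightarrow>
    'n paravector set" where
  "S_resolvent_set T = {s. \<exists>R. op_inverse_of R (Q_op s T)}"

definition S_spectrum :: "('v::real_normed_vector, 'n::{finite,linorder}) clifford_op \<Rightarrow>
    'n paravector set" where
  "S_spectrum T = - S_resolvent_set T"

definition SL_resolvent :: "('n::{finite,linorder}) paravector \<Rightarrow>
    ('v::real_normed_vector, 'n) clifford_op \<Rightarrow> ('v, 'n) clifford_op" where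
  "SL_resolvent s T = - (op_inv (Q_op s T) * (T - cscalar (paravec (pconj s))))"

definition SR_resolvent :: "('n::{finite,linorder}) paravector \<Rightarrow>
    ('v::real_normed_vector, 'n) clifford_op \<Rightarrow> ('v, 'n) clifford_op" where
  "SR_resolvent s T = - ((T - cscalar (paravec (pconj s))) * op_inv (Q_op s T))"

section \<open>Slice monogenic functions\<close>

text \<open>\<open>g\<close> is of class \<open>C\<^sup>1\<close> on the (open) set \<open>P\<close> with partial derivatives \<open>gu\<close> and \<open>gv\<close>.\<close>

definition C1_partials :: "(real \<times> real) set \<Rightarrow> (real \<Rightarrow> real \<Rightarrow> 'b::real_normed_vector) \<Rightarrow>
    (real \<Rightarrow> real \<Rightarrow> 'b) \<Rightarrow> (real \<Rightarrow> real \<Rightarrow> 'b) \<Rightarrow> bool" where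
  "C1_partials P g gu gv \<longleftrightarrow>
     (\<forall>(u, v)\<in>P. ((\<lambda>x. g x v) has_vector_derivative gu u v) (at u) \<and>
                 ((\<lambda>y. g u y) has_vector_derivative gv u v) (at v)) \<and>
     continuous_on P (\<lambda>(u, v). gu u v) \<and> continuous_on P (\<lambda>(u, v). gv u v)"

definition slice_plane :: "'n::finite paravector set \<Rightarrow> (real \<times> real) set" where
  "slice_plane U = {(u, v). \<exists>j\<in>\<S>. (u, v *\<^sub>R j) \<in> U}"

definition slice_components :: "('n::{finite,linorder}) paravector set \<Rightarrow>
    (real \<Rightarrow> real \<Rightarrow> real ^ ('n set)) \<Rightarrow> (real \<Rightarrow> real \<Rightarrow> real ^ ('n set)) \<Rightarrow> bool" where
  "slice_components U f0 f1 \<longleftrightarrow>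
     (\<forall>(u, v)\<in>slice_plane U. f0 u (- v) = f0 u v \<and> f1 u (- v) = - f1 u v) \<and>
     (\<exists>f0u f0v f1u f1v.
        C1_partials (slice_plane U) f0 f0u f0v \<and> C1_partials (slice_plane U) f1 f1u f1v \<and>
        (\<forall>(u, v)\<in>slice_plane U. f0u u v = f1v u v \<and> f0v u v = - f1u u v))"

definition left_slice_monogenic :: "('n::{finite,linorder}) paravector set \<Rightarrow>
    ('n paravector \<Rightarrow> real ^ ('n set)) \<Rightarrow> bool" where
  "left_slice_monogenic U f \<longleftrightarrow> open U \<and> axially_symmetric U \<and>
     (\<exists>f0 f1. slice_components U f0 f1 \<and>
        (\<forall>u v. \<forall>j\<in>\<S>. (u, v *\<^sub>R j) \<in> U \<longrightarrow>
           f (u, v *\<^sub>R j) = f0 u v + paravec (0, j) \<odot> f1 u v))"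

definition right_slice_monogenic :: "('n::{finite,linorder}) paravector set \<Rightarrow>
    ('n paravector \<Rightarrow> real ^ ('n set)) \<Rightarrow> bool" where
  "right_slice_monogenic U f \<longleftrightarrow> open U \<and> axially_symmetric U \<and>
     (\<exists>f0 f1. slice_components U f0 f1 \<and>
        (\<forall>u v. \<forall>j\<in>\<S>. (u, v *\<^sub>R j) \<in> U \<longrightarrow>
           f (u, v *\<^sub>R j) = f0 u v + f1 u v \<odot> paravec (0, j)))"

section \<open>Slice Cauchy domains and their boundary integrals\<close>

definition Jordan_boundary :: "complex set \<Rightarrow> (real \<Rightarrow> complex) set \<Rightarrow> bool" where
  "Jordan_boundary D \<Gamma> \<longleftrightarrow> finite \<Gamma> \<and>
     (\<forall>\<gamma>\<in>\<Gamma>. valid_path \<gamma> \<and> simple_path \<gamma> \<and> pathfinish \<gamma> = pathstart \<gamma>) \<and>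
     disjoint_family_on path_image \<Gamma> \<and>
     (\<Union>\<gamma>\<in>\<Gamma>. path_image \<gamma>) = frontier D"

definition slice_Cauchy_domain :: "'n::finite paravector set \<Rightarrow> bool" where
  "slice_Cauchy_domain U \<longleftrightarrow> open U \<and> axially_symmetric U \<and>
     (\<forall>j\<in>\<S>. \<exists>\<Gamma>. Jordan_boundary (slice U j) \<Gamma>)"

text \<open>
  Positive orientation of the whole boundary (outer curves counterclockwise, inner ones
  clockwise): the cycle has winding number 1 about the points of \<open>D\<close> and 0 about the points
  outside its closure.
\<close>

definition positively_oriented_boundary :: "complex set \<Rightarrow> (real \<Rightarrow> complex) set \<Rightarrow> bool" where
  "positively_oriented_boundary D \<Gamma> \<longleftrightarrow> Jordan_boundary D \<Gamma> \<and>
     (\<forall>z\<in>D. (\<Sum>\<gamma>\<in>\<Gamma>. winding_number \<gamma> z) = 1) \<and>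
     (\<forall>z. z \<notin> closure D \<longrightarrow> (\<Sum>\<gamma>\<in>\<Gamma>. winding_number \<gamma> z) = 0)"

text \<open>\<open>ds\<^sub>j = ds (-j)\<close> for the increment \<open>ds = slice_pt j w\<close> in \<open>\<complex>\<^sub>j\<close>.\<close>

definition ds :: "real ^ 'n::{finite,linorder} \<Rightarrow> complex \<Rightarrow> real ^ ('n set)" where
  "ds j w = paravec (slice_pt j w) \<odot> (- paravec (0, j))"

definition left_integrand :: "('v::real_normed_vector, 'n::{finite,linorder}) clifford_op \<Rightarrow>
    ('n paravector \<Rightarrow> real ^ ('n set)) \<Rightarrow> (real, 'n) vec \<Rightarrow> (real \<Rightarrow> complex) \<Rightarrow> real \<Rightarrow>
    ('v, 'n) clifford_op" where
  "left_integrand T f j \<gamma> t =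
     SL_resolvent (slice_pt j (\<gamma> t)) T
       * cscalar (ds j (vector_derivative \<gamma> (at t within {0..1})))
       * cscalar (f (slice_pt j (\<gamma> t)))"

definition right_integrand :: "('v::real_normed_vector, 'n::{finite,linorder}) clifford_op \<Rightarrow>
    ('n paravector \<Rightarrow> real ^ ('n set)) \<Rightarrow> (real, 'n) vec \<Rightarrow> (real \<Rightarrow> complex) \<Rightarrow> real \<Rightarrow>
    ('v, 'n) clifford_op" where
  "right_integrand T f j \<gamma> t =
     cscalar (f (slice_pt j (\<gamma> t)))
       * cscalar (ds j (vector_derivative \<gamma> (at t within {0..1})))
       * SR_resolvent (slice_pt j (\<gamma> t)) T"

definition left_calculus :: "('v::real_normed_vector, 'n::{finite,linorder}) clifford_op \<Rightarrow>
    ('n paravector \<Rightarrow> real ^ ('n set)) \<Rightarrow> (real, 'n) vec \<Rightarrow> (real \<Rightarrow> complex) set \<Rightarrow>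
    ('v, 'n) clifford_op" where
  "left_calculus T f j \<Gamma> = (1 / (2 * pi)) *\<^sub>R (\<Sum>\<gamma>\<in>\<Gamma>. integral {0..1} (left_integrand T f j \<gamma>))"

definition right_calculus :: "('v::real_normed_vector, 'n::{finite,linorder}) clifford_op \<Rightarrow>
    ('n paravector \<Rightarrow> real ^ ('n set)) \<Rightarrow> (real, 'n) vec \<Rightarrow> (real \<Rightarrow> complex) set \<Rightarrow>
    ('v, 'n) clifford_op" where
  "right_calculus T f j \<Gamma> = (1 / (2 * pi)) *\<^sub>R (\<Sum>\<gamma>\<in>\<Gamma>. integral {0..1} (right_integrand T f j \<gamma>))"

text \<open>
  The choices in the functional calculus of \<open>T\<close> for a function with domain \<open>D\<close>: a domain \<open>U\<close>,
  an imaginary unit \<open>j\<close>, and a parametrization \<open>\<Gamma>\<close> of the boundary of \<open>U \<inter> \<complex>\<^sub>j\<close>.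
\<close>

definition admissible :: "('v::real_normed_vector, 'n::{finite,linorder}) clifford_op \<Rightarrow>
    'n paravector set \<Rightarrow> 'n paravector set \<Rightarrow> (real, 'n) vec \<Rightarrow>
    (real \<Rightarrow> complex) set \<Rightarrow> bool" where
  "admissible T D U j \<Gamma> \<longleftrightarrow>
     slice_Cauchy_domain U \<and> bounded U \<and> S_spectrum T \<subseteq> U \<and> closure U \<subseteq> D \<and>
     j \<in> \<S> \<and> positively_oriented_boundary (slice U j) \<Gamma>"

end

theory Submission
  imports Defs "HOL-Complex_Analysis.Cauchy_Integral_Formula"
begin

text \<open>
  Fix \<open>j \<in> \<S>\<close>. In the Banach algebra of full Clifford operators \<open>j\<close> is an element \<open>J\<close> with
  \<open>J\<^sup>2 = -1\<close>. In the plane \<open>\<complex>\<^sub>j\<close> a left slice monogenic \<open>f\<close> is \<open>F = f\<^sub>0 + J f\<^sub>1\<close>, and the left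
  S-resolvent is \<open>X = r\<^sub>0 + r\<^sub>1 J\<close>, where \<open>r\<^sub>0 = -(T - u) Q\<^sup>-\<^sup>1\<close> and \<open>r\<^sub>1 = -v Q\<^sup>-\<^sup>1\<close>. Both pairs have the
  same three properties (\<open>slice_pair\<close>): they do not involve \<open>j\<close>, the first component is even in \<open>v\<close>
  and the second odd, and they satisfy the Cauchy-Riemann equations. For the resolvent the
  reason is that \<open>Q = (T - u)\<^sup>2 + v\<^sup>2\<close>, so that \<open>r\<^sub>0 + i r\<^sub>1\<close> is the classical resolvent
  \<open>(u + i v - T)\<^sup>-\<^sup>1\<close> in the complexified algebra. The integrand is \<open>X ds (-J) F\<close>. For right slice
  monogenic functions the integrand has the same shape, with the two pairs exchanged, so both halves
  of the theorem are one statement about two slice pairs (\<open>slice_form_integral_independent\<close>).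

  Independence of \<open>U\<close> for fixed \<open>j\<close>. The Cauchy-Riemann equations say that \<open>X\<close> has derivative
  \<open>w \<mapsto> X' w\<close> and \<open>F\<close> has derivative \<open>w \<mapsto> w F'\<close>, with \<open>w \<in> \<real> + \<real> J\<close>. Hence for every bounded real
  functional \<open>\<phi>\<close> the complex function \<open>\<phi> (X F) - i \<phi> (X J F)\<close> is holomorphic in the ordinary
  sense (\<open>holomorphic_form_mult\<close>), and \<open>\<phi>\<close> of the operator integral is the real part of a contour
  integral. The functions are defined on \<open>W\<close>, the part of \<open>dom f \<inter> \<complex>\<^sub>j\<close> outside the spectrum, and
  outside \<open>W\<close> the boundaries of two admissible domains have the same winding numbers: 1 about
  spectral points, 0 about points outside \<open>dom f\<close>. So the Cauchy theorem makes the two values of \<open>\<phi>\<close>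
  equal, and enough functionals exist by the Hahn-Banach argument. Since \<open>W\<close> may be disconnected, the
  boundaries cannot be joined to a single closed path, and the Cauchy theorem is needed for cycles.

  Independence of \<open>j\<close>. The set \<open>W\<close> is the same for all \<open>j\<close> and is symmetric about the real axis.
  Conjugation turns the integrand for \<open>j\<close> into minus the one for \<open>-j\<close>, and it turns the boundary of
  \<open>U \<inter> \<complex>\<^sub>j\<close> into a boundary of its mirror image with reversed orientation. The two signs cancel, and
  by the first part the integrals for \<open>j\<close> and \<open>-j\<close> agree. But when the integrand is expanded, the factors \<open>J\<close> of each term stand side
  by side. In the sum of the integrands for \<open>j\<close> and \<open>-j\<close> the odd powers of \<open>J\<close> cancel and the even
  powers are scalars, so this sum is the same for all \<open>j\<close>.
\<close>

section \<open>Linear functionals separate points\<close>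

text \<open>
  The bound by the norm is built in, so that a linear functional of this kind is automatically
  bounded.
\<close>

definition sublinear_functional :: "('a::real_normed_vector \<Rightarrow> real) \<Rightarrow> bool" where
  "sublinear_functional p \<longleftrightarrow>
     (\<forall>x y. p (x + y) \<le> p x + p y) \<and> (\<forall>c x. 0 < c \<longrightarrow> p (c *\<^sub>R x) = c * p x) \<and> (\<forall>x. p x \<le> norm x)"

lemma sublinear_functionalD:
  assumes "sublinear_functional p"
  shows "p (x + y) \<le> p x + p y" "0 < c \<Longrightarrow> p (c *\<^sub>R x) = c * p x" "p x \<le> norm x"
    "p 0 = 0" "- norm x \<le> p x"
proof -
  show sub: "p (x + y) \<le> p x + p y" and hom: "0 < c \<Longrightarrow> p (c *\<^sub>R x) = c * p x" 
    and le: "p x \<le> norm x" for x y c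
    using assms unfolding sublinear_functional_def by auto
  show p0: "p 0 = 0"
    using hom[of 2 0] by simp
  show "- norm x \<le> p x"
    using sub[of x "- x"] le[of "- x"] p0 by simp
qed

text \<open>
  The largest sublinear functional below \<open>p\<close> that takes the value \<open>- p y\<close> at \<open>- y\<close>; hence
  it is linear on the line spanned by \<open>y\<close>.
\<close>

definition lower_envelope :: "('a::real_normed_vector \<Rightarrow> real) \<Rightarrow> 'a \<Rightarrow> 'a \<Rightarrow> real" where
  "lower_envelope p y z = (INF t\<in>{0..}. p (z + t *\<^sub>R y) - t * p y)"

lemma sublinear_lower_envelope:
  assumes p: "sublinear_functional p"
  shows "sublinear_functional (lower_envelope p y)"
    "0 \<le> t \<Longrightarrow> lower_envelope p y z \<le> p (z + t *\<^sub>R y) - t * p y"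
proof -
  note [simp] = sublinear_functionalD(4)[OF p]
  have hom: "p (c *\<^sub>R x) = c * p x" if "0 \<le> c" for c x
    using sublinear_functionalD(2)[OF p, of c x] that by (cases "c = 0") auto
  have bdd: "bdd_below ((\<lambda>t. p (z + t *\<^sub>R y) - t * p y) ` {0..})" for z
  proof (rule bdd_belowI2)
    fix t :: real assume "t \<in> {0..}"
    then have "t * p y = p (t *\<^sub>R y)" by (simp add: hom)
    also have "\<dots> \<le> p (z + t *\<^sub>R y) + p (- z)"
      using sublinear_functionalD(1)[OF p, of "z + t *\<^sub>R y" "- z"] by simp
    finally show "- p (- z) \<le> p (z + t *\<^sub>R y) - t * p y" by simp
  qed
  show le: "0 \<le> t \<Longrightarrow> lower_envelope p y z \<le> p (z + t *\<^sub>R y) - t * p y" for z t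
    unfolding lower_envelope_def by (intro cINF_lower bdd) auto
  have ge: "a \<le> lower_envelope p y z" if "\<And>t. 0 \<le> t \<Longrightarrow> a \<le> p (z + t *\<^sub>R y) - t * p y" for a z
    unfolding lower_envelope_def using that by (intro cINF_greatest) auto
  show "sublinear_functional (lower_envelope p y)"
    unfolding sublinear_functional_def
  proof (intro conjI allI impI)
    fix x z :: 'a
    have "lower_envelope p y (x + z) - (p (z + t *\<^sub>R y) - t * p y) \<le> p (x + s *\<^sub>R y) - s * p y"
      if "0 \<le> s" "0 \<le> t" for s t
    proof -
      have "lower_envelope p y (x + z) \<le> p ((x + s *\<^sub>R y) + (z + t *\<^sub>R y)) - (s + t) * p y"
        using le[of "s + t" "x + z"] that by (simp add: algebra_simps)
      also have "\<dots> \<le> p (x + s *\<^sub>R y) + p (z + t *\<^sub>R y) - (s + t) * p y"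
        using sublinear_functionalD(1)[OF p] by (intro diff_right_mono)
      finally show ?thesis by (simp add: algebra_simps)
    qed
    then have "lower_envelope p y (x + z) - (p (z + t *\<^sub>R y) - t * p y) \<le> lower_envelope p y x" if "0 \<le> t" for t
      using that by (intro ge) auto
    then have "lower_envelope p y (x + z) - lower_envelope p y x \<le> lower_envelope p y z"
      by (intro ge) (simp add: algebra_simps)
    then show "lower_envelope p y (x + z) \<le> lower_envelope p y x + lower_envelope p y z" by simp
  next
    fix c :: real and x :: 'a
    assume c: "0 < c"
    have half: "c * lower_envelope p y x \<le> lower_envelope p y (c *\<^sub>R x)" if "0 < c" for c x
    proof (rule ge)
      fix t :: real assume t: "0 \<le> t"
      have "c * lower_envelope p y x \<le> c * (p (x + (t / c) *\<^sub>R y) - (t / c) * p y)"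
        using le[of "t / c" x] t that by (intro mult_left_mono) auto
      also have "\<dots> = p (c *\<^sub>R (x + (t / c) *\<^sub>R y)) - t * p y"
        using that by (simp add: hom right_diff_distrib)
      also have "c *\<^sub>R (x + (t / c) *\<^sub>R y) = c *\<^sub>R x + t *\<^sub>R y"
        using that by (simp add: algebra_simps)
      finally show "c * lower_envelope p y x \<le> p (c *\<^sub>R x + t *\<^sub>R y) - t * p y" .
    qed
    have "lower_envelope p y (c *\<^sub>R x) \<le> c * lower_envelope p y x"
      using half[of "1 / c" "c *\<^sub>R x"] c by (simp add: field_simps)
    then show "lower_envelope p y (c *\<^sub>R x) = c * lower_envelope p y x"
      using half[OF c, of x] by simp
  next
    show "lower_envelope p y x \<le> norm x" for x
      using le[of 0 x] sublinear_functionalD(3)[OF p, of x] by simp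
  qed
qed

lemma sublinear_chain_Inf:
  assumes "C \<noteq> {}" and sl: "\<And>p. p \<in> C \<Longrightarrow> sublinear_functional p"
    and chain: "\<And>p q. p \<in> C \<Longrightarrow> q \<in> C \<Longrightarrow> p \<le> q \<or> q \<le> p"
  defines "m \<equiv> \<lambda>x. INF p\<in>C. p x"
  shows "sublinear_functional m" "\<And>p. p \<in> C \<Longrightarrow> m \<le> p"
proof -
  have bdd: "bdd_below ((\<lambda>p. p x) ` C)" for x
    using sublinear_functionalD(5)[OF sl] by (intro bdd_belowI2[of _ "- norm x"])
  have le: "m x \<le> p x" if "p \<in> C" for p x
    unfolding m_def using that by (intro cINF_lower bdd)
  have ge: "a \<le> m x" if "\<And>p. p \<in> C \<Longrightarrow> a \<le> p x" for a x
    unfolding m_def using that \<open>C \<noteq> {}\<close> by (intro cINF_greatest)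
  show "m \<le> p" if "p \<in> C" for p
    using le that by (simp add: le_fun_def)
  show "sublinear_functional m"
    unfolding sublinear_functional_def
  proof (intro conjI allI impI)
    fix x y
    have "m (x + y) - q y \<le> p x" if pq: "p \<in> C" "q \<in> C" for p q
    proof -
      obtain r where r: "r \<in> C" "r x \<le> p x" "r y \<le> q y"
        using chain[OF pq] pq by (auto simp: le_fun_def)
      then show ?thesis
        using le[of r "x + y"] sublinear_functionalD(1)[OF sl, of r x y] by simp
    qed
    then have "m (x + y) - q y \<le> m x" if "q \<in> C" for q
      using that by (intro ge)
    then have "m (x + y) - m x \<le> m y"
      by (intro ge) (simp add: algebra_simps)
    then show "m (x + y) \<le> m x + m y" by simp
  next
    fix c :: real and x
    assume c: "0 < c"
    have half: "c * m x \<le> m (c *\<^sub>R x)" if "0 < c" for c x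
      using le[of _ x] that by (intro ge) (simp add: sublinear_functionalD(2)[OF sl])
    show "m (c *\<^sub>R x) = c * m x"
      using half[OF c, of x] half[of "1 / c" "c *\<^sub>R x"] c by (simp add: field_simps)
  next
    fix x
    obtain p where "p \<in> C" using \<open>C \<noteq> {}\<close> by blast
    then show "m x \<le> norm x"
      using le[of p x] sublinear_functionalD(3)[OF sl, of p x] by simp
  qed
qed

text \<open>
  By minimality \<open>p\<close> coincides with all its lower envelopes, and \<open>p z \<le> p (z + y) - p y\<close> is the
  missing half of additivity.
\<close>

lemma minimal_sublinear_is_linear:
  assumes p: "sublinear_functional p"
    and min: "\<And>q. sublinear_functional q \<Longrightarrow> q \<le> p \<Longrightarrow> q = p"
  shows "bounded_linear p"
proof -
  have add: "p (x + y) = p x + p y" for x y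
  proof -
    note le = sublinear_lower_envelope(2)[OF p, where y = y]
    have "lower_envelope p y = p"
      using le[of 0] by (intro min sublinear_lower_envelope(1)[OF p] le_funI) simp
    then show ?thesis
      using le[of 1 x] sublinear_functionalD(1)[OF p, of x y] by simp
  qed
  have neg: "p (- x) = - p x" for x
    using add[of x "- x"] sublinear_functionalD(4)[OF p] by simp
  have scale: "p (c *\<^sub>R x) = c * p x" for c x
  proof (cases c "0 :: real" rule: linorder_cases)
    case less
    then show ?thesis
      using sublinear_functionalD(2)[OF p, of "- c" x] neg[of "c *\<^sub>R x"] by simp
  qed (auto simp: sublinear_functionalD[OF p])
  have "norm (p x) \<le> norm x * 1" for x
    using sublinear_functionalD(3,5)[OF p, of x] by simp
  then show ?thesis
    using add scale by (intro bounded_linear_intro[where K = 1]) auto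
qed

text \<open>
  The separation form of the Hahn-Banach theorem. Below the lower envelope of the norm at \<open>x\<close>,
  which is at most \<open>- norm x\<close> at \<open>- x\<close>, Zorn's lemma yields a minimal sublinear functional.
  It is linear and negative at \<open>- x\<close>.
\<close>

theorem bounded_linear_separates:
  fixes x :: "'a::real_normed_vector"
  assumes "x \<noteq> 0"
  obtains \<phi> :: "'a \<Rightarrow> real" where "bounded_linear \<phi>" "\<phi> x \<noteq> 0"
proof -
  define q where "q = lower_envelope norm x"
  have norm: "sublinear_functional (norm :: 'a \<Rightarrow> real)"
    by (auto simp: sublinear_functional_def norm_triangle_ineq)
  have q: "sublinear_functional q" "q (- x) \<le> - norm x"
    using sublinear_lower_envelope(1)[OF norm] sublinear_lower_envelope(2)[OF norm, where t = 1 and y = x and z = "- x"]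
    unfolding q_def by auto
  define S where "S = {p. sublinear_functional p \<and> p \<le> q}"
  \<comment> \<open>Zorn for the reversed order: a chain is bounded by its pointwise infimum.\<close>
  have "\<exists>m\<in>S. \<forall>p\<in>S. p \<le> m \<longrightarrow> p = m"
  proof (rule predicate_Zorn[where P = "\<lambda>p r. r \<le> p"])
    show "partial_order_on S (relation_of (\<lambda>p r. r \<le> p) S)"
      by (rule partial_order_on_relation_ofI) auto
    fix C assume C: "C \<in> Chains (relation_of (\<lambda>p r. r \<le> p) S)"
    then have CS: "C \<subseteq> S" and chain: "\<And>p r. p \<in> C \<Longrightarrow> r \<in> C \<Longrightarrow> p \<le> r \<or> r \<le> p"
      by (auto simp: Chains_def relation_of_def)
    show "\<exists>u\<in>S. \<forall>p\<in>C. u \<le> p"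
    proof (cases "C = {}")
      case True
      with q show ?thesis by (auto simp: S_def)
    next
      case False
      define m where "m = (\<lambda>x. INF p\<in>C. p x)"
      have m: "sublinear_functional m" "\<And>p. p \<in> C \<Longrightarrow> m \<le> p"
        using sublinear_chain_Inf[OF False _ chain] CS unfolding m_def S_def by blast+
      obtain p where "p \<in> C" using False by blast
      then have "m \<le> q" using m(2)[of p] CS by (auto simp: S_def)
      with m show ?thesis by (auto simp: S_def)
    qed
  qed
  then obtain \<phi> where \<phi>: "\<phi> \<in> S" and min: "\<And>p. p \<in> S \<Longrightarrow> p \<le> \<phi> \<Longrightarrow> p = \<phi>" by blast
  have "bounded_linear \<phi>"
    using \<phi> min by (intro minimal_sublinear_is_linear) (auto simp: S_def)
  moreover have "\<phi> (- x) \<le> q (- x)" using \<phi> by (auto simp: S_def le_fun_def)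
  then have "\<phi> (- x) < 0" using q(2) assms by (smt (verit) zero_less_norm_iff)
  then have "\<phi> x \<noteq> 0"
    using linear_neg[OF bounded_linear.linear[OF \<open>bounded_linear \<phi>\<close>], of x] by auto
  ultimately show ?thesis by (rule that)
qed

section \<open>The Cauchy theorem for cycles\<close>

text \<open>
  Dixon's kernel. Its integral over a cycle is the Cauchy integral of \<open>f\<close> minus
  \<open>2 \<pi> \<i> f z\<close> times the winding number, but it stays meaningful for \<open>z\<close> on the cycle.
\<close>

definition diff_quot :: "(complex \<Rightarrow> complex) \<Rightarrow> complex \<Rightarrow> complex \<Rightarrow> complex" where
  "diff_quot f z w = (if w = z then deriv f z else (f w - f z) / (w - z))"

lemma diff_quot_sym: "diff_quot f z w = diff_quot f w z"
  unfolding diff_quot_def by (auto simp: divide_simps) (auto simp: algebra_simps)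

lemma diff_quot_holomorphic:
  assumes "f holomorphic_on W" "open W"
  shows "diff_quot f z holomorphic_on W" "(\<lambda>z. diff_quot f z w) holomorphic_on W"
proof -
  have "diff_quot f z = (\<lambda>w. if w = z then deriv f z else (f w - f z) / (w - z))" for z
    by (auto simp: diff_quot_def)
  then show *: "diff_quot f z holomorphic_on W" for z
    using pole_lemma_open[OF assms, of z] by metis
  show "(\<lambda>z. diff_quot f z w) holomorphic_on W"
    using *[of w] by (simp add: diff_quot_sym[of f _ w])
qed

text \<open>
  This representation is also valid on the diagonal, from which joint continuity there is evident.
\<close>

lemma diff_quot_convex:
  assumes f: "f holomorphic_on B" "open B" "convex B" and zw: "z \<in> B" "w \<in> B"
  shows "diff_quot f z w = integral {0..1} (\<lambda>t. deriv f (linepath z w t))"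
proof (cases "w = z")
  case False
  have seg: "path_image (linepath z w) \<subseteq> B"
    using f(3) zw by (simp add: closed_segment_subset)
  have "(deriv f has_contour_integral (f w - f z)) (linepath z w)"
    using contour_integral_primitive[OF _ valid_path_linepath seg, of f "deriv f"]
      holomorphic_derivI[OF f(1,2)] by auto
  then have "((\<lambda>t. deriv f (linepath z w t) * (w - z)) has_integral (f w - f z)) {0..1}"
    by (simp add: has_contour_integral_linepath)
  then have "((\<lambda>t. deriv f (linepath z w t) * (w - z) * (1 / (w - z)))
      has_integral (f w - f z) * (1 / (w - z))) {0..1}"
    by (rule has_integral_mult_left)
  then have "((\<lambda>t. deriv f (linepath z w t)) has_integral diff_quot f z w) {0..1}"
    using False by (simp add: diff_quot_def)
  then show ?thesis by (simp add: integral_unique)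
qed (simp add: diff_quot_def)

lemma diff_quot_continuous:
  assumes f: "f holomorphic_on W" "open W"
  shows "continuous_on (W \<times> W) (\<lambda>(z, w). diff_quot f z w)"
proof -
  have "isCont (\<lambda>(z, w). diff_quot f z w) (z, w)" if zw: "z \<in> W" "w \<in> W" for z w
  proof (cases "z = w")
    case True
    obtain r where r: "0 < r" "ball z r \<subseteq> W" using f(2) zw by (meson openE)
    define B where "B = ball z r"
    have fB: "f holomorphic_on B" "open B" "convex B"
      using f(1) r(2) holomorphic_on_subset by (auto simp: B_def)
    have "deriv f holomorphic_on B" by (intro holomorphic_deriv fB)
    then have cd: "continuous_on B (deriv f)" by (rule holomorphic_on_imp_continuous_on)
    have "continuous_on ((B \<times> B) \<times> cbox 0 1) (\<lambda>(x, t). deriv f (linepath (fst x) (snd x) t))"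
      unfolding split_def
    proof (rule continuous_on_compose2[OF cd])
      show "continuous_on ((B \<times> B) \<times> cbox 0 1)
          (\<lambda>x. linepath (fst (fst x)) (snd (fst x)) (snd x))"
        unfolding linepath_def by (intro continuous_intros)
      show "(\<lambda>x. linepath (fst (fst x)) (snd (fst x)) (snd x)) ` ((B \<times> B) \<times> cbox 0 1) \<subseteq> B"
        using closed_segment_subset[OF _ _ fB(3)] linepath_in_path by fastforce
    qed
    then have "continuous_on (B \<times> B)
        (\<lambda>x. integral (cbox 0 1) (\<lambda>t. deriv f (linepath (fst x) (snd x) t)))"
      by (rule integral_continuous_on_param)
    then have "continuous_on (B \<times> B) (\<lambda>(z, w). diff_quot f z w)"
      by (rule continuous_on_eq) (auto simp: diff_quot_convex[OF fB])
    then show ?thesis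
      using r(1) True fB(2) by (subst (asm) continuous_on_eq_continuous_at) (auto simp: open_Times B_def)
  next
    case False
    let ?O = "(W \<times> W) \<inter> {x. fst x \<noteq> snd x}"
    have "open {x :: complex \<times> complex. fst x \<noteq> snd x}"
      by (intro open_Collect_neq continuous_intros)
    then have "open ?O" using f(2) by (intro open_Int open_Times)
    have cf: "continuous_on W f" using f(1) by (rule holomorphic_on_imp_continuous_on)
    have "continuous_on ?O (\<lambda>x. (f (snd x) - f (fst x)) / (snd x - fst x))"
      by (intro continuous_intros continuous_on_compose2[OF cf]) auto
    then have "continuous_on ?O (\<lambda>(z, w). diff_quot f z w)"
      by (rule continuous_on_eq) (auto simp: diff_quot_def)
    then show ?thesis
      using zw False \<open>open ?O\<close> by (subst (asm) continuous_on_eq_continuous_at) auto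
  qed
  then show ?thesis by (intro continuous_at_imp_continuous_on) auto
qed

text \<open>
  The derivative of a general piecewise continuously differentiable path may be unbounded near
  the break points; polynomial paths are used where a bound or the exchange of two integrals
  is needed.
\<close>

lemma polynomial_path_regularity:
  fixes p :: "real \<Rightarrow> complex"
  assumes "polynomial_function p"
  shows "valid_path p" "continuous_on {0..1} (\<lambda>t. vector_derivative p (at t))"
    "\<exists>B. \<forall>t\<in>{0..1}. norm (vector_derivative p (at t)) \<le> B"
    "continuous_on (path_image p) f \<Longrightarrow> f contour_integrable_on p"
proof -
  obtain p' where p': "polynomial_function p'" "\<And>x. (p has_vector_derivative (p' x)) (at x)"
    using has_vector_derivative_polynomial_function[OF assms] by blast
  have "vector_derivative p (at t) = p' t" for t
    using p'(2) by (rule vector_derivative_at)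
  then show cont: "continuous_on {0..1} (\<lambda>t. vector_derivative p (at t))"
    using p'(1) by (simp add: continuous_on_polymonial_function)
  show "valid_path p" by (rule valid_path_polynomial_function[OF assms])
  have "bounded ((\<lambda>t. vector_derivative p (at t)) ` {0..1})"
    by (intro compact_imp_bounded compact_continuous_image cont) simp
  then show "\<exists>B. \<forall>t\<in>{0..1}. norm (vector_derivative p (at t)) \<le> B"
    by (auto simp: bounded_iff)
  show "f contour_integrable_on p" if "continuous_on (path_image p) f"
    unfolding contour_integrable_on
    by (intro integrable_continuous_real continuous_on_mult cont continuous_on_compose2[OF that]
        continuous_on_polymonial_function assms) (auto simp: path_image_def)
qed

text \<open>
  Exchanging the two integrals shows that the parameter integral inherits the Cauchy integral
  formula on small circles, and a function represented by that formula is differentiable.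
\<close>

lemma holomorphic_on_contour_integral_parameter:
  assumes p: "polynomial_function p" and "open W"
    and cont: "continuous_on (W \<times> path_image p) (\<lambda>(z, w). g z w)"
    and hol: "\<And>w. w \<in> path_image p \<Longrightarrow> (\<lambda>z. g z w) holomorphic_on W"
  shows "(\<lambda>z. contour_integral p (g z)) holomorphic_on W"
proof -
  note pv = polynomial_path_regularity[OF p]
  define G where "G z = contour_integral p (g z)" for z
  have slice_cont: "continuous_on (path_image p) (g z)" if "z \<in> W" for z
  proof -
    have "continuous_on (path_image p) (\<lambda>w. case (z, w) of (z, w) \<Rightarrow> g z w)"
      by (rule continuous_on_compose2[OF cont]) (use that in \<open>auto intro!: continuous_intros\<close>)
    then show ?thesis by simp
  qed
  have Gcont: "continuous_on W G"
  proof -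
    have pc: "continuous_on {0..1} p" using pv(1) by (simp add: valid_path_imp_path path_def[symmetric])
    have "continuous_on (W \<times> cbox 0 1) (\<lambda>(z, t). g z (p t) * vector_derivative p (at t))"
      unfolding split_def
    proof (intro continuous_on_mult)
      show "continuous_on (W \<times> cbox 0 1) (\<lambda>x. g (fst x) (p (snd x)))"
      proof -
        have "continuous_on (W \<times> cbox 0 1) (\<lambda>x. (fst x, p (snd x)))"
          by (intro continuous_intros continuous_on_compose2[OF pc]) auto
        then have "continuous_on (W \<times> cbox 0 1) (\<lambda>x. case (fst x, p (snd x)) of (z, w) \<Rightarrow> g z w)"
          by (rule continuous_on_compose2[OF cont]) (auto simp: path_image_def)
        then show ?thesis by simp
      qed
      show "continuous_on (W \<times> cbox 0 1) (\<lambda>x. vector_derivative p (at (snd x)))"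
        by (intro continuous_on_compose2[OF pv(2)] continuous_intros) auto
    qed
    then have "continuous_on W (\<lambda>z. integral (cbox 0 1) (\<lambda>t. g z (p t) * vector_derivative p (at t)))"
      by (rule integral_continuous_on_param)
    then show ?thesis by (simp add: G_def contour_integral_integral)
  qed
  have "\<exists>G'. (G has_field_derivative G') (at z0)" if z0: "z0 \<in> W" for z0
  proof -
    obtain r where r: "0 < r" "cball z0 r \<subseteq> W"
      using \<open>open W\<close> z0 open_contains_cball by blast
    let ?C = "circlepath z0 r"
    have CW: "path_image ?C \<subseteq> W" using r by auto
    have G_circ: "((\<lambda>\<zeta>. G \<zeta> / (\<zeta> - z) ^ 1) has_contour_integral (2 * pi * \<i>) * G z) ?C"
      if z: "z \<in> ball z0 r" for z
    proof -
      have zC: "\<zeta> \<noteq> z" if "\<zeta> \<in> path_image ?C" for \<zeta> using that z r(1) by auto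
      have "continuous_on (path_image ?C) (\<lambda>\<zeta>. G \<zeta> / (\<zeta> - z))"
        using zC CW by (intro continuous_intros continuous_on_subset[OF Gcont]) auto
      then have int: "(\<lambda>\<zeta>. G \<zeta> / (\<zeta> - z)) contour_integrable_on ?C"
        by (rule contour_integrable_continuous_circlepath)
      have "contour_integral ?C (\<lambda>\<zeta>. G \<zeta> / (\<zeta> - z))
          = contour_integral ?C (\<lambda>\<zeta>. contour_integral p (\<lambda>w. g \<zeta> w / (\<zeta> - z)))"
      proof (intro contour_integral_cong refl)
        fix \<zeta> assume "\<zeta> \<in> path_image ?C"
        then have "continuous_on (path_image p) (g \<zeta>)" using CW by (intro slice_cont) auto
        then have "g \<zeta> contour_integrable_on p" by (rule pv(4))
        then show "G \<zeta> / (\<zeta> - z) = contour_integral p (\<lambda>w. g \<zeta> w / (\<zeta> - z))"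
          unfolding G_def by (rule contour_integral_div[symmetric])
      qed
      also have "\<dots> = contour_integral p (\<lambda>w. contour_integral ?C (\<lambda>\<zeta>. g \<zeta> w / (\<zeta> - z)))"
      proof (rule contour_integral_swap)
        have "continuous_on (path_image ?C \<times> path_image p) (\<lambda>x. g (fst x) (snd x) / (fst x - z))"
          using zC CW continuous_on_subset[OF cont, of "path_image ?C \<times> path_image p"]
          by (intro continuous_intros) (auto simp: split_def)
        then show "continuous_on (path_image ?C \<times> path_image p) (\<lambda>(\<zeta>, w). g \<zeta> w / (\<zeta> - z))"
          by (simp add: split_def)
        show "continuous_on {0..1} (\<lambda>t. vector_derivative ?C (at t))"
          by (simp add: vector_derivative_circlepath) (intro continuous_intros)
      qed (use pv in auto)
      also have "\<dots> = contour_integral p (\<lambda>w. (2 * pi * \<i>) * g z w)"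
      proof (intro contour_integral_cong refl)
        fix w assume "w \<in> path_image p"
        then have "(\<lambda>\<zeta>. g \<zeta> w) holomorphic_on cball z0 r"
          using hol r(2) holomorphic_on_subset by blast
        then show "contour_integral ?C (\<lambda>\<zeta>. g \<zeta> w / (\<zeta> - z)) = (2 * pi * \<i>) * g z w"
          using Cauchy_integral_circlepath_simple[of "\<lambda>\<zeta>. g \<zeta> w" z0 r z] z
          by (intro contour_integral_unique) (auto simp: dist_norm norm_minus_commute)
      qed
      also have "\<dots> = (2 * pi * \<i>) * G z"
      proof -
        have "z \<in> W" using z r by auto
        then have "continuous_on (path_image p) (g z)" by (rule slice_cont)
        then show ?thesis
          unfolding G_def by (intro contour_integral_lmul pv(4))
      qed
      finally show ?thesis using int has_contour_integral_integral by fastforce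
    qed
    have "((\<lambda>z. (2 * pi * \<i>) * G z) has_field_derivative
        (of_nat 1 * contour_integral ?C (\<lambda>\<zeta>. G \<zeta> / (\<zeta> - z0) ^ (Suc 1)))) (at z0)"
      using r(1) by (intro Cauchy_next_derivative_circlepath(2)[OF _ G_circ] continuous_on_subset[OF Gcont CW]) auto
    from DERIV_cdivide[OF this, of "2 * pi * \<i>"] show ?thesis by auto
  qed
  then show ?thesis
    using \<open>open W\<close> by (auto simp: G_def[symmetric] holomorphic_on_open)
qed

lemma Cauchy_transform_eq_diff_quot:
  assumes f: "f holomorphic_on W" "open W" and p: "valid_path p" "path_image p \<subseteq> W"
    and z: "z \<in> W" "z \<notin> path_image p"
  shows "contour_integral p (\<lambda>w. f w / (w - z))
       = contour_integral p (diff_quot f z) + 2 * pi * \<i> * winding_number p z * f z"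
proof -
  have "diff_quot f z contour_integrable_on p"
    using diff_quot_holomorphic(1)[OF f] f(2) p by (intro contour_integrable_holomorphic_simple)
  then have 1: "(diff_quot f z has_contour_integral contour_integral p (diff_quot f z)) p"
    by (rule has_contour_integral_integral)
  have 2: "((\<lambda>w. f z * (1 / (w - z))) has_contour_integral f z * (2 * pi * \<i> * winding_number p z)) p"
    using p(1) z(2) by (intro has_contour_integral_lmul has_contour_integral_winding_number)
  have "((\<lambda>w. f w / (w - z)) has_contour_integral
      (contour_integral p (diff_quot f z) + f z * (2 * pi * \<i> * winding_number p z))) p"
    using has_contour_integral_add[OF 1 2]
    by (rule has_contour_integral_eq) (use z(2) in \<open>auto simp: diff_quot_def diff_divide_distrib\<close>)
  then show ?thesis by (simp add: contour_integral_unique mult_ac)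
qed

lemma Cauchy_transform_polynomial_path:
  assumes p: "polynomial_function p" and f: "continuous_on (path_image p) f"
  shows "(\<lambda>z. contour_integral p (\<lambda>w. f w / (w - z))) holomorphic_on - path_image p"
    "((\<lambda>z. contour_integral p (\<lambda>w. f w / (w - z))) \<longlongrightarrow> 0) at_infinity"
proof -
  note pv = polynomial_path_regularity[OF p]
  obtain B where B: "\<And>t. t \<in> {0..1} \<Longrightarrow> norm (vector_derivative p (at t)) \<le> B" using pv(3) by blast
  have cont: "continuous_on (path_image p) (\<lambda>w. f w / (w - z))" if "z \<notin> path_image p" for z
    using that by (intro continuous_intros f) auto
  have int: "((\<lambda>w. f w / (w - z) ^ 1) has_contour_integral contour_integral p (\<lambda>w. f w / (w - z))) p"
    if "z \<in> UNIV - path_image p" for z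
    using that has_contour_integral_integral[OF pv(4)[OF cont]] by simp
  have op: "open (- path_image p)"
    using closed_valid_path_image[OF pv(1)] by auto
  show "(\<lambda>z. contour_integral p (\<lambda>w. f w / (w - z))) holomorphic_on - path_image p"
    unfolding holomorphic_on_open[OF op]
    using Cauchy_next_derivative(2)[OF f B int _ open_UNIV pv(1)] by auto
  show "((\<lambda>z. contour_integral p (\<lambda>w. f w / (w - z))) \<longlongrightarrow> 0) at_infinity"
  proof -
    have "compact (path_image p)" using pv(1) by (rule compact_valid_path_image)
    then obtain R where R: "\<And>w. w \<in> path_image p \<Longrightarrow> norm w \<le> R"
      using compact_imp_bounded bounded_iff by metis
    obtain M where M: "\<And>w. w \<in> path_image p \<Longrightarrow> norm (f w) \<le> M"
      using compact_imp_bounded[OF compact_continuous_image[OF f \<open>compact (path_image p)\<close>]]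
      by (auto simp: bounded_iff)
    have "uniform_limit (path_image p) (\<lambda>z w. f w / (w - z)) (\<lambda>w. 0) at_infinity"
      unfolding uniform_limit_iff
    proof (intro allI impI)
      fix e :: real assume e: "0 < e"
      have "norm (f w / (w - z)) < e" if w: "w \<in> path_image p" and z: "norm z \<ge> R + (\<bar>M\<bar> / e + 1)" for w z
      proof -
        have "\<bar>M\<bar> / e + 1 \<le> norm (w - z)"
          using R[OF w] z norm_triangle_ineq2[of z w] by (simp add: norm_minus_commute)
        moreover from this have "0 < norm (w - z)"
          using e by (smt (verit) divide_nonneg_pos)
        moreover have "norm (f w) < (\<bar>M\<bar> / e + 1) * e"
        proof -
          have "(\<bar>M\<bar> / e + 1) * e = \<bar>M\<bar> + e" using e by (simp add: field_simps)
          then show ?thesis using M[OF w] e by linarith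
        qed
        ultimately show ?thesis
          using e by (simp add: norm_divide divide_less_eq) (smt (verit) mult_right_mono mult.commute)
      qed
      then show "\<forall>\<^sub>F z in at_infinity. \<forall>w\<in>path_image p. dist (f w / (w - z)) 0 < e"
        unfolding eventually_at_infinity by (auto intro!: exI[of _ "R + (\<bar>M\<bar> / e + 1)"])
    qed
    moreover have "\<forall>\<^sub>F z in at_infinity. (\<lambda>w. f w / (w - z)) contour_integrable_on p"
      unfolding eventually_at_infinity
    proof (intro exI allI impI)
      fix z :: complex assume "R + 1 \<le> norm z"
      then have "z \<notin> path_image p" using R by force
      then show "(\<lambda>w. f w / (w - z)) contour_integrable_on p" by (intro pv(4) cont)
    qed
    ultimately have "((\<lambda>z. contour_integral p (\<lambda>w. f w / (w - z))) \<longlongrightarrow> contour_integral p (\<lambda>w. 0)) at_infinity"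
      using B pv(1) trivial_limit_at_infinity[where 'a = complex]
      by (intro contour_integral_uniform_limit(2)) auto
    then show ?thesis by simp
  qed
qed

text \<open>
  Dixon's argument. Where the cycle has winding number 0 the integral of the difference quotient
  equals the Cauchy integral of \<open>f\<close>, which makes sense there even outside \<open>W\<close>. The two expressions
  therefore define one entire function. It tends to 0 at infinity, so it vanishes by Liouville's
  theorem.
\<close>

lemma polynomial_cycle_diff_quot:
  assumes I: "finite I" and W: "open W" "f holomorphic_on W"
    and p: "\<And>i. i \<in> I \<Longrightarrow> polynomial_function (p i)"
      "\<And>i. i \<in> I \<Longrightarrow> pathfinish (p i) = pathstart (p i)"
      "\<And>i. i \<in> I \<Longrightarrow> path_image (p i) \<subseteq> W"
    and null: "\<And>w. w \<notin> W \<Longrightarrow> (\<Sum>i\<in>I. c i * winding_number (p i) w) = 0"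
    and z: "z \<in> W"
  shows "(\<Sum>i\<in>I. c i * contour_integral (p i) (diff_quot f z)) = 0"
proof -
  define K where "K = (\<Union>i\<in>I. path_image (p i))"
  have vp: "valid_path (p i)" if "i \<in> I" for i using polynomial_path_regularity(1) p(1) that by blast
  have "compact K"
    unfolding K_def using I vp by (intro compact_UN compact_valid_path_image) auto
  have KW: "K \<subseteq> W" using p(3) by (auto simp: K_def)
  have fc: "continuous_on (path_image (p i)) f" if "i \<in> I" for i
    using W(2) p(3)[OF that] holomorphic_on_imp_continuous_on continuous_on_subset by blast
  define N where "N z = (\<Sum>i\<in>I. c i * winding_number (p i) z)" for z
  define S where "S z = (\<Sum>i\<in>I. c i * contour_integral (p i) (\<lambda>w. f w / (w - z)))" for z
  \<comment> \<open>The entire function obtained by gluing along \<open>W \<inter> H\<close>.\<close>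
  define E where "E z = (if z \<in> W then \<Sum>i\<in>I. c i * contour_integral (p i) (diff_quot f z) else S z)" for z
  define H where "H = {z. z \<notin> K \<and> N z = 0}"
  have ES: "E z = S z" if "z \<in> H" for z
  proof (cases "z \<in> W")
    case True
    have "S z = (\<Sum>i\<in>I. c i * (contour_integral (p i) (diff_quot f z)
        + 2 * pi * \<i> * winding_number (p i) z * f z))"
      unfolding S_def using that True p(3) vp
      by (intro sum.cong refl arg_cong2[of _ _ _ _ "(*)"]
          Cauchy_transform_eq_diff_quot[OF W(2,1)]) (auto simp: H_def K_def)
    also have "\<dots> = E z + 2 * pi * \<i> * f z * N z"
      using True by (simp add: E_def N_def algebra_simps sum.distrib sum_distrib_left)
    finally show ?thesis using that by (simp add: H_def)
  qed (simp add: E_def)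
  have "open H"
    unfolding open_contains_ball
  proof
    fix z assume z: "z \<in> H"
    then have "z \<in> - K" by (simp add: H_def)
    moreover have "open (- K)" using \<open>compact K\<close> compact_imp_closed by blast
    ultimately obtain r where r: "0 < r" "ball z r \<subseteq> - K" by (meson openE)
    have "N w = N z" if "w \<in> ball z r" for w
      unfolding N_def
    proof (intro sum.cong refl arg_cong2[of _ _ _ _ "(*)"])
      fix i assume i: "i \<in> I"
      show "winding_number (p i) w = winding_number (p i) z"
        using r that p(2)[OF i] valid_path_imp_path[OF vp[OF i]] i
        by (intro winding_number_eq[where S = "ball z r"]) (auto simp: K_def)
    qed
    then have "ball z r \<subseteq> H" using r(2) z by (auto simp: H_def simp del: mem_ball)
    then show "\<exists>r>0. ball z r \<subseteq> H" using r(1) by blast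
  qed
  have "E holomorphic_on W"
  proof (rule holomorphic_transform)
    show "(\<lambda>z. \<Sum>i\<in>I. c i * contour_integral (p i) (diff_quot f z)) holomorphic_on W"
    proof (intro holomorphic_intros holomorphic_on_contour_integral_parameter)
      fix i assume i: "i \<in> I"
      show "continuous_on (W \<times> path_image (p i)) (\<lambda>(z, w). diff_quot f z w)"
        by (rule continuous_on_subset[OF diff_quot_continuous[OF W(2,1)]]) (use p(3)[OF i] in auto)
    qed (use W p in \<open>auto intro: diff_quot_holomorphic(2)\<close>)
  qed (simp add: E_def)
  moreover have "E holomorphic_on H"
  proof (rule holomorphic_transform)
    show "S holomorphic_on H"
      unfolding S_def
    proof (intro holomorphic_intros)
      fix i assume i: "i \<in> I"
      show "(\<lambda>z. contour_integral (p i) (\<lambda>w. f w / (w - z))) holomorphic_on H"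
        by (rule holomorphic_on_subset[OF Cauchy_transform_polynomial_path(1)[OF p(1)[OF i] fc[OF i]]])
          (use i in \<open>auto simp: H_def K_def\<close>)
    qed
  qed (simp add: ES)
  ultimately have "E holomorphic_on W \<union> H" using W(1) \<open>open H\<close> by (intro holomorphic_on_Un)
  moreover have "W \<union> H = UNIV" using KW null by (auto simp: H_def N_def)
  ultimately have "E holomorphic_on UNIV" by simp
  moreover have "(E \<longlongrightarrow> 0) at_infinity"
  proof (rule Lim_transform_eventually)
    have "(S \<longlongrightarrow> (\<Sum>i\<in>I. c i * 0)) at_infinity"
      unfolding S_def
      by (intro tendsto_sum tendsto_mult tendsto_const Cauchy_transform_polynomial_path(2) p(1) fc)
    then show "(S \<longlongrightarrow> 0) at_infinity" by simp
    obtain R where R: "K \<subseteq> cball 0 R"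
      using compact_imp_bounded[OF \<open>compact K\<close>] by (auto simp: bounded_iff subset_iff)
    have "z \<in> H" if "norm z \<ge> R + 1" for z
    proof -
      have "z \<notin> cball 0 R" using that by auto
      then have "winding_number (p i) z = 0" if "i \<in> I" for i
        using R p(2)[OF that] vp[OF that] that
        by (intro winding_number_zero_outside[of _ "cball 0 R"])
          (auto simp: K_def valid_path_imp_path)
      moreover have "z \<notin> K" using R \<open>z \<notin> cball 0 R\<close> by blast
      ultimately show ?thesis by (simp add: H_def N_def)
    qed
    then show "\<forall>\<^sub>F z in at_infinity. S z = E z"
      unfolding eventually_at_infinity using ES by metis
  qed
  ultimately have "E z = 0" by (rule Liouville_weak_0)
  then show ?thesis using z by (simp add: E_def)
qed

text \<open>
  Homology version of the Cauchy theorem for finite families of closed paths with complex weights.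
  The paths are first replaced by nearby polynomial ones, which changes neither the integrals of
  holomorphic functions nor the winding numbers about points outside \<open>W\<close>. Then Dixon's identity
  is applied to \<open>(w - z) f w\<close>, whose difference quotient at a point \<open>z\<close> off the paths is \<open>f\<close>.
\<close>

theorem Cauchy_theorem_cycle:
  assumes I: "finite I" and W: "open W" "f holomorphic_on W"
    and \<gamma>: "\<And>i. i \<in> I \<Longrightarrow> valid_path (\<gamma> i)" "\<And>i. i \<in> I \<Longrightarrow> pathfinish (\<gamma> i) = pathstart (\<gamma> i)"
      "\<And>i. i \<in> I \<Longrightarrow> path_image (\<gamma> i) \<subseteq> W"
    and null: "\<And>w. w \<notin> W \<Longrightarrow> (\<Sum>i\<in>I. c i * winding_number (\<gamma> i) w) = 0"
  shows "(\<Sum>i\<in>I. c i * contour_integral (\<gamma> i) f) = 0"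
proof (cases "I = {}")
  case False
  have "\<exists>p. polynomial_function p \<and> pathfinish p = pathstart p \<and> path_image p \<subseteq> W \<and>
      (\<forall>g. g holomorphic_on W \<longrightarrow> contour_integral (\<gamma> i) g = contour_integral p g)" if i: "i \<in> I" for i
  proof -
    have path: "path (\<gamma> i)" using \<gamma>(1)[OF i] by (rule valid_path_imp_path)
    obtain d where d: "0 < d" "\<And>g h. valid_path g \<and> valid_path h \<and>
        (\<forall>t\<in>{0..1}. norm (g t - \<gamma> i t) < d \<and> norm (h t - \<gamma> i t) < d) \<and>
        pathfinish g = pathstart g \<and> pathfinish h = pathstart h \<Longrightarrow>
        path_image g \<subseteq> W \<and> path_image h \<subseteq> W \<and>
        (\<forall>f. f holomorphic_on W \<longrightarrow> contour_integral h f = contour_integral g f)"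
      using contour_integral_nearby_loops[OF W(1) path \<gamma>(3)[OF i]] by metis
    obtain p where p: "polynomial_function p" "pathstart p = pathstart (\<gamma> i)"
        "pathfinish p = pathfinish (\<gamma> i)" "\<And>t. t \<in> {0..1} \<Longrightarrow> norm (p t - \<gamma> i t) < d"
      using path_approx_polynomial_function[OF path d(1)] by metis
    show ?thesis
      using d(2)[of p "\<gamma> i"] p d(1) \<gamma>(1,2)[OF i] valid_path_polynomial_function[OF p(1)]
      by (intro exI[of _ p]) auto
  qed
  then obtain p where p: "\<And>i. i \<in> I \<Longrightarrow> polynomial_function (p i)"
      "\<And>i. i \<in> I \<Longrightarrow> pathfinish (p i) = pathstart (p i)" "\<And>i. i \<in> I \<Longrightarrow> path_image (p i) \<subseteq> W"
    and eq: "\<And>i g. i \<in> I \<Longrightarrow> g holomorphic_on W \<Longrightarrow> contour_integral (\<gamma> i) g = contour_integral (p i) g"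
    by metis
  have vp: "valid_path (p i)" if "i \<in> I" for i using valid_path_polynomial_function p(1) that by blast
  have null': "(\<Sum>i\<in>I. c i * winding_number (p i) w) = 0" if w: "w \<notin> W" for w
  proof -
    have "winding_number (p i) w = winding_number (\<gamma> i) w" if i: "i \<in> I" for i
    proof -
      have "(\<lambda>z. 1 / (z - w)) holomorphic_on W" using w by (intro holomorphic_intros) auto
      then show ?thesis
        using eq[OF i] winding_number_valid_path[OF vp[OF i]] winding_number_valid_path[OF \<gamma>(1)[OF i]]
          p(3)[OF i] \<gamma>(3)[OF i] w by (metis (no_types, lifting) subsetD)
    qed
    then show ?thesis using null[OF w] by simp
  qed
  define K where "K = (\<Union>i\<in>I. path_image (p i))"
  have "compact K"
    unfolding K_def using I vp by (intro compact_UN compact_valid_path_image) auto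
  \<comment> \<open>A nonempty open subset of the plane is not compact, so the paths leave room for \<open>z\<close>.\<close>
  moreover have "K \<noteq> {}" using False by (auto simp: K_def path_image_nonempty)
  ultimately have "K \<noteq> W" using W(1) compact_open by blast
  moreover have "K \<subseteq> W" using p(3) by (auto simp: K_def)
  ultimately obtain z where z: "z \<in> W" "z \<notin> K" by blast
  have "(\<lambda>w. (w - z) * f w) holomorphic_on W" by (intro holomorphic_intros W)
  from polynomial_cycle_diff_quot[OF I W(1) this p null' z(1)]
  have "0 = (\<Sum>i\<in>I. c i * contour_integral (p i) (diff_quot (\<lambda>w. (w - z) * f w) z))" by simp
  also have "\<dots> = (\<Sum>i\<in>I. c i * contour_integral (p i) f)"
    using z(2) by (intro sum.cong refl arg_cong2[of _ _ _ _ "(*)"] contour_integral_cong)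
      (auto simp: K_def diff_quot_def)
  also have "\<dots> = (\<Sum>i\<in>I. c i * contour_integral (\<gamma> i) f)"
    using eq[OF _ W(2)] by simp
  finally show ?thesis by simp
qed simp

section \<open>Banach-valued line integrals\<close>

text \<open>
  The pullback along \<open>\<gamma>\<close> of the differential form \<open>A dx + C dy\<close> on the plane with values in a vector
  space.
\<close>

definition line_form ::
  "(complex \<Rightarrow> 'a::real_vector) \<Rightarrow> (complex \<Rightarrow> 'a) \<Rightarrow> (real \<Rightarrow> complex) \<Rightarrow> real \<Rightarrow> 'a" where
  "line_form A C \<gamma> t =
     (let d = vector_derivative \<gamma> (at t within {0..1}) in Re d *\<^sub>R A (\<gamma> t) + Im d *\<^sub>R C (\<gamma> t))"

text \<open>
  Every functional \<open>\<phi>\<close> makes \<open>A dx + C dy\<close> the real part of \<open>h dz\<close> with the holomorphic function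
  \<open>h = \<phi> A - \<i> \<phi> C\<close>; that is, both this form and its conjugate \<open>A dy - C dx\<close> are weakly closed.
\<close>

definition holomorphic_form ::
  "complex set \<Rightarrow> (complex \<Rightarrow> 'a::real_normed_vector) \<Rightarrow> (complex \<Rightarrow> 'a) \<Rightarrow> bool" where
  "holomorphic_form W A C \<longleftrightarrow> continuous_on W A \<and> continuous_on W C \<and>
     (\<forall>\<phi>. bounded_linear \<phi> \<longrightarrow> (\<lambda>z. Complex (\<phi> (A z)) (- \<phi> (C z))) holomorphic_on W)"

lemma holomorphic_form_subset:
  "holomorphic_form W A C \<Longrightarrow> V \<subseteq> W \<Longrightarrow> holomorphic_form V A C"
  unfolding holomorphic_form_def by (meson continuous_on_subset holomorphic_on_subset)

lemma functional_line_form: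
  assumes "bounded_linear \<phi>"
  shows "\<phi> (line_form A C \<gamma> t)
       = Re (Complex (\<phi> (A (\<gamma> t))) (- \<phi> (C (\<gamma> t))) * vector_derivative \<gamma> (at t within {0..1}))"
proof -
  interpret bounded_linear \<phi> by fact
  show ?thesis by (simp add: line_form_def Let_def add scaleR mult.commute)
qed

text \<open>
  Integrals of Banach-valued forms are studied through this identity, which reduces them to complex
  contour integrals.
\<close>

lemma functional_integral_line_form:
  fixes A :: "complex \<Rightarrow> 'a::banach"
  assumes \<phi>: "bounded_linear \<phi>" and int: "line_form A C \<gamma> integrable_on {0..1}"
    and hint: "(\<lambda>z. Complex (\<phi> (A z)) (- \<phi> (C z))) contour_integrable_on \<gamma>"
  shows "\<phi> (integral {0..1} (line_form A C \<gamma>))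
       = Re (contour_integral \<gamma> (\<lambda>z. Complex (\<phi> (A z)) (- \<phi> (C z))))"
proof -
  let ?h = "\<lambda>z. Complex (\<phi> (A z)) (- \<phi> (C z))"
  have 1: "((\<phi> \<circ> line_form A C \<gamma>) has_integral \<phi> (integral {0..1} (line_form A C \<gamma>))) {0..1}"
    using int \<phi> by (intro has_integral_linear integrable_integral)
  have "((\<lambda>t. ?h (\<gamma> t) * vector_derivative \<gamma> (at t within {0..1}))
      has_integral contour_integral \<gamma> ?h) {0..1}"
    using has_contour_integral_integral[OF hint] by (simp add: has_contour_integral_def)
  from has_integral_linear[OF this bounded_linear_Re]
  have "((\<phi> \<circ> line_form A C \<gamma>) has_integral Re (contour_integral \<gamma> ?h)) {0..1}"
    by (simp add: o_def functional_line_form[OF \<phi>])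
  with 1 show ?thesis by (rule has_integral_unique)
qed

lemma line_form_linepath:
  "t \<in> {0..1} \<Longrightarrow>
    line_form A C (linepath a b) t = Re (b - a) *\<^sub>R A (linepath a b t) + Im (b - a) *\<^sub>R C (linepath a b t)"
  by (simp add: line_form_def Let_def vector_derivative_linepath_within)

lemma line_form_linepath_integrable:
  fixes A :: "complex \<Rightarrow> 'a::banach"
  assumes "continuous_on (closed_segment a b) A" "continuous_on (closed_segment a b) C"
  shows "line_form A C (linepath a b) integrable_on {0..1}"
proof -
  have "continuous_on {0..1} (\<lambda>t. Re (b - a) *\<^sub>R A (linepath a b t) + Im (b - a) *\<^sub>R C (linepath a b t))"
    by (intro continuous_intros continuous_on_compose2[OF assms(1)] continuous_on_compose2[OF assms(2)])
      (auto simp: linepath_in_path)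
  then have "continuous_on {0..1} (line_form A C (linepath a b))"
    by (rule continuous_on_eq) (simp add: line_form_linepath)
  then show ?thesis by (rule integrable_continuous_real)
qed

lemma eq_by_functionals:
  fixes x y :: "'a::real_normed_vector"
  assumes "\<And>\<phi> :: 'a \<Rightarrow> real. bounded_linear \<phi> \<Longrightarrow> \<phi> x = \<phi> y"
  shows "x = y"
proof (rule ccontr)
  assume "x \<noteq> y"
  then obtain \<phi> :: "'a \<Rightarrow> real" where \<phi>: "bounded_linear \<phi>" "\<phi> (x - y) \<noteq> 0"
    using bounded_linear_separates[of "x - y"] by auto
  then show False
    using assms[OF \<phi>(1)] linear_diff[OF bounded_linear.linear[OF \<phi>(1)], of x y] by simp
qed

text \<open>
  The usual construction by integration along segments from a base point. The integral over a
  triangle vanishes because all functionals of it do; that the result is a primitive then uses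
  only the continuity of \<open>A\<close> and \<open>C\<close>, and so holds in the norm.
\<close>

lemma holomorphic_form_primitive:
  fixes A :: "complex \<Rightarrow> 'a::banach"
  assumes form: "holomorphic_form B A C" and B: "open B" "convex B"
  obtains G where
    "\<And>z. z \<in> B \<Longrightarrow> (G has_derivative (\<lambda>w. Re w *\<^sub>R A z + Im w *\<^sub>R C z)) (at z)"
proof (cases "B = {}")
  case False
  then obtain z0 where z0: "z0 \<in> B" by blast
  define J where "J a b = integral {0..1} (line_form A C (linepath a b))" for a b
  have cA: "continuous_on B A" and cC: "continuous_on B C"
    using form by (auto simp: holomorphic_form_def)
  have seg: "closed_segment a b \<subseteq> B" if "a \<in> B" "b \<in> B" for a b
    using closed_segment_subset[OF that B(2)] .
  have int: "line_form A C (linepath a b) integrable_on {0..1}" if "a \<in> B" "b \<in> B" for a b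
    using seg[OF that] cA cC by (intro line_form_linepath_integrable) (auto intro: continuous_on_subset)
  have add: "J z0 b - J z0 a = J a b" if ab: "a \<in> B" "b \<in> B" for a b
  proof -
    have "\<phi> (J z0 b) = \<phi> (J z0 a + J a b)" if \<phi>: "bounded_linear \<phi>" for \<phi> :: "'a \<Rightarrow> real"
    proof -
      let ?h = "\<lambda>z. Complex (\<phi> (A z)) (- \<phi> (C z))"
      have h: "?h holomorphic_on B" using form \<phi> by (auto simp: holomorphic_form_def)
      then have hc: "continuous_on B ?h" by (rule holomorphic_on_imp_continuous_on)
      have hint: "?h contour_integrable_on linepath x y" if "x \<in> B" "y \<in> B" for x y
        using seg[OF that] continuous_on_subset[OF hc] by (intro contour_integrable_continuous_linepath)
      have eq: "\<phi> (J x y) = Re (contour_integral (linepath x y) ?h)" if "x \<in> B" "y \<in> B" for x y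
        unfolding J_def by (rule functional_integral_line_form[OF \<phi> int[OF that] hint[OF that]])
      have "convex hull {z0, a, b} \<subseteq> B"
        using z0 ab B(2) by (intro hull_minimal) auto
      then have "(?h has_contour_integral 0) (linepath z0 a +++ linepath a b +++ linepath b z0)"
        using h holomorphic_on_subset by (intro Cauchy_theorem_triangle) blast
      then have "contour_integral (linepath z0 a) ?h
          + (contour_integral (linepath a b) ?h + contour_integral (linepath b z0) ?h) = 0"
        using hint z0 ab by (auto dest!: contour_integral_unique)
      moreover have "contour_integral (linepath b z0) ?h = - contour_integral (linepath z0 b) ?h"
        using seg[OF z0 ab(2)] continuous_on_subset[OF hc] by (intro contour_integral_reverse_linepath) (metis closed_segment_commute)
      ultimately have "contour_integral (linepath z0 b) ?h
          = contour_integral (linepath z0 a) ?h + contour_integral (linepath a b) ?h"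
        by (simp add: algebra_simps)
      then show ?thesis
        using eq z0 ab linear_add[OF bounded_linear.linear[OF \<phi>]] by simp
    qed
    then have "J z0 b = J z0 a + J a b" by (rule eq_by_functionals)
    then show ?thesis by simp
  qed
  have "(J z0 has_derivative (\<lambda>w. Re w *\<^sub>R A z + Im w *\<^sub>R C z)) (at z)" if z: "z \<in> B" for z
    unfolding has_derivative_at_alt
  proof (intro conjI allI impI)
    show "bounded_linear (\<lambda>w. Re w *\<^sub>R A z + Im w *\<^sub>R C z)"
      by (intro bounded_linear_add bounded_linear_scaleR_const bounded_linear_Re bounded_linear_Im)
    fix e :: real assume e: "0 < e"
    have "isCont A z" "isCont C z"
      using cA cC z B(1) continuous_on_eq_continuous_at by auto
    then have "\<exists>d>0. \<forall>y. dist y z < d \<longrightarrow> dist (A y) (A z) < e / 2"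
        "\<exists>d>0. \<forall>y. dist y z < d \<longrightarrow> dist (C y) (C z) < e / 2"
      using half_gt_zero[OF e] unfolding continuous_at_eps_delta by blast+
    then obtain d1 d2 where d: "0 < d1" "0 < d2"
        "\<And>y. dist y z < d1 \<Longrightarrow> dist (A y) (A z) < e / 2"
        "\<And>y. dist y z < d2 \<Longrightarrow> dist (C y) (C z) < e / 2"
      by auto
    obtain r where r: "0 < r" "ball z r \<subseteq> B" using B(1) z by (meson openE)
    define m where "m = min r (min d1 d2)"
    have "norm (J z0 y - J z0 z - (Re (y - z) *\<^sub>R A z + Im (y - z) *\<^sub>R C z)) \<le> e * norm (y - z)"
      if y: "norm (y - z) < m" for y
    proof -
      have yB: "y \<in> B" using y r by (auto simp: m_def dist_norm norm_minus_commute)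
      let ?k = "Re (y - z) *\<^sub>R A z + Im (y - z) *\<^sub>R C z"
      have "((\<lambda>t. line_form A C (linepath z y) t - ?k) has_integral (J z y - ?k)) {0..1}"
        using has_integral_diff[OF integrable_integral[OF int[OF z yB]] has_integral_const_real[of ?k 0 1]]
        by (simp add: J_def)
      moreover have "norm (line_form A C (linepath z y) t - ?k) \<le> e * norm (y - z)" if t: "t \<in> {0..1}" for t
      proof -
        let ?p = "linepath z y t"
        have "norm (?p - z) = t * norm (y - z)"
          using t by (simp add: linepath_def algebra_simps flip: scaleR_diff_right)
        also have "\<dots> \<le> norm (y - z)" using t by (simp add: mult_left_le_one_le)
        finally have p: "dist ?p z < d1" "dist ?p z < d2" using y by (auto simp: m_def dist_norm)
        have "line_form A C (linepath z y) t - ?k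
            = Re (y - z) *\<^sub>R (A ?p - A z) + Im (y - z) *\<^sub>R (C ?p - C z)"
          using t by (simp add: line_form_linepath scaleR_diff_right)
        also have "norm \<dots> \<le> \<bar>Re (y - z)\<bar> * norm (A ?p - A z) + \<bar>Im (y - z)\<bar> * norm (C ?p - C z)"
          by (rule order_trans[OF norm_triangle_ineq]) simp
        also have "\<dots> \<le> norm (y - z) * (e / 2) + norm (y - z) * (e / 2)"
          using d(3)[OF p(1)] d(4)[OF p(2)] abs_Re_le_cmod[of "y - z"] abs_Im_le_cmod[of "y - z"]
          by (intro add_mono mult_mono) (auto simp: dist_norm)
        finally show ?thesis by (simp add: mult.commute)
      qed
      ultimately have "norm (J z y - ?k) \<le> e * norm (y - z) * measure lborel (cbox 0 (1::real))"
        using e by (intro has_integral_bound) auto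
      then show ?thesis using add[OF z yB] by simp
    qed
    then show "\<exists>d>0. \<forall>y. norm (y - z) < d \<longrightarrow>
        norm (J z0 y - J z0 z - (Re (y - z) *\<^sub>R A z + Im (y - z) *\<^sub>R C z)) \<le> e * norm (y - z)"
      using d r by (intro exI[of _ m]) (auto simp: m_def)
  qed
  then show ?thesis by (rule that)
qed (use that in auto)

text \<open>
  Continuity of \<open>A\<close> and \<open>C\<close> is not sufficient, because the derivative of a valid path may be
  unbounded and not absolutely integrable. A local primitive composed with the path is an
  antiderivative of the integrand away from finitely many points, so the integrand is integrable on
  short intervals.
\<close>

lemma line_form_integrable:
  fixes A :: "complex \<Rightarrow> 'a::banach"
  assumes form: "holomorphic_form W A C" and W: "open W"
    and \<gamma>: "valid_path \<gamma>" "path_image \<gamma> \<subseteq> W"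
  shows "line_form A C \<gamma> integrable_on {0..1}"
proof -
  obtain S where S: "finite S" "\<gamma> C1_differentiable_on {0..1} - S"
    using \<gamma>(1) unfolding valid_path_def piecewise_C1_differentiable_on_def by blast
  have cont: "continuous_on {0..1} \<gamma>"
    using \<gamma>(1) valid_path_imp_path path_def by blast
  have "\<exists>d>0. \<forall>u v. x \<in> cbox u v \<and> cbox u v \<subseteq> ball x d \<and> cbox u v \<subseteq> cbox 0 1 \<longrightarrow>
      line_form A C \<gamma> integrable_on cbox u v" if x: "x \<in> cbox 0 1" for x
  proof -
    have "\<gamma> x \<in> W" using \<gamma>(2) x by (auto simp: path_image_def)
    then obtain r where r: "0 < r" "ball (\<gamma> x) r \<subseteq> W" using W by (meson openE)
    obtain G where G: "\<And>z. z \<in> ball (\<gamma> x) r \<Longrightarrow>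
        (G has_derivative (\<lambda>w. Re w *\<^sub>R A z + Im w *\<^sub>R C z)) (at z)"
      using holomorphic_form_primitive[OF holomorphic_form_subset[OF form r(2)]] by auto
    obtain d where d: "0 < d" "\<And>t. t \<in> {0..1} \<Longrightarrow> dist t x < d \<Longrightarrow> dist (\<gamma> t) (\<gamma> x) < r"
      using cont x r(1) unfolding continuous_on_iff by (metis cbox_interval)
    have "line_form A C \<gamma> integrable_on cbox u v"
      if uv: "x \<in> cbox u v" "cbox u v \<subseteq> ball x d" "cbox u v \<subseteq> cbox 0 1" for u v
    proof -
      have uv': "u \<le> v" "0 \<le> u" "v \<le> 1" using uv by auto
      have near: "\<gamma> t \<in> ball (\<gamma> x) r" if "t \<in> {u..v}" for t
        using d(2)[of t] uv that by (auto simp: dist_commute subset_iff)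
      have "(line_form A C \<gamma> has_integral ((G \<circ> \<gamma>) v - (G \<circ> \<gamma>) u)) {u..v}"
      proof (rule fundamental_theorem_of_calculus_interior_strong[OF S(1) uv'(1)])
        fix t assume t: "t \<in> {u<..<v} - S"
        then have t01: "t \<in> {0..1} - S" "0 < t" "t < 1" using uv' by auto
        then have "(\<gamma> has_vector_derivative vector_derivative \<gamma> (at t)) (at t)"
          using S(2) by (meson C1_differentiable_on_eq vector_derivative_works)
        moreover from this have "vector_derivative \<gamma> (at t within {0..1}) = vector_derivative \<gamma> (at t)"
          using t01 by (intro vector_derivative_at_within_ivl) auto
        ultimately have "(\<gamma> has_vector_derivative vector_derivative \<gamma> (at t within {0..1})) (at t)"
          by simp
        from has_derivative_compose[OF this[unfolded has_vector_derivative_def] G[OF near]]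
        show "((G \<circ> \<gamma>) has_vector_derivative line_form A C \<gamma> t) (at t)"
          using t by (simp add: has_vector_derivative_def line_form_def Let_def o_def scaleR_add_right)
      next
        have "continuous_on (ball (\<gamma> x) r) G"
          using G has_derivative_continuous by (intro continuous_at_imp_continuous_on) blast
        then show "continuous_on {u..v} (G \<circ> \<gamma>)"
          using near uv' by (intro continuous_on_compose continuous_on_subset[OF cont])
            (auto elim!: continuous_on_subset)
      qed
      then show ?thesis by (auto intro: has_integral_integrable)
    qed
    then show ?thesis using d(1) by blast
  qed
  then show ?thesis
    using integrable_on_little_subintervals[of 0 1 "line_form A C \<gamma>"] by simp
qed

theorem holomorphic_form_null_cycle:
  fixes A :: "complex \<Rightarrow> 'a::banach"
  assumes form: "holomorphic_form W A C" and W: "open W" and I: "finite I"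
    and \<gamma>: "\<And>i. i \<in> I \<Longrightarrow> valid_path (\<gamma> i)" "\<And>i. i \<in> I \<Longrightarrow> pathfinish (\<gamma> i) = pathstart (\<gamma> i)"
      "\<And>i. i \<in> I \<Longrightarrow> path_image (\<gamma> i) \<subseteq> W"
    and null: "\<And>w. w \<notin> W \<Longrightarrow> (\<Sum>i\<in>I. of_real (c i) * winding_number (\<gamma> i) w) = 0"
  shows "(\<Sum>i\<in>I. c i *\<^sub>R integral {0..1} (line_form A C (\<gamma> i))) = 0"
proof (rule eq_by_functionals)
  fix \<phi> :: "'a \<Rightarrow> real" assume \<phi>: "bounded_linear \<phi>"
  let ?h = "\<lambda>z. Complex (\<phi> (A z)) (- \<phi> (C z))"
  have h: "?h holomorphic_on W" using form \<phi> by (auto simp: holomorphic_form_def)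
  have eq: "\<phi> (integral {0..1} (line_form A C (\<gamma> i))) = Re (contour_integral (\<gamma> i) ?h)" if "i \<in> I" for i
    using that \<gamma> by (intro functional_integral_line_form \<phi> line_form_integrable[OF form W]
        contour_integrable_holomorphic_simple[OF h W]) auto
  interpret bounded_linear \<phi> by fact
  have "\<phi> (\<Sum>i\<in>I. c i *\<^sub>R integral {0..1} (line_form A C (\<gamma> i)))
      = (\<Sum>i\<in>I. c i * Re (contour_integral (\<gamma> i) ?h))"
    by (simp add: sum scaleR eq)
  also have "\<dots> = Re (\<Sum>i\<in>I. of_real (c i) * contour_integral (\<gamma> i) ?h)" by simp
  also have "\<dots> = 0"
    using Cauchy_theorem_cycle[where c = "\<lambda>i. of_real (c i)", OF I W h \<gamma>] null by simp
  finally show "\<phi> (\<Sum>i\<in>I. c i *\<^sub>R integral {0..1} (line_form A C (\<gamma> i))) = \<phi> 0" by (simp add: zero)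
qed

definition closed_paths_in :: "complex set \<Rightarrow> (real \<Rightarrow> complex) set \<Rightarrow> bool" where
  "closed_paths_in W \<Gamma> \<longleftrightarrow> finite \<Gamma> \<and>
     (\<forall>\<gamma>\<in>\<Gamma>. valid_path \<gamma> \<and> pathfinish \<gamma> = pathstart \<gamma> \<and> path_image \<gamma> \<subseteq> W)"

text \<open>
  The difference of two families is a null cycle, indexed by the disjoint union because the families
  may share paths.
\<close>

lemma holomorphic_form_homologous:
  fixes A :: "complex \<Rightarrow> 'a::banach"
  assumes form: "holomorphic_form W A C" and W: "open W"
    and \<Gamma>: "closed_paths_in W \<Gamma>" "closed_paths_in W \<Gamma>'"
    and wn: "\<And>w. w \<notin> W \<Longrightarrow> (\<Sum>\<gamma>\<in>\<Gamma>. winding_number \<gamma> w) = (\<Sum>\<gamma>\<in>\<Gamma>'. winding_number \<gamma> w)"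
  shows "(\<Sum>\<gamma>\<in>\<Gamma>. integral {0..1} (line_form A C \<gamma>)) = (\<Sum>\<gamma>\<in>\<Gamma>'. integral {0..1} (line_form A C \<gamma>))"
proof -
  have "(\<Sum>i\<in>\<Gamma> <+> \<Gamma>'. case_sum (\<lambda>_. 1) (\<lambda>_. -1) i *\<^sub>R
      integral {0..1} (line_form A C (case_sum id id i))) = 0"
  proof (rule holomorphic_form_null_cycle[OF form W])
    fix w assume "w \<notin> W"
    then show "(\<Sum>i\<in>\<Gamma> <+> \<Gamma>'. of_real (case_sum (\<lambda>_. 1) (\<lambda>_. -1) i) * winding_number (case_sum id id i) w) = 0"
      using \<Gamma> wn by (simp add: closed_paths_in_def sum.Plus o_def sum_negf)
  qed (use \<Gamma> in \<open>auto simp: closed_paths_in_def\<close>)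
  then show ?thesis
    using \<Gamma> by (simp add: closed_paths_in_def sum.Plus o_def sum_negf)
qed

lemma integral_line_form_cnj:
  fixes A :: "complex \<Rightarrow> 'a::banach"
  assumes \<gamma>: "valid_path \<gamma>"
  shows "integral {0..1} (line_form A C (cnj \<circ> \<gamma>))
       = integral {0..1} (line_form (\<lambda>z. A (cnj z)) (\<lambda>z. - C (cnj z)) \<gamma>)"
proof -
  obtain S where S: "finite S" "\<gamma> C1_differentiable_on {0..1} - S"
    using \<gamma> unfolding valid_path_def piecewise_C1_differentiable_on_def by blast
  show ?thesis
  proof (rule integral_spike)
    show "negligible (S \<union> {0, 1})" using S(1) by (intro negligible_finite) auto
    fix t assume t: "t \<in> {0..1} - (S \<union> {0, 1})"
    then have diff: "\<gamma> differentiable at t" using S(2) by (meson C1_differentiable_on_eq DiffD1 DiffD2 DiffI UnI1)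
    then have d: "(\<gamma> has_vector_derivative vector_derivative \<gamma> (at t)) (at t)"
      by (simp add: vector_derivative_works)
    have "((\<lambda>t. cnj (\<gamma> t)) has_vector_derivative cnj (vector_derivative \<gamma> (at t))) (at t)"
      using d by (rule has_vector_derivative_cnj)
    then have "vector_derivative (\<lambda>t. cnj (\<gamma> t)) (at t within {0..1}) = cnj (vector_derivative \<gamma> (at t))"
      using t by (intro vector_derivative_at_within_ivl) auto
    moreover have "vector_derivative \<gamma> (at t within {0..1}) = vector_derivative \<gamma> (at t)"
      using d t by (intro vector_derivative_at_within_ivl) auto
    ultimately show "line_form (\<lambda>z. A (cnj z)) (\<lambda>z. - C (cnj z)) \<gamma> t = line_form A C (cnj \<circ> \<gamma>) t"
      by (simp add: line_form_def Let_def o_def)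
  qed
qed

text \<open>
  Conjugation reverses orientation. If the winding numbers of \<open>\<Gamma>\<close> outside \<open>W\<close> are symmetric about the
  real axis, then \<open>\<Gamma>\<close> together with its mirror image is a null cycle in the symmetric set \<open>W\<close>, and
  the integral over the mirror image is an integral over \<open>\<Gamma>\<close> of the reflected form.
\<close>

lemma holomorphic_form_cnj_homologous:
  fixes A :: "complex \<Rightarrow> 'a::banach"
  assumes form: "holomorphic_form W A C" and W: "open W" "\<And>z. z \<in> W \<Longrightarrow> cnj z \<in> W"
    and \<Gamma>: "closed_paths_in W \<Gamma>"
    and wn: "\<And>w. w \<notin> W \<Longrightarrow> (\<Sum>\<gamma>\<in>\<Gamma>. winding_number \<gamma> (cnj w)) = cnj (\<Sum>\<gamma>\<in>\<Gamma>. winding_number \<gamma> w)"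
  shows "(\<Sum>\<gamma>\<in>\<Gamma>. integral {0..1} (line_form A C \<gamma>))
       = (\<Sum>\<gamma>\<in>\<Gamma>. integral {0..1} (line_form (\<lambda>z. - A (cnj z)) (\<lambda>z. C (cnj z)) \<gamma>))"
proof -
  have valid: "valid_path \<gamma>" if "\<gamma> \<in> \<Gamma>" for \<gamma> using \<Gamma> that by (auto simp: closed_paths_in_def)
  have wn_cnj: "winding_number (cnj \<circ> \<gamma>) w = - cnj (winding_number \<gamma> (cnj w))" if "\<gamma> \<in> \<Gamma>" "w \<notin> W" for \<gamma> w
    using winding_number_cnj[of \<gamma> "cnj w"] that \<Gamma> W(2)[of "cnj w"]
    by (auto simp: closed_paths_in_def valid_path_imp_path)
  \<comment> \<open>The left copy of an index denotes the path itself, the right copy its mirror image.\<close>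
  have "(\<Sum>i\<in>\<Gamma> <+> \<Gamma>. 1 *\<^sub>R integral {0..1} (line_form A C (case_sum id ((\<circ>) cnj) i))) = 0"
  proof (rule holomorphic_form_null_cycle[OF form W(1)])
    fix w assume w: "w \<notin> W"
    have "(\<Sum>\<gamma>\<in>\<Gamma>. winding_number (cnj \<circ> \<gamma>) w) = - (\<Sum>\<gamma>\<in>\<Gamma>. winding_number \<gamma> w)"
      using wn[OF w] wn_cnj[OF _ w] by (simp add: sum_negf flip: cnj_sum)
    then show "(\<Sum>i\<in>\<Gamma> <+> \<Gamma>. of_real 1 * winding_number (case_sum id ((\<circ>) cnj) i) w) = 0"
      using \<Gamma> by (simp add: closed_paths_in_def sum.Plus o_def)
  next
    fix i assume i: "i \<in> \<Gamma> <+> \<Gamma>"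
    then show "valid_path (case_sum id ((\<circ>) cnj) i)"
      using valid by (auto simp: valid_path_cnj)
    show "pathfinish (case_sum id ((\<circ>) cnj) i) = pathstart (case_sum id ((\<circ>) cnj) i)"
      using i \<Gamma> by (auto simp: closed_paths_in_def pathfinish_def pathstart_def)
    show "path_image (case_sum id ((\<circ>) cnj) i) \<subseteq> W"
      using i \<Gamma> W(2) by (auto simp: closed_paths_in_def path_image_def image_subset_iff)
  qed (use \<Gamma> in \<open>auto simp: closed_paths_in_def\<close>)
  then have "(\<Sum>\<gamma>\<in>\<Gamma>. integral {0..1} (line_form A C \<gamma>))
      = (\<Sum>\<gamma>\<in>\<Gamma>. - integral {0..1} (line_form A C (cnj \<circ> \<gamma>)))"
    using \<Gamma> by (simp add: closed_paths_in_def sum.Plus o_def sum_negf eq_neg_iff_add_eq_0)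
  also have "\<dots> = (\<Sum>\<gamma>\<in>\<Gamma>. integral {0..1} (line_form (\<lambda>z. - A (cnj z)) (\<lambda>z. C (cnj z)) \<gamma>))"
  proof (rule sum.cong[OF refl])
    fix \<gamma> assume "\<gamma> \<in> \<Gamma>"
    show "- integral {0..1} (line_form A C (cnj \<circ> \<gamma>))
        = integral {0..1} (line_form (\<lambda>z. - A (cnj z)) (\<lambda>z. C (cnj z)) \<gamma>)"
      unfolding integral_line_form_cnj[OF valid[OF \<open>\<gamma> \<in> \<Gamma>\<close>]] integral_neg[symmetric]
      by (intro integral_cong) (simp add: line_form_def Let_def)
  qed
  finally show ?thesis .
qed

section \<open>Slice forms in a Banach algebra\<close>

text \<open>
  For \<open>J\<^sup>2 = -1\<close> this is the embedding of the complex numbers that sends \<open>\<i>\<close> to \<open>J\<close>.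
\<close>

definition cplx :: "'a::{real_normed_algebra,monoid_mult} \<Rightarrow> complex \<Rightarrow> 'a" where
  "cplx J w = Re w *\<^sub>R 1 + Im w *\<^sub>R J"

text \<open>
  The components of a slice monogenic function, for coefficients in an algebra:
  \<open>g\<^sub>0 + i g\<^sub>1\<close> is holomorphic in the complexified algebra, with derivative \<open>p + i q\<close>, and intertwines
  the conjugations.
\<close>

definition slice_pair :: "complex set \<Rightarrow> (complex \<Rightarrow> 'a::real_normed_vector) \<Rightarrow> (complex \<Rightarrow> 'a) \<Rightarrow> bool" where
  "slice_pair W g0 g1 \<longleftrightarrow> (\<forall>z\<in>W. cnj z \<in> W \<and> g0 (cnj z) = g0 z \<and> g1 (cnj z) = - g1 z \<and>
     (\<exists>p q. (g0 has_derivative (\<lambda>w. Re w *\<^sub>R p - Im w *\<^sub>R q)) (at z) \<and>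
            (g1 has_derivative (\<lambda>w. Re w *\<^sub>R q + Im w *\<^sub>R p)) (at z)))"

lemma slice_pairD:
  assumes "slice_pair W g0 g1" "z \<in> W"
  shows "cnj z \<in> W" "g0 (cnj z) = g0 z" "g1 (cnj z) = - g1 z"
    "\<exists>p q. (g0 has_derivative (\<lambda>w. Re w *\<^sub>R p - Im w *\<^sub>R q)) (at z) \<and>
            (g1 has_derivative (\<lambda>w. Re w *\<^sub>R q + Im w *\<^sub>R p)) (at z)"
  using assms unfolding slice_pair_def by auto

lemma slice_pair_subset:
  "slice_pair W g0 g1 \<Longrightarrow> V \<subseteq> W \<Longrightarrow> (\<And>z. z \<in> V \<Longrightarrow> cnj z \<in> V) \<Longrightarrow> slice_pair V g0 g1"
  unfolding slice_pair_def by blast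

lemma slice_pair_bounded_linear:
  assumes "slice_pair W g0 g1" "bounded_linear L"
  shows "slice_pair W (\<lambda>z. L (g0 z)) (\<lambda>z. L (g1 z))"
proof -
  interpret L: bounded_linear L by fact
  show ?thesis
    unfolding slice_pair_def
  proof (intro ballI conjI)
    fix z assume z: "z \<in> W"
    note D = slice_pairD[OF assms(1) z]
    show "cnj z \<in> W" "L (g0 (cnj z)) = L (g0 z)" "L (g1 (cnj z)) = - L (g1 z)"
      using D by (auto simp: L.neg)
    obtain p q where "(g0 has_derivative (\<lambda>w. Re w *\<^sub>R p - Im w *\<^sub>R q)) (at z)"
        "(g1 has_derivative (\<lambda>w. Re w *\<^sub>R q + Im w *\<^sub>R p)) (at z)"
      using D(4) by blast
    from this[THEN L.has_derivative]
    show "\<exists>p q. ((\<lambda>z. L (g0 z)) has_derivative (\<lambda>w. Re w *\<^sub>R p - Im w *\<^sub>R q)) (at z) \<and>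
            ((\<lambda>z. L (g1 z)) has_derivative (\<lambda>w. Re w *\<^sub>R q + Im w *\<^sub>R p)) (at z)"
      by (intro exI[of _ "L p"] exI[of _ "L q"]) (simp add: L.diff L.add L.scaleR)
  qed
qed

lemma slice_pair_left_holomorphic:
  fixes J :: "'a::{real_normed_algebra,monoid_mult}"
  assumes "slice_pair W g0 g1" "z \<in> W" "J * J = - 1"
  shows "\<exists>d. ((\<lambda>z. g0 z + J * g1 z) has_derivative (\<lambda>w. cplx J w * d)) (at z)"
proof -
  obtain p q where *: "(g0 has_derivative (\<lambda>w. Re w *\<^sub>R p - Im w *\<^sub>R q)) (at z)"
      "(g1 has_derivative (\<lambda>w. Re w *\<^sub>R q + Im w *\<^sub>R p)) (at z)"
    using slice_pairD(4)[OF assms(1,2)] by blast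
  have "((\<lambda>z. g0 z + J * g1 z) has_derivative
      (\<lambda>w. (Re w *\<^sub>R p - Im w *\<^sub>R q) + J * (Re w *\<^sub>R q + Im w *\<^sub>R p))) (at z)"
    by (intro has_derivative_add * has_derivative_mult_right)
  moreover have "(Re w *\<^sub>R p - Im w *\<^sub>R q) + J * (Re w *\<^sub>R q + Im w *\<^sub>R p) = cplx J w * (p + J * q)" for w
    using assms(3) by (simp add: cplx_def algebra_simps flip: mult.assoc)
  ultimately show ?thesis by auto
qed

lemma slice_pair_right_holomorphic:
  fixes J :: "'a::{real_normed_algebra,monoid_mult}"
  assumes "slice_pair W g0 g1" "z \<in> W" "J * J = - 1"
  shows "\<exists>d. ((\<lambda>z. g0 z + g1 z * J) has_derivative (\<lambda>w. d * cplx J w)) (at z)"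
proof -
  obtain p q where *: "(g0 has_derivative (\<lambda>w. Re w *\<^sub>R p - Im w *\<^sub>R q)) (at z)"
      "(g1 has_derivative (\<lambda>w. Re w *\<^sub>R q + Im w *\<^sub>R p)) (at z)"
    using slice_pairD(4)[OF assms(1,2)] by blast
  have "((\<lambda>z. g0 z + g1 z * J) has_derivative
      (\<lambda>w. (Re w *\<^sub>R p - Im w *\<^sub>R q) + (Re w *\<^sub>R q + Im w *\<^sub>R p) * J)) (at z)"
    by (intro has_derivative_add * has_derivative_mult_left)
  moreover have "(Re w *\<^sub>R p - Im w *\<^sub>R q) + (Re w *\<^sub>R q + Im w *\<^sub>R p) * J = (p + q * J) * cplx J w" for w
    using assms(3) by (simp add: cplx_def algebra_simps mult.assoc)
  ultimately show ?thesis by auto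
qed

text \<open>
  With \<open>M a = \<phi> (X' a F + X a F')\<close> the function \<open>h = \<phi> (X F) - \<i> \<phi> (X J F)\<close> has derivative
  \<open>w \<mapsto> M w - \<i> M (w J)\<close> for \<open>w \<in> \<real> + \<real> J\<close>. This map is real linear and replaces \<open>w\<close> by \<open>w J\<close> at the
  cost of a factor \<open>\<i>\<close>, so it is complex linear. It is essential that \<open>w\<close> stands to the right of \<open>X'\<close>
  and to the left of \<open>F'\<close>: then it always meets the factor \<open>J\<close>, with which it commutes.
\<close>

lemma holomorphic_form_mult:
  fixes J :: "'a::{real_normed_algebra,monoid_mult}"
  assumes W: "open W" and J: "J * J = - 1"
    and X: "\<And>z. z \<in> W \<Longrightarrow> \<exists>d. (X has_derivative (\<lambda>w. d * cplx J w)) (at z)"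
    and F: "\<And>z. z \<in> W \<Longrightarrow> \<exists>d. (F has_derivative (\<lambda>w. cplx J w * d)) (at z)"
  shows "holomorphic_form W (\<lambda>z. X z * F z) (\<lambda>z. X z * J * F z)"
  unfolding holomorphic_form_def
proof (intro conjI allI impI)
  have cX: "isCont X z" if "z \<in> W" for z using X[OF that] has_derivative_continuous by blast
  have cF: "isCont F z" if "z \<in> W" for z using F[OF that] has_derivative_continuous by blast
  show "continuous_on W (\<lambda>z. X z * F z)" "continuous_on W (\<lambda>z. X z * J * F z)"
    by (intro continuous_at_imp_continuous_on ballI continuous_intros cX cF; assumption)+
  fix \<phi> :: "'a \<Rightarrow> real" assume "bounded_linear \<phi>"
  then interpret \<phi>: bounded_linear \<phi> .
  let ?h = "\<lambda>z. Complex (\<phi> (X z * F z)) (- \<phi> (X z * J * F z))"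
  have "\<exists>h'. (?h has_field_derivative h') (at z)" if z: "z \<in> W" for z
  proof -
    obtain x f where x: "(X has_derivative (\<lambda>w. x * cplx J w)) (at z)"
        and f: "(F has_derivative (\<lambda>w. cplx J w * f)) (at z)"
      using X[OF z] F[OF z] by blast
    define M where "M a = \<phi> (x * a * F z + X z * a * f)" for a
    have M: "M (a + b) = M a + M b" "M (r *\<^sub>R a) = r * M a" "M (- a) = - M a" for a b r
      by (simp_all add: M_def algebra_simps \<phi>.add \<phi>.scaleR \<phi>.neg \<phi>.diff)
    have d1: "((\<lambda>z. \<phi> (X z * F z)) has_derivative (\<lambda>w. M (cplx J w))) (at z)"
      using \<phi>.has_derivative[OF has_derivative_mult[OF x f]] by (simp add: M_def add.commute mult.assoc)
    have d2: "((\<lambda>z. \<phi> (X z * J * F z)) has_derivative (\<lambda>w. M (cplx J w * J))) (at z)"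
    proof -
      have comm: "J * cplx J w = cplx J w * J" for w by (simp add: cplx_def algebra_simps)
      have "X z * J * (cplx J w * f) + x * cplx J w * J * F z
          = x * (cplx J w * J) * F z + X z * (cplx J w * J) * f" for w
        by (simp add: mult.assoc flip: comm)
      then show ?thesis
        using \<phi>.has_derivative[OF has_derivative_mult[OF has_derivative_mult_left[OF x, of J] f]]
        by (simp add: M_def mult.assoc add.commute)
    qed
    have "((\<lambda>z. of_real (\<phi> (X z * F z)) + \<i> * of_real (- \<phi> (X z * J * F z))) has_derivative
        (\<lambda>w. of_real (M (cplx J w)) + \<i> * of_real (- M (cplx J w * J)))) (at z)"
      by (intro has_derivative_add has_derivative_mult_right has_derivative_of_real has_derivative_minus d1 d2)
    moreover have "of_real (M (cplx J w)) + \<i> * of_real (- M (cplx J w * J)) = Complex (M 1) (- M J) * w" for w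
    proof -
      have "cplx J w * J = Re w *\<^sub>R J + Im w *\<^sub>R (- 1)" using J by (simp add: cplx_def algebra_simps)
      then show ?thesis by (simp add: cplx_def M complex_eq_iff del: scaleR_minus_right)
    qed
    ultimately have "((\<lambda>z. of_real (\<phi> (X z * F z)) + \<i> * of_real (- \<phi> (X z * J * F z))) has_field_derivative
        Complex (M 1) (- M J)) (at z)"
      by (simp add: has_field_derivative_def)
    moreover have "?h = (\<lambda>z. of_real (\<phi> (X z * F z)) + \<i> * of_real (- \<phi> (X z * J * F z)))"
      by (simp only: Complex_eq)
    ultimately show ?thesis by metis
  qed
  then show "?h holomorphic_on W" by (simp add: holomorphic_on_open[OF W])
qed

text \<open>
  The common shape \<open>X ds (-J) F\<close> of the integrands of the left and the right functional calculus.
\<close>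

definition slice_form ::
  "'a::{real_normed_algebra,monoid_mult} \<Rightarrow> (complex \<Rightarrow> 'a) \<Rightarrow> (complex \<Rightarrow> 'a) \<Rightarrow> (complex \<Rightarrow> 'a) \<Rightarrow>
     (complex \<Rightarrow> 'a) \<Rightarrow> (real \<Rightarrow> complex) \<Rightarrow> real \<Rightarrow> 'a" where
  "slice_form J X0 X1 F0 F1 \<gamma> t =
     (X0 (\<gamma> t) + X1 (\<gamma> t) * J) * (cplx J (vector_derivative \<gamma> (at t within {0..1})) * (- J))
       * (F0 (\<gamma> t) + J * F1 (\<gamma> t))"

lemma slice_form_line_form:
  fixes J :: "'a::{real_normed_algebra,monoid_mult}"
  assumes "J * J = - 1"
  shows "slice_form J X0 X1 F0 F1 = line_form
     (\<lambda>z. (X0 z + X1 z * J) * (F1 z - J * F0 z)) (\<lambda>z. (X0 z + X1 z * J) * J * (F1 z - J * F0 z))"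
proof (intro ext)
  fix \<gamma> t
  have "- J * (F0 z + J * F1 z) = F1 z - J * F0 z" for z
    using assms by (simp add: algebra_simps flip: mult.assoc)
  then have *: "x * (c * (- J)) * (F0 z + J * F1 z) = x * c * (F1 z - J * F0 z)" for x c z
    by (simp only: mult.assoc)
  show "slice_form J X0 X1 F0 F1 \<gamma> t = line_form
     (\<lambda>z. (X0 z + X1 z * J) * (F1 z - J * F0 z)) (\<lambda>z. (X0 z + X1 z * J) * J * (F1 z - J * F0 z)) \<gamma> t"
    unfolding slice_form_def line_form_def Let_def *
    by (simp add: cplx_def distrib_left distrib_right)
qed

lemma slice_form_holomorphic:
  fixes J :: "'a::{real_normed_algebra,monoid_mult}"
  assumes W: "open W" and J: "J * J = - 1" and X: "slice_pair W X0 X1" and F: "slice_pair W F0 F1"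
  shows "holomorphic_form W
     (\<lambda>z. (X0 z + X1 z * J) * (F1 z - J * F0 z)) (\<lambda>z. (X0 z + X1 z * J) * J * (F1 z - J * F0 z))"
proof (rule holomorphic_form_mult[OF W J])
  fix z assume z: "z \<in> W"
  show "\<exists>d. ((\<lambda>z. X0 z + X1 z * J) has_derivative (\<lambda>w. d * cplx J w)) (at z)"
    by (rule slice_pair_right_holomorphic[OF X z J])
  obtain d where "((\<lambda>z. F0 z + J * F1 z) has_derivative (\<lambda>w. cplx J w * d)) (at z)"
    using slice_pair_left_holomorphic[OF F z J] by blast
  then have "((\<lambda>z. - J * (F0 z + J * F1 z)) has_derivative (\<lambda>w. - J * (cplx J w * d))) (at z)"
    by (rule has_derivative_mult_right)
  moreover have "- J * (F0 z + J * F1 z) = F1 z - J * F0 z" for z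
    using J by (simp add: algebra_simps flip: mult.assoc)
  moreover have "- J * (cplx J w * d) = cplx J w * (- J * d)" for w
    by (simp add: cplx_def algebra_simps)
  ultimately have "((\<lambda>z. F1 z - J * F0 z) has_derivative (\<lambda>w. cplx J w * (- J * d))) (at z)"
    by (simp only:)
  then show "\<exists>d. ((\<lambda>z. F1 z - J * F0 z) has_derivative (\<lambda>w. cplx J w * d)) (at z)" by blast
qed

text \<open>
  The terms linear in \<open>J\<close> cancel in the sum; the others contain \<open>J\<close> only through \<open>J\<^sup>2 = -1\<close>.
\<close>

lemma slice_form_even_part:
  fixes J :: "'a::{real_normed_algebra,monoid_mult}"
  assumes J: "J * J = - 1" and J': "J' * J' = - 1"
  shows "slice_form J X0 X1 F0 F1 \<gamma> t + slice_form (- J) X0 X1 F0 F1 \<gamma> t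
       = slice_form J' X0 X1 F0 F1 \<gamma> t + slice_form (- J') X0 X1 F0 F1 \<gamma> t"
proof -
  define d where "d = vector_derivative \<gamma> (at t within {0..1})"
  define x0 x1 f0 f1 where "x0 = X0 (\<gamma> t)" "x1 = X1 (\<gamma> t)" "f0 = F0 (\<gamma> t)" "f1 = F1 (\<gamma> t)"
  define e where "e = Im d *\<^sub>R (x0 * f0 - x1 * f1) + Re d *\<^sub>R (x0 * f1 + x1 * f0)"
  have split: "slice_form J X0 X1 F0 F1 \<gamma> t
      = e + (Im d *\<^sub>R (x0 * J * f1 + x1 * J * f0) + Re d *\<^sub>R (x1 * J * f1 - x0 * J * f0))"
    if J: "J * J = - 1" for J
  proof -
    have JJ: "J * (J * y) = - y" for y using J by (simp flip: mult.assoc)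
    have "cplx J d * (- J) = Im d *\<^sub>R 1 - Re d *\<^sub>R J"
      using J by (simp add: cplx_def algebra_simps)
    then have "slice_form J X0 X1 F0 F1 \<gamma> t
        = (x0 + x1 * J) * (Im d *\<^sub>R 1 - Re d *\<^sub>R J) * (f0 + J * f1)"
      by (simp add: slice_form_def d_def x0_x1_f0_f1_def)
    also have "\<dots> = Im d *\<^sub>R ((x0 + x1 * J) * (f0 + J * f1)) - Re d *\<^sub>R ((x0 + x1 * J) * (J * (f0 + J * f1)))"
      by (simp add: right_diff_distrib left_diff_distrib mult.assoc)
    also have "(x0 + x1 * J) * (f0 + J * f1) = (x0 * f0 - x1 * f1) + (x0 * J * f1 + x1 * J * f0)"
      by (simp add: distrib_left distrib_right mult.assoc JJ)
    also have "(x0 + x1 * J) * (J * (f0 + J * f1)) = - (x0 * f1 + x1 * f0) - (x1 * J * f1 - x0 * J * f0)"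
      by (simp add: distrib_left distrib_right right_diff_distrib mult.assoc JJ)
    finally show ?thesis
      by (simp add: e_def scaleR_diff_right scaleR_add_right)
  qed
  have "slice_form J X0 X1 F0 F1 \<gamma> t + slice_form (- J) X0 X1 F0 F1 \<gamma> t = e + e" if J: "J * J = - 1" for J
    using split[OF J] split[of "- J"] J by (simp add: scaleR_diff_right scaleR_add_right)
  from this[OF J] this[OF J'] show ?thesis by simp
qed

text \<open>
  The abstract form of the independence theorem. The integral \<open>I J\<close> over the first family equals
  \<open>I (- J)\<close> by reflection in the real axis, while \<open>I J + I (- J)\<close> is independent of \<open>J\<close>; so \<open>I J\<close>
  is itself independent of \<open>J\<close>, and the two families may then be compared with one and the same unit.
\<close>

theorem slice_form_integral_independent:
  fixes J :: "'a::{real_normed_algebra,monoid_mult,banach}"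
  assumes W: "open W" and X: "slice_pair W X0 X1" and F: "slice_pair W F0 F1"
    and J: "J * J = - 1" and J': "J' * J' = - 1"
    and \<Gamma>: "closed_paths_in W \<Gamma>" "closed_paths_in W \<Gamma>'"
    and wn: "\<And>w. w \<notin> W \<Longrightarrow> (\<Sum>\<gamma>\<in>\<Gamma>. winding_number \<gamma> w) = m w"
      "\<And>w. w \<notin> W \<Longrightarrow> (\<Sum>\<gamma>\<in>\<Gamma>'. winding_number \<gamma> w) = m w"
    and m: "\<And>w. w \<notin> W \<Longrightarrow> m (cnj w) = cnj (m w)"
  shows "(\<Sum>\<gamma>\<in>\<Gamma>. integral {0..1} (slice_form J X0 X1 F0 F1 \<gamma>))
       = (\<Sum>\<gamma>\<in>\<Gamma>'. integral {0..1} (slice_form J' X0 X1 F0 F1 \<gamma>))"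
proof -
  define I where "I J = (\<Sum>\<gamma>\<in>\<Gamma>. integral {0..1} (slice_form J X0 X1 F0 F1 \<gamma>))" for J
  have sym: "cnj z \<in> W" if "z \<in> W" for z using slice_pairD(1)[OF X that] .
  have neg: "(- J) * (- J) = - 1" if "J * J = - 1" for J :: 'a using that by simp
  have int: "slice_form J X0 X1 F0 F1 \<gamma> integrable_on {0..1}" if "J * J = - 1" "\<gamma> \<in> \<Gamma>" for J \<gamma>
    unfolding slice_form_line_form[OF that(1)] using \<Gamma>(1) that(2)
    by (intro line_form_integrable[OF slice_form_holomorphic[OF W that(1) X F] W]) (auto simp: closed_paths_in_def)
  have flip: "I J = I (- J)" if J: "J * J = - 1" for J
  proof -
    let ?A = "\<lambda>J z. (X0 z + X1 z * J) * (F1 z - J * F0 z)"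
    let ?C = "\<lambda>J z. (X0 z + X1 z * J) * J * (F1 z - J * F0 z)"
    have wn': "(\<Sum>\<gamma>\<in>\<Gamma>. winding_number \<gamma> (cnj w)) = cnj (\<Sum>\<gamma>\<in>\<Gamma>. winding_number \<gamma> w)" if "w \<notin> W" for w
    proof -
      have "cnj w \<notin> W" using sym[of "cnj w"] that by auto
      then show ?thesis using wn(1) m that by simp
    qed
    have "I J = (\<Sum>\<gamma>\<in>\<Gamma>. integral {0..1} (line_form (\<lambda>z. - ?A J (cnj z)) (\<lambda>z. ?C J (cnj z)) \<gamma>))"
      unfolding I_def slice_form_line_form[OF J]
      by (rule holomorphic_form_cnj_homologous[OF slice_form_holomorphic[OF W J X F] W sym \<Gamma>(1) wn'])
    also have "\<dots> = I (- J)"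
      unfolding I_def slice_form_line_form[OF neg[OF J]]
    proof (intro sum.cong refl integral_cong)
      fix \<gamma> and t :: real assume "\<gamma> \<in> \<Gamma>" "t \<in> {0..1}"
      then have "\<gamma> t \<in> W" using \<Gamma>(1) by (force simp: closed_paths_in_def path_image_def)
      note D = slice_pairD(2,3)[OF X this] slice_pairD(2,3)[OF F this]
      show "line_form (\<lambda>z. - ?A J (cnj z)) (\<lambda>z. ?C J (cnj z)) \<gamma> t = line_form (?A (- J)) (?C (- J)) \<gamma> t"
        by (simp add: line_form_def Let_def D algebra_simps)
    qed
    finally show ?thesis .
  qed
  have even: "I J + I (- J) = I J' + I (- J')"
  proof -
    have "I J + I (- J)
        = (\<Sum>\<gamma>\<in>\<Gamma>. integral {0..1} (\<lambda>t. slice_form J X0 X1 F0 F1 \<gamma> t + slice_form (- J) X0 X1 F0 F1 \<gamma> t))"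
      if "J * J = - 1" for J
      unfolding I_def using int[OF that] int[OF neg[OF that]]
      by (simp add: integral_add flip: sum.distrib)
    then show ?thesis using J J' slice_form_even_part[OF J J'] by simp
  qed
  have "2 *\<^sub>R I J = 2 *\<^sub>R I J'"
    using even flip[OF J] flip[OF J'] by (simp add: scaleR_2)
  then have "I J = I J'" by simp
  also have "\<dots> = (\<Sum>\<gamma>\<in>\<Gamma>'. integral {0..1} (slice_form J' X0 X1 F0 F1 \<gamma>))"
    unfolding I_def slice_form_line_form[OF J']
    using wn by (intro holomorphic_form_homologous[OF slice_form_holomorphic[OF W J' X F] W \<Gamma>]) simp
  finally show ?thesis by (simp add: I_def)
qed

section \<open>Inverses in a Banach algebra\<close>

definition inverse_of :: "'a::monoid_mult \<Rightarrow> 'a \<Rightarrow> bool" where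
  "inverse_of R P \<longleftrightarrow> P * R = 1 \<and> R * P = 1"

lemma inverse_of_unique: "inverse_of R P \<Longrightarrow> inverse_of R' P \<Longrightarrow> R = R'"
  unfolding inverse_of_def by (metis mult.assoc mult_1_left mult_1_right)

lemma inverse_of_commute:
  assumes "inverse_of R P" "P * a = a * P"
  shows "R * a = a * R"
proof -
  have "R * a = R * (a * P) * R" using assms(1) by (simp add: inverse_of_def mult.assoc)
  also have "\<dots> = a * R" using assms by (simp add: inverse_of_def flip: assms(2)) (simp add: inverse_of_def flip: mult.assoc)
  finally show ?thesis .
qed

text \<open>
  A right and a left inverse are the fixed points of the contractions \<open>x \<mapsto> 1 + a x\<close> and
  \<open>y \<mapsto> 1 + y a\<close>, and they coincide by associativity.
\<close>

lemma inverse_of_one_minus: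
  fixes a :: "'a::{real_normed_algebra,monoid_mult,banach}"
  assumes "norm a < 1"
  shows "\<exists>R. inverse_of R (1 - a)"
proof -
  have "\<exists>!x. 1 + a * x = x"
  proof (rule banach_fix_type[of "norm a"])
    show "\<forall>x y. dist (1 + a * x) (1 + a * y) \<le> norm a * dist x y"
      by (simp add: dist_norm norm_mult_ineq flip: right_diff_distrib)
  qed (use assms in auto)
  then obtain x where x: "1 + a * x = x" by blast
  have "\<exists>!y. 1 + y * a = y"
  proof (rule banach_fix_type[of "norm a"])
    show "\<forall>x y. dist (1 + x * a) (1 + y * a) \<le> norm a * dist x y"
      by (simp add: dist_norm mult.commute[of "norm a"] norm_mult_ineq flip: left_diff_distrib)
  qed (use assms in auto)
  then obtain y where y: "1 + y * a = y" by blast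
  have 1: "(1 - a) * x = 1" using x by (simp add: left_diff_distrib) (metis add_diff_cancel_right')
  have 2: "y * (1 - a) = 1" using y by (simp add: right_diff_distrib) (metis add_diff_cancel_right')
  have "y = y * ((1 - a) * x)" using 1 by simp
  also have "\<dots> = x" using 2 by (simp flip: mult.assoc)
  finally show ?thesis using 1 2 by (auto simp: inverse_of_def)
qed

text \<open>
  \<open>P' = P (1 - R (P - P'))\<close> is a product of two invertible elements.
\<close>

lemma inverse_of_perturb:
  fixes P :: "'a::{real_normed_algebra,monoid_mult,banach}"
  assumes R: "inverse_of R P" and small: "norm R * norm (P - P') < 1"
  shows "\<exists>R'. inverse_of R' P'"
proof -
  have "norm (R * (P - P')) < 1" using norm_mult_ineq small by (rule le_less_trans)
  then obtain S where S: "inverse_of S (1 - R * (P - P'))" using inverse_of_one_minus by blast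
  have "P * (1 - R * (P - P')) = P'"
    using R by (simp add: inverse_of_def right_diff_distrib flip: mult.assoc)
  moreover have "inverse_of (S * R) (P * (1 - R * (P - P')))"
  proof -
    have "P * (1 - R * (P - P')) * (S * R) = P * ((1 - R * (P - P')) * S) * R" by (simp only: mult.assoc)
    moreover have "S * R * (P * (1 - R * (P - P'))) = S * (R * P) * (1 - R * (P - P'))" by (simp only: mult.assoc)
    ultimately show ?thesis using R S by (simp add: inverse_of_def)
  qed
  ultimately show ?thesis by auto
qed

text \<open>
  From \<open>R x - R z = - R x (P x - P z) R z\<close> one first gets that \<open>R\<close> stays bounded near \<open>z\<close>, and then that
  it converges.
\<close>

lemma inverse_of_isCont:
  fixes P R :: "'b::metric_space \<Rightarrow> 'a::{real_normed_algebra,monoid_mult,banach}"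
  assumes inv: "\<And>x. x \<in> U \<Longrightarrow> inverse_of (R x) (P x)" and "open U" "z \<in> U" and P: "isCont P z"
  shows "isCont R z"
proof -
  define k where "k x = norm (R z) * norm (P x - P z)" for x
  have "(k \<longlongrightarrow> norm (R z) * norm (P z - P z)) (at z)"
    unfolding k_def using P by (intro tendsto_intros) (simp add: isCont_def)
  then have k0: "(k \<longlongrightarrow> 0) (at z)" by simp
  then have "\<forall>\<^sub>F x in at z. k x < 1 / 2" by (rule order_tendstoD) simp
  moreover have "\<forall>\<^sub>F x in at z. x \<in> U"
    using assms(2,3) by (simp add: eventually_at_in_open')
  ultimately have "\<forall>\<^sub>F x in at z. norm (R x - R z) \<le> 2 * norm (R z) * k x"
  proof eventually_elim
    case (elim x)
    have "R x * (P x - P z) * R z = R z - R x"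
      using inv[OF elim(2)] inv[OF assms(3)]
      by (simp add: inverse_of_def right_diff_distrib left_diff_distrib mult.assoc)
    then have eq: "R x - R z = - (R x * (P x - P z) * R z)" by simp
    have "norm (R x - R z) \<le> norm (R x * (P x - P z)) * norm (R z)"
      unfolding eq norm_minus_cancel by (rule norm_mult_ineq)
    also have "\<dots> \<le> norm (R x) * norm (P x - P z) * norm (R z)"
      by (intro mult_right_mono norm_mult_ineq norm_ge_zero)
    finally have le: "norm (R x - R z) \<le> norm (R x) * k x"
      by (simp only: k_def mult.assoc mult.commute[of "norm (P x - P z)"])
    also have "\<dots> \<le> norm (R x) * (1 / 2)" using elim(1) by (intro mult_left_mono) auto
    finally have "norm (R x) \<le> 2 * norm (R z)" using norm_triangle_ineq2[of "R x" "R z"] by simp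
    then have "norm (R x) * k x \<le> 2 * norm (R z) * k x" by (intro mult_right_mono) (auto simp: k_def)
    then show ?case using le by simp
  qed
  moreover have "((\<lambda>x. 2 * norm (R z) * k x) \<longlongrightarrow> 2 * norm (R z) * 0) (at z)"
    by (intro tendsto_intros k0)
  ultimately have "((\<lambda>x. R x - R z) \<longlongrightarrow> 0) (at z)"
    using Lim_null_comparison[of "\<lambda>x. R x - R z" "\<lambda>x. 2 * norm (R z) * k x" "at z"] by simp
  then show ?thesis unfolding isCont_def by (rule LIM_zero_cancel)
qed

text \<open>
  A product rule in which the first factor is merely continuous, at a zero of the second one.
\<close>

lemma has_derivative_mult_zero:
  fixes R H :: "'b::real_normed_vector \<Rightarrow> 'a::real_normed_algebra"
  assumes R: "isCont R z" and H: "(H has_derivative H') (at z)" and 0: "H z = 0"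
  shows "((\<lambda>x. R x * H x) has_derivative (\<lambda>w. R z * H' w)) (at z)"
proof -
  note bl = has_derivative_bounded_linear[OF H]
  obtain K where K: "\<And>w. norm (H' w) \<le> norm w * K" using bounded_linear.bounded[OF bl] by blast
  have lim: "((\<lambda>x. norm (H x - H z - H' (x - z)) / norm (x - z)) \<longlongrightarrow> 0) (at z)"
    using H unfolding has_derivative_iff_norm by simp
  show ?thesis
    unfolding has_derivative_iff_norm
  proof (intro conjI)
    show "bounded_linear (\<lambda>w. R z * H' w)" by (intro bounded_linear_const_mult bl)
    have "((\<lambda>x. norm (R x) * (norm (H x - H z - H' (x - z)) / norm (x - z)) + norm (R x - R z) * \<bar>K\<bar>)
        \<longlongrightarrow> norm (R z) * 0 + norm (R z - R z) * \<bar>K\<bar>) (at z)"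
      using R by (intro tendsto_intros lim) (simp_all add: isCont_def)
    then have "((\<lambda>x. norm (R x) * (norm (H x - H z - H' (x - z)) / norm (x - z)) + norm (R x - R z) * \<bar>K\<bar>)
        \<longlongrightarrow> 0) (at z)" by simp
    then show "((\<lambda>x. norm (R x * H x - R z * H z - R z * H' (x - z)) / norm (x - z)) \<longlongrightarrow> 0) (at z)"
    proof (rule Lim_null_comparison[rotated], intro always_eventually allI)
      fix x
      have "R x * H x - R z * H z - R z * H' (x - z)
          = R x * (H x - H z - H' (x - z)) + (R x - R z) * H' (x - z)"
        by (simp add: 0 algebra_simps)
      also have "norm \<dots> \<le> norm (R x) * norm (H x - H z - H' (x - z)) + norm (R x - R z) * (norm (x - z) * \<bar>K\<bar>)"
      proof (rule norm_triangle_le, intro add_mono)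
        have "norm (H' (x - z)) \<le> norm (x - z) * \<bar>K\<bar>"
          using K[of "x - z"] by (smt (verit) mult_left_mono norm_ge_zero)
        then show "norm ((R x - R z) * H' (x - z)) \<le> norm (R x - R z) * (norm (x - z) * \<bar>K\<bar>)"
          by (intro order_trans[OF norm_mult_ineq] mult_left_mono) auto
      qed (rule norm_mult_ineq)
      finally show "norm (norm (R x * H x - R z * H z - R z * H' (x - z)) / norm (x - z))
          \<le> norm (R x) * (norm (H x - H z - H' (x - z)) / norm (x - z)) + norm (R x - R z) * \<bar>K\<bar>"
        by (cases "x = z") (simp_all add: field_simps)
    qed
  qed
qed

text \<open>
  Write \<open>R x = R z - R x (P x - P z) R z\<close>. The factor \<open>P x - P z\<close> vanishes at \<open>z\<close>, so continuity of the
  other factor \<open>R\<close> suffices.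
\<close>

lemma inverse_of_has_derivative:
  fixes P R :: "'b::real_normed_vector \<Rightarrow> 'a::{real_normed_algebra,monoid_mult,banach}"
  assumes inv: "\<And>x. x \<in> U \<Longrightarrow> inverse_of (R x) (P x)" and U: "open U" "z \<in> U"
    and P: "(P has_derivative P') (at z)"
  shows "(R has_derivative (\<lambda>w. - (R z * P' w * R z))) (at z)"
proof -
  have cont: "isCont R z"
    by (rule inverse_of_isCont[OF inv U has_derivative_continuous[OF P]])
  have "((\<lambda>x. (P x - P z) * R z) has_derivative (\<lambda>w. (P' w - 0) * R z)) (at z)"
    by (intro has_derivative_mult_left has_derivative_diff P has_derivative_const)
  from has_derivative_mult_zero[OF cont this]
  have "((\<lambda>x. R x * ((P x - P z) * R z)) has_derivative (\<lambda>w. R z * (P' w * R z))) (at z)" by simp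
  from has_derivative_diff[OF has_derivative_const[of "R z"] this]
  have "((\<lambda>x. R z - R x * ((P x - P z) * R z)) has_derivative (\<lambda>w. - (R z * P' w * R z))) (at z)"
    by (simp add: mult.assoc)
  then show ?thesis
  proof (rule has_derivative_transform_within_open[OF _ U])
    fix x assume x: "x \<in> U"
    have "R x * ((P x - P z) * R z) = R x * P x * R z - R x * (P z * R z)"
      by (simp add: algebra_simps)
    then show "R z - R x * ((P x - P z) * R z) = R x"
      using inv[OF x] inv[OF U(2)] by (simp add: inverse_of_def)
  qed
qed

text \<open>
  With \<open>a = T - u\<close> the polynomial is \<open>P = a\<^sup>2 + v\<^sup>2\<close>, hence \<open>g\<^sub>0 + i g\<^sub>1 = -(a + i v) P\<^sup>-\<^sup>1 = (u + i v - T)\<^sup>-\<^sup>1\<close>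
  in the complexified algebra. The derivative \<open>p + i q\<close> is accordingly minus the square of this
  resolvent.
\<close>

lemma resolvent_slice_pair:
  fixes T :: "'a::{real_normed_algebra,monoid_mult,banach}"
  defines "P \<equiv> \<lambda>z :: complex. T ^ 2 - (2 * Re z) *\<^sub>R T + (cmod z)\<^sup>2 *\<^sub>R 1"
  assumes inv: "\<And>z. z \<in> W \<Longrightarrow> inverse_of (R z) (P z)" and W: "open W" "\<And>z. z \<in> W \<Longrightarrow> cnj z \<in> W"
  shows "slice_pair W (\<lambda>z. - (R z * (T - Re z *\<^sub>R 1))) (\<lambda>z. - (Im z *\<^sub>R R z))"
  unfolding slice_pair_def
proof (intro ballI conjI)
  fix z assume z: "z \<in> W"
  then show cz: "cnj z \<in> W" by (rule W(2))
  have "P (cnj z) = P z" by (simp add: P_def)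
  then have Rc: "R (cnj z) = R z" using inv[OF cz] inv[OF z] by (auto intro: inverse_of_unique)
  then show "- (R (cnj z) * (T - Re (cnj z) *\<^sub>R 1)) = - (R z * (T - Re z *\<^sub>R 1))"
    "- (Im (cnj z) *\<^sub>R R (cnj z)) = - (- (Im z *\<^sub>R R z))" by simp_all
  define a where "a = T - Re z *\<^sub>R 1"
  define r where "r = R z"
  define v where "v = Im z"
  have Pa: "P z = a * a + v\<^sup>2 *\<^sub>R 1"
    unfolding P_def a_def v_def cmod_power2
    by (simp add: power2_eq_square algebra_simps scaleR_2 flip: scaleR_scaleR)
  have rP: "r * (a * a) + v\<^sup>2 *\<^sub>R r = 1"
    using inv[OF z] by (simp add: inverse_of_def Pa r_def distrib_left)
  have ra: "r * a = a * r"
    unfolding r_def by (rule inverse_of_commute[OF inv[OF z]]) (simp add: Pa algebra_simps)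
  have "(P has_derivative (\<lambda>w. (- (2 * Re w)) *\<^sub>R T + (2 * (Re z * Re w + Im z * Im w)) *\<^sub>R 1)) (at z)"
  proof -
    have "P = (\<lambda>z. T ^ 2 + (- (2 * Re z)) *\<^sub>R T + ((Re z)\<^sup>2 + (Im z)\<^sup>2) *\<^sub>R 1)"
      by (simp add: P_def cmod_power2 fun_eq_iff)
    moreover have "((\<lambda>z. T ^ 2 + (- (2 * Re z)) *\<^sub>R T + ((Re z)\<^sup>2 + (Im z)\<^sup>2) *\<^sub>R 1) has_derivative
        (\<lambda>w. (- (2 * Re w)) *\<^sub>R T + (2 * (Re z * Re w + Im z * Im w)) *\<^sub>R 1)) (at z)"
      by (rule derivative_eq_intros refl has_derivative_bounded_linear | simp add: algebra_simps)+
    ultimately show ?thesis by simp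
  qed
  moreover have "(- (2 * Re w)) *\<^sub>R T + (2 * (Re z * Re w + Im z * Im w)) *\<^sub>R 1
      = 2 *\<^sub>R ((v * Im w) *\<^sub>R 1 - Re w *\<^sub>R a)" for w
    by (simp add: a_def v_def algebra_simps)
  ultimately have "(P has_derivative (\<lambda>w. 2 *\<^sub>R ((v * Im w) *\<^sub>R 1 - Re w *\<^sub>R a))) (at z)" by simp
  from inverse_of_has_derivative[OF inv W(1) z this]
  have "(R has_derivative (\<lambda>w. - (r * (2 *\<^sub>R ((v * Im w) *\<^sub>R 1 - Re w *\<^sub>R a)) * r))) (at z)"
    by (simp add: r_def)
  moreover have "- (r * (2 *\<^sub>R ((v * Im w) *\<^sub>R 1 - Re w *\<^sub>R a)) * r)
      = (2 * Re w) *\<^sub>R (r * r * a) - (2 * v * Im w) *\<^sub>R (r * r)" for w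
  proof -
    have "r * r * a = r * a * r" by (metis mult.assoc ra)
    then show ?thesis
      by (simp add: right_diff_distrib left_diff_distrib scaleR_diff_right)
  qed
  ultimately have dR: "(R has_derivative (\<lambda>w. (2 * Re w) *\<^sub>R (r * r * a) - (2 * v * Im w) *\<^sub>R (r * r))) (at z)"
    by simp
  define p where "p = r - 2 *\<^sub>R (r * r * a * a)"
  define q where "q = - (2 * v) *\<^sub>R (r * r * a)"
  have p: "p = (2 * v\<^sup>2) *\<^sub>R (r * r) - r"
  proof -
    have "r = r * (r * (a * a) + v\<^sup>2 *\<^sub>R r)" by (simp add: rP)
    also have "\<dots> = r * r * a * a + v\<^sup>2 *\<^sub>R (r * r)" by (simp add: distrib_left mult.assoc)
    finally have "2 *\<^sub>R (r * r * a * a) = 2 *\<^sub>R r - (2 * v\<^sup>2) *\<^sub>R (r * r)"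
      by (metis add_diff_cancel_right' scaleR_diff_right scaleR_scaleR)
    then show ?thesis by (simp add: p_def scaleR_2)
  qed
  have "((\<lambda>z. - (R z * (T - Re z *\<^sub>R 1))) has_derivative
      (\<lambda>w. - (R z * (0 - Re w *\<^sub>R 1) + ((2 * Re w) *\<^sub>R (r * r * a) - (2 * v * Im w) *\<^sub>R (r * r)) * (T - Re z *\<^sub>R 1)))) (at z)"
    by (intro has_derivative_minus has_derivative_mult dR has_derivative_diff has_derivative_const
        has_derivative_scaleR_left bounded_linear_imp_has_derivative bounded_linear_Re)
  moreover have "- (R z * (0 - Re w *\<^sub>R 1) + ((2 * Re w) *\<^sub>R (r * r * a) - (2 * v * Im w) *\<^sub>R (r * r)) * (T - Re z *\<^sub>R 1))
      = Re w *\<^sub>R p - Im w *\<^sub>R q" for w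
    unfolding a_def[symmetric] r_def[symmetric] p_def q_def
    by (simp add: left_diff_distrib scaleR_diff_right mult.commute)
  ultimately have d0: "((\<lambda>z. - (R z * (T - Re z *\<^sub>R 1))) has_derivative (\<lambda>w. Re w *\<^sub>R p - Im w *\<^sub>R q)) (at z)"
    by simp
  have "((\<lambda>z. - (Im z *\<^sub>R R z)) has_derivative
      (\<lambda>w. - (Im z *\<^sub>R ((2 * Re w) *\<^sub>R (r * r * a) - (2 * v * Im w) *\<^sub>R (r * r)) + Im w *\<^sub>R R z))) (at z)"
    by (intro has_derivative_minus has_derivative_scaleR dR bounded_linear_imp_has_derivative bounded_linear_Im)
  moreover have "- (Im z *\<^sub>R ((2 * Re w) *\<^sub>R (r * r * a) - (2 * v * Im w) *\<^sub>R (r * r)) + Im w *\<^sub>R R z)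
      = Re w *\<^sub>R q + Im w *\<^sub>R p" for w
    unfolding r_def[symmetric] v_def[symmetric] p q_def
    by (simp add: scaleR_diff_right power2_eq_square mult_ac)
  ultimately have d1: "((\<lambda>z. - (Im z *\<^sub>R R z)) has_derivative (\<lambda>w. Re w *\<^sub>R q + Im w *\<^sub>R p)) (at z)"
    by simp
  from d0 d1 show "\<exists>p q. ((\<lambda>z. - (R z * (T - Re z *\<^sub>R 1))) has_derivative (\<lambda>w. Re w *\<^sub>R p - Im w *\<^sub>R q)) (at z) \<and>
      ((\<lambda>z. - (Im z *\<^sub>R R z)) has_derivative (\<lambda>w. Re w *\<^sub>R q + Im w *\<^sub>R p)) (at z)" by blast
qed

section \<open>Slice monogenic functions in a plane\<close>

lemma has_derivative_of_C1_partials: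
  assumes "open P" "C1_partials P g gu gv" "(u, v) \<in> P"
  shows "((\<lambda>(x, y). g x y) has_derivative (\<lambda>(a, b). a *\<^sub>R gu u v + b *\<^sub>R gv u v)) (at (u, v))"
proof -
  obtain A B where AB: "open A" "open B" "u \<in> A" "v \<in> B" "A \<times> B \<subseteq> P"
    using open_prod_elim[OF assms(1,3)] by (metis mem_Sigma_iff)
  obtain e where e: "0 < e" "ball v e \<subseteq> B" using AB by (meson openE)
  let ?Y = "ball v e"
  have sub: "A \<times> ?Y \<subseteq> P" using AB e by blast
  have vd: "((\<lambda>x. g x y) has_vector_derivative gu x y) (at x)"
    "((\<lambda>y. g x y) has_vector_derivative gv x y) (at y)" if "(x, y) \<in> P" for x y
    using assms(2) that unfolding C1_partials_def by auto
  have "((\<lambda>(x, y). g x y) has_derivative (\<lambda>(a, b). a *\<^sub>R gu u v + blinfun_apply (blinfun_scaleR_left (gv u v)) b))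
      (at (u, v) within A \<times> ?Y)"
  proof (rule has_derivative_partialsI)
    show "((\<lambda>x. g x v) has_derivative (\<lambda>a. a *\<^sub>R gu u v)) (at u within A)"
      using vd(1)[OF assms(3)] unfolding has_vector_derivative_def by (rule has_derivative_at_withinI)
    show "((\<lambda>y. g x y) has_derivative blinfun_apply (blinfun_scaleR_left (gv x y))) (at y within ?Y)"
      if "x \<in> A" "y \<in> ?Y" for x y
    proof -
      have "(x, y) \<in> P" using that sub by blast
      from vd(2)[OF this] show ?thesis
        unfolding has_vector_derivative_def blinfun_scaleR_left.rep_eq by (rule has_derivative_at_withinI)
    qed
    have "continuous_on P (\<lambda>x. blinfun_scaleR_left ((\<lambda>(x, y). gv x y) x))"
      using assms(2) unfolding C1_partials_def by (intro bounded_linear.continuous_on[OF bounded_linear_blinfun_scaleR_left]) auto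
    then have "continuous_on (A \<times> ?Y) (\<lambda>(x, y). blinfun_scaleR_left (gv x y))"
      using sub by (auto simp: split_def intro: continuous_on_subset)
    then show "continuous (at (u, v) within A \<times> ?Y) (\<lambda>(x, y). blinfun_scaleR_left (gv x y))"
      using AB(3) e(1) by (simp add: continuous_on_eq_continuous_within)
  qed (use e in auto)
  then show ?thesis
    using AB(1,3) e(1) by (simp add: at_within_open[of _ "A \<times> ?Y"] open_Times)
qed

lemma continuous_slice_pt: "continuous_on A (slice_pt j)"
  unfolding slice_pt_def by (intro continuous_intros)

lemma open_slice: "open U \<Longrightarrow> open (slice U j)"
  using open_vimage[OF _ continuous_slice_pt[of UNIV j], of U] by (simp add: slice_def vimage_def)

lemma closure_slice_subset: "closure (slice U j) \<subseteq> slice (closure U) j"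
proof (rule closure_minimal)
  show "slice U j \<subseteq> slice (closure U) j" using closure_subset by (auto simp: slice_def)
  show "closed (slice (closure U) j)"
    using closed_vimage[OF closed_closure continuous_slice_pt[of UNIV j], of U]
    by (simp add: slice_def vimage_def)
qed

lemma norm_slice_pt: "j \<in> \<S> \<Longrightarrow> norm (slice_pt j z) = cmod z"
  by (simp add: slice_pt_def norm_Pair cmod_def)

lemma slice_pt_cnj: "slice_pt j (cnj z) = slice_pt (- j) z"
  by (simp add: slice_pt_def)

lemma axially_symmetric_slice:
  assumes "axially_symmetric U" "i \<in> \<S>" "j \<in> \<S>"
  shows "slice U i = slice U j"
  using assms unfolding axially_symmetric_def slice_def by blast

lemma axially_symmetric_slice_cnj:
  assumes "axially_symmetric U" "j \<in> \<S>" "z \<in> slice U j"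
  shows "cnj z \<in> slice U j"
proof -
  have "- j \<in> \<S>" using assms(2) by simp
  then show ?thesis
    using assms unfolding axially_symmetric_def slice_def slice_pt_cnj mem_Collect_eq by blast
qed

lemma slice_plane_iff:
  assumes "axially_symmetric U" "j \<in> \<S>"
  shows "(Re z, Im z) \<in> slice_plane U \<longleftrightarrow> z \<in> slice U j"
  using assms unfolding axially_symmetric_def slice_plane_def slice_def slice_pt_def by blast

text \<open>
  A function given by continuous partial derivatives is differentiable, so the partial differential
  equations for the components yield the total derivatives required of a slice pair.
\<close>

lemma slice_components_slice_pair:
  assumes D: "open D" "axially_symmetric D" and j: "j \<in> \<S>" and f: "slice_components D f0 f1"
  shows "slice_pair (slice D j) (\<lambda>z. f0 (Re z) (Im z)) (\<lambda>z. f1 (Re z) (Im z))"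
proof -
  obtain f0u f0v f1u f1v where C1: "C1_partials (slice_plane D) f0 f0u f0v"
      "C1_partials (slice_plane D) f1 f1u f1v"
    and CR: "\<And>u v. (u, v) \<in> slice_plane D \<Longrightarrow> f0u u v = f1v u v \<and> f0v u v = - f1u u v"
    and par: "\<And>u v. (u, v) \<in> slice_plane D \<Longrightarrow> f0 u (- v) = f0 u v \<and> f1 u (- v) = - f1 u v"
    using f unfolding slice_components_def by fast
  have op: "open (slice_plane D)"
  proof -
    have "slice_plane D = (\<lambda>x. Complex (fst x) (snd x)) -` slice D j"
      using slice_plane_iff[OF D(2) j, of "Complex _ _"] by auto
    moreover have "continuous_on UNIV (\<lambda>x :: real \<times> real. Complex (fst x) (snd x))"
      unfolding Complex_eq by (intro continuous_intros)
    ultimately show ?thesis using open_vimage[OF open_slice[OF D(1), of j]] by simp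
  qed
  have D2: "((\<lambda>z. g (Re z) (Im z)) has_derivative
      (\<lambda>w. Re w *\<^sub>R gu (Re z) (Im z) + Im w *\<^sub>R gv (Re z) (Im z))) (at z)"
    if "C1_partials (slice_plane D) g gu gv" "z \<in> slice D j"
    for g gu gv :: "real \<Rightarrow> real \<Rightarrow> real ^ 'a set" and z
  proof -
    have "(Re z, Im z) \<in> slice_plane D" using slice_plane_iff[OF D(2) j] that(2) by blast
    from has_derivative_of_C1_partials[OF op that(1) this]
    have g: "((\<lambda>(x, y). g x y) has_derivative (\<lambda>(a, b). a *\<^sub>R gu (Re z) (Im z) + b *\<^sub>R gv (Re z) (Im z)))
        (at (Re z, Im z))" .
    have "((\<lambda>z. (Re z, Im z)) has_derivative (\<lambda>w. (Re w, Im w))) (at z)"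
      by (intro has_derivative_Pair bounded_linear_imp_has_derivative bounded_linear_Re bounded_linear_Im)
    from has_derivative_compose[OF this g] show ?thesis by simp
  qed
  show ?thesis
    unfolding slice_pair_def
  proof (intro ballI conjI)
    fix z assume z: "z \<in> slice D j"
    then have zp: "(Re z, Im z) \<in> slice_plane D" using slice_plane_iff[OF D(2) j] by blast
    show "cnj z \<in> slice D j" by (rule axially_symmetric_slice_cnj[OF D(2) j z])
    show "f0 (Re (cnj z)) (Im (cnj z)) = f0 (Re z) (Im z)"
      "f1 (Re (cnj z)) (Im (cnj z)) = - f1 (Re z) (Im z)" using par[OF zp] by simp_all
    show "\<exists>p q. ((\<lambda>z. f0 (Re z) (Im z)) has_derivative (\<lambda>w. Re w *\<^sub>R p - Im w *\<^sub>R q)) (at z) \<and>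
      ((\<lambda>z. f1 (Re z) (Im z)) has_derivative (\<lambda>w. Re w *\<^sub>R q + Im w *\<^sub>R p)) (at z)"
      using D2[OF C1(1) z] D2[OF C1(2) z] CR[OF zp] by auto
  qed
qed

section \<open>Imaginary units as operators\<close>

lemma cscalar_mult: "cscalar (a \<odot> b) = cscalar a * cscalar b"
  by (simp add: op_apply_inject[symmetric] fun_eq_iff cscalar.rep_eq cmult_assoc)

lemma cscalar_one: "cscalar (axis {} 1) = 1"
  by (simp add: op_apply_inject[symmetric] fun_eq_iff cscalar.rep_eq one_clifford_op.rep_eq cmult_one)

lemma bounded_linear_cscalar: "bounded_linear cscalar"
proof -
  have "linear (cscalar :: real ^ 'a set \<Rightarrow> ('b, 'a) clifford_op)"
  proof (rule linearI)
    show "cscalar (a + b) = cscalar a + (cscalar b :: ('b, 'a) clifford_op)" for a b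
      by (simp add: op_apply_inject[symmetric] fun_eq_iff cscalar.rep_eq plus_clifford_op.rep_eq
          vec_eq_iff cmult_nth algebra_simps sum.distrib)
    show "cscalar (r *\<^sub>R a) = r *\<^sub>R (cscalar a :: ('b, 'a) clifford_op)" for r a
      by (simp add: op_apply_inject[symmetric] fun_eq_iff cscalar.rep_eq scaleR_clifford_op.rep_eq
          vec_eq_iff cmult_nth scaleR_sum_right mult_ac)
  qed
  then show ?thesis by (simp add: linear_conv_bounded_linear)
qed

lemmas linear_cscalar = bounded_linear.linear[OF bounded_linear_cscalar]
lemmas cscalar_add = linear_add[OF linear_cscalar]
  and cscalar_scaleR = linear_cmul[OF linear_cscalar]
  and cscalar_neg = linear_neg[OF linear_cscalar]
  and cscalar_zero = linear_0[OF linear_cscalar]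
  and cscalar_sum = linear_sum[OF linear_cscalar]

definition unit_op :: "real ^ 'n::{finite,linorder} \<Rightarrow> ('v::real_normed_vector, 'n::{finite,linorder}) clifford_op" where
  "unit_op j = cscalar (paravec (0, j))"

lemma paravec_slice_pt: "paravec (slice_pt j z) = Re z *\<^sub>R axis {} 1 + Im z *\<^sub>R paravec (0, j)"
  by (simp add: paravec_def slice_pt_def vec_eq_iff axis_def sum_distrib_left if_distrib cong: if_cong)

lemma cscalar_slice_pt: "cscalar (paravec (slice_pt j z)) = cplx (unit_op j) z"
  by (simp add: paravec_slice_pt cplx_def unit_op_def cscalar_add cscalar_scaleR cscalar_one)

lemma cscalar_ds: "cscalar (ds j w) = cplx (unit_op j) w * (- unit_op j)"
  unfolding ds_def cscalar_mult cscalar_slice_pt cscalar_neg unit_op_def ..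

text \<open>
  Symmetrizing the double sum for \<open>j\<^sup>2\<close>, the anticommutation relations leave only the diagonal terms,
  which add up to \<open>- norm j ^ 2\<close>.
\<close>

lemma unit_op_square:
  assumes j: "j \<in> \<S>"
  shows "unit_op j * unit_op j = - (1 :: ('v::real_normed_vector, 'n::{finite,linorder}) clifford_op)"
proof -
  define E where "E l = (cscalar (axis {l} 1) :: ('v, 'n) clifford_op)" for l
  have "paravec (0, j) = (\<Sum>l\<in>UNIV. (j $ l) *\<^sub>R axis {l} 1)"
    by (simp add: paravec_def vec_eq_iff axis_def if_distrib cong: if_cong)
  then have J: "unit_op j = (\<Sum>l\<in>UNIV. (j $ l) *\<^sub>R E l)"
    by (simp add: unit_op_def E_def cscalar_sum cscalar_scaleR)
  have EE: "E l * E m + E m * E l = (if l = m then (-2) *\<^sub>R 1 else 0)" for l m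
  proof (cases "l = m")
    case True
    have "E m * E m = - 1"
      unfolding E_def by (simp add: generator_square cscalar_neg cscalar_one flip: cscalar_mult)
    then show ?thesis using True by (simp add: scaleR_2)
  next
    case False
    show ?thesis
      unfolding E_def using generator_anticommute[OF False] False
      by (simp add: cscalar_zero flip: cscalar_mult cscalar_add)
  qed
  define g where "g l m = (j $ l * j $ m) *\<^sub>R (E l * E m)" for l m
  have prod: "unit_op j * unit_op j = (\<Sum>l\<in>UNIV. \<Sum>m\<in>UNIV. g l m)"
    unfolding J by (simp add: sum_product g_def mult.commute[of "j $ _" "j $ _"])
  also have "\<dots> = (\<Sum>l\<in>UNIV. \<Sum>m\<in>UNIV. g m l)"
    by (rule sum.swap)
  finally have "unit_op j * unit_op j + unit_op j * unit_op j = (\<Sum>l\<in>UNIV. \<Sum>m\<in>UNIV. g l m + g m l)"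
    using prod by (simp add: sum.distrib)
  also have "\<dots> = (\<Sum>l\<in>UNIV. \<Sum>m\<in>UNIV. (j $ l * j $ m) *\<^sub>R (E l * E m + E m * E l))"
    by (intro sum.cong refl) (simp add: g_def mult.commute scaleR_add_right)
  also have "\<dots> = (\<Sum>l\<in>UNIV. (j $ l * j $ l) *\<^sub>R ((-2) *\<^sub>R 1))"
    by (intro sum.cong refl) (simp add: EE if_distrib cong: if_cong)
  also have "\<dots> = (\<Sum>l\<in>UNIV. j $ l * j $ l) *\<^sub>R ((-2) *\<^sub>R 1)"
    by (simp only: scaleR_sum_left)
  also have "(\<Sum>l\<in>UNIV. j $ l * j $ l) = 1"
    using j power2_norm_eq_inner[of j] by (simp add: inner_vec_def)
  finally have "2 *\<^sub>R (unit_op j * unit_op j) = 2 *\<^sub>R (- 1 :: ('v, 'n) clifford_op)"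
    by (simp add: scaleR_2)
  then show ?thesis by (simp only: scaleR_cancel_left) simp
qed

section \<open>The S-resolvents in a plane\<close>

text \<open>
  The value of \<open>Q_op\<close> at \<open>slice_pt j z\<close>, for every \<open>j \<in> \<S>\<close>. The spectrum and the resolvent components
  are expressed by it, which makes their independence of \<open>j\<close> visible.
\<close>

definition planar_Q :: "('v::real_normed_vector, 'n::{finite,linorder}) clifford_op \<Rightarrow> complex \<Rightarrow> ('v, 'n) clifford_op" where
  "planar_Q T z = T ^ 2 - (2 * Re z) *\<^sub>R T + (cmod z)\<^sup>2 *\<^sub>R 1"

definition planar_resolvent_set :: "('v::real_normed_vector, 'n::{finite,linorder}) clifford_op \<Rightarrow> complex set" where
  "planar_resolvent_set T = {z. \<exists>R. inverse_of R (planar_Q T z)}"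

lemma Q_op_slice_pt: "j \<in> \<S> \<Longrightarrow> Q_op (slice_pt j z) T = planar_Q T z"
  by (simp add: Q_op_def planar_Q_def norm_slice_pt) (simp add: slice_pt_def)

lemma op_inverse_of_iff: "op_inverse_of R P \<longleftrightarrow> inverse_of R P"
  by (simp add: op_inverse_of_def inverse_of_def)

lemma op_inv_inverse: "inverse_of R P \<Longrightarrow> inverse_of (op_inv P) P"
  unfolding op_inv_def op_inverse_of_iff by (rule theI) (auto intro: inverse_of_unique)

lemma slice_spectrum: "j \<in> \<S> \<Longrightarrow> slice (S_spectrum T) j = - planar_resolvent_set T"
  by (auto simp: slice_def S_spectrum_def S_resolvent_set_def planar_resolvent_set_def Q_op_slice_pt
      op_inverse_of_iff)

lemma planar_resolvent_set_cnj: "cnj z \<in> planar_resolvent_set T \<longleftrightarrow> z \<in> planar_resolvent_set T"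
  by (simp add: planar_resolvent_set_def planar_Q_def)

lemma open_planar_resolvent_set:
  fixes T :: "('v::banach, 'n::{finite,linorder}) clifford_op"
  shows "open (planar_resolvent_set T)"
  unfolding open_subopen[of "planar_resolvent_set T"]
proof
  fix z assume "z \<in> planar_resolvent_set T"
  then obtain R where R: "inverse_of R (planar_Q T z)" by (auto simp: planar_resolvent_set_def)
  let ?N = "{w. norm R * norm (planar_Q T z - planar_Q T w) < 1}"
  have "open ?N"
    unfolding planar_Q_def by (intro open_Collect_less continuous_intros)
  moreover have "z \<in> ?N" by simp
  moreover have "?N \<subseteq> planar_resolvent_set T"
    using inverse_of_perturb[OF R] by (auto simp: planar_resolvent_set_def)
  ultimately show "\<exists>N. open N \<and> z \<in> N \<and> N \<subseteq> planar_resolvent_set T" by blast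
qed

definition resolvent0 :: "('v::real_normed_vector, 'n::{finite,linorder}) clifford_op \<Rightarrow> complex \<Rightarrow> ('v, 'n) clifford_op" where
  "resolvent0 T z = - (op_inv (planar_Q T z) * (T - Re z *\<^sub>R 1))"

definition resolvent1 :: "('v::real_normed_vector, 'n::{finite,linorder}) clifford_op \<Rightarrow> complex \<Rightarrow> ('v, 'n) clifford_op" where
  "resolvent1 T z = - (Im z *\<^sub>R op_inv (planar_Q T z))"

lemma pconj_slice_pt: "pconj (slice_pt j z) = slice_pt j (cnj z)"
  by (simp add: pconj_def slice_pt_def)

lemma SL_resolvent_components:
  assumes "j \<in> \<S>"
  shows "SL_resolvent (slice_pt j z) T = resolvent0 T z + resolvent1 T z * unit_op j"
  using assms
  by (simp add: SL_resolvent_def Q_op_slice_pt pconj_slice_pt cscalar_slice_pt resolvent0_def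
      resolvent1_def cplx_def algebra_simps)

text \<open>
  The right resolvent has the same components as the left one because \<open>Q\<^sup>-\<^sup>1\<close> commutes with \<open>T\<close>
  (though not with \<open>j\<close>).
\<close>

lemma SR_resolvent_components:
  assumes "j \<in> \<S>" "z \<in> planar_resolvent_set T"
  shows "SR_resolvent (slice_pt j z) T = resolvent0 T z + unit_op j * resolvent1 T z"
proof -
  obtain R where "inverse_of R (planar_Q T z)" using assms(2) by (auto simp: planar_resolvent_set_def)
  then have inv: "inverse_of (op_inv (planar_Q T z)) (planar_Q T z)" by (rule op_inv_inverse)
  have "op_inv (planar_Q T z) * T = T * op_inv (planar_Q T z)"
    by (rule inverse_of_commute[OF inv]) (simp add: planar_Q_def algebra_simps power2_eq_square)
  then show ?thesis
    using assms(1)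
    by (simp add: SR_resolvent_def Q_op_slice_pt pconj_slice_pt cscalar_slice_pt resolvent0_def
        resolvent1_def cplx_def algebra_simps)
qed

lemma resolvent_components_slice_pair:
  fixes T :: "('v::banach, 'n::{finite,linorder}) clifford_op"
  shows "slice_pair (planar_resolvent_set T) (resolvent0 T) (resolvent1 T)"
proof -
  have "slice_pair (planar_resolvent_set T)
      (\<lambda>z. - (op_inv (planar_Q T z) * (T - Re z *\<^sub>R 1))) (\<lambda>z. - (Im z *\<^sub>R op_inv (planar_Q T z)))"
  proof (rule resolvent_slice_pair)
    fix z assume "z \<in> planar_resolvent_set T"
    then show "inverse_of (op_inv (planar_Q T z)) (T ^ 2 - (2 * Re z) *\<^sub>R T + (cmod z)\<^sup>2 *\<^sub>R 1)"
      using op_inv_inverse by (auto simp: planar_resolvent_set_def simp flip: planar_Q_def)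
  qed (auto simp: open_planar_resolvent_set planar_resolvent_set_cnj)
  then show ?thesis by (simp add: resolvent0_def[abs_def] resolvent1_def[abs_def])
qed

section \<open>The functional calculus\<close>

text \<open>
  The boundary curves run inside the closure of \<open>U\<close>, hence in \<open>D\<close>, and avoid the open set \<open>U\<close>, hence the
  spectrum. A point outside \<open>W\<close> is either spectral and thus in \<open>U\<close>, or not in \<open>D\<close> and thus outside the
  closure of \<open>U\<close>; so its winding number does not depend on \<open>U\<close>.
\<close>

lemma admissible_facts:
  assumes adm: "admissible T D U j \<Gamma>" and D: "open D" "axially_symmetric D"
  defines "W \<equiv> slice D j \<inter> planar_resolvent_set T"
  shows "j \<in> \<S>" "closed_paths_in W \<Gamma>"
    "w \<notin> W \<Longrightarrow> (\<Sum>\<gamma>\<in>\<Gamma>. winding_number \<gamma> w) = (if w \<in> planar_resolvent_set T then 0 else 1)"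
proof -
  have U: "slice_Cauchy_domain U" "S_spectrum T \<subseteq> U" "closure U \<subseteq> D"
    and pos: "positively_oriented_boundary (slice U j) \<Gamma>" and j: "j \<in> \<S>"
    using adm by (auto simp: admissible_def)
  show "j \<in> \<S>" by (rule j)
  have opU: "open (slice U j)" using U(1) by (auto simp: slice_Cauchy_domain_def intro: open_slice)
  have clU: "closure (slice U j) \<subseteq> slice D j"
    using closure_slice_subset[of U j] U(3) by (auto simp: slice_def)
  have spec: "- planar_resolvent_set T \<subseteq> slice U j"
    using U(2) slice_spectrum[OF j, of T] by (auto simp: slice_def)
  have JB: "Jordan_boundary (slice U j) \<Gamma>"
    using pos by (auto simp: positively_oriented_boundary_def)
  have "path_image \<gamma> \<subseteq> W" if "\<gamma> \<in> \<Gamma>" for \<gamma>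
  proof -
    have "path_image \<gamma> \<subseteq> frontier (slice U j)"
      using JB that by (auto simp: Jordan_boundary_def)
    also have "\<dots> \<subseteq> W"
      using clU spec opU by (auto simp: W_def frontier_def interior_open)
    finally show ?thesis .
  qed
  then show "closed_paths_in W \<Gamma>"
    using JB by (auto simp: closed_paths_in_def Jordan_boundary_def)
  show "(\<Sum>\<gamma>\<in>\<Gamma>. winding_number \<gamma> w) = (if w \<in> planar_resolvent_set T then 0 else 1)" if w: "w \<notin> W"
  proof (cases "w \<in> planar_resolvent_set T")
    case True
    then have "w \<notin> closure (slice U j)" using w clU by (auto simp: W_def)
    then show ?thesis using True pos by (simp add: positively_oriented_boundary_def)
  next
    case False
    then have "w \<in> slice U j" using spec by auto
    then show ?thesis using False pos by (simp add: positively_oriented_boundary_def)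
  qed
qed

text \<open>
  The left and the right calculus are the two instances. Their integrands \<open>L\<close> agree with a slice form
  only where the S-resolvent and \<open>f\<close> are given by their components, which includes the boundary
  curves.
\<close>

lemma calculus_independent:
  fixes T :: "('v::banach, 'n::{finite,linorder}) clifford_op"
    and L :: "(real, 'n) vec \<Rightarrow> (real \<Rightarrow> complex) \<Rightarrow> real \<Rightarrow> ('v, 'n) clifford_op"
  assumes D: "open D" "axially_symmetric D"
    and pairs: "\<And>j. j \<in> \<S> \<Longrightarrow> slice_pair (slice D j \<inter> planar_resolvent_set T) X0 X1"
      "\<And>j. j \<in> \<S> \<Longrightarrow> slice_pair (slice D j \<inter> planar_resolvent_set T) F0 F1"
    and L: "\<And>j \<gamma> t. j \<in> \<S> \<Longrightarrow> \<gamma> t \<in> slice D j \<inter> planar_resolvent_set T \<Longrightarrow>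
      L j \<gamma> t = slice_form (unit_op j) X0 X1 F0 F1 \<gamma> t"
  shows "admissible T D U j \<Gamma> \<Longrightarrow> \<gamma> \<in> \<Gamma> \<Longrightarrow> L j \<gamma> integrable_on {0..1}"
    "admissible T D U j \<Gamma> \<Longrightarrow> admissible T D U' j' \<Gamma>' \<Longrightarrow>
      (\<Sum>\<gamma>\<in>\<Gamma>. integral {0..1} (L j \<gamma>)) = (\<Sum>\<gamma>\<in>\<Gamma>'. integral {0..1} (L j' \<gamma>))"
proof -
  have open_W: "open (slice D j \<inter> planar_resolvent_set T)" for j
    by (intro open_Int open_slice D open_planar_resolvent_set)
  have L': "L j \<gamma> t = slice_form (unit_op j) X0 X1 F0 F1 \<gamma> t"
    if "admissible T D U j \<Gamma>" "\<gamma> \<in> \<Gamma>" "t \<in> {0..1}" for U j \<Gamma> \<gamma> t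
  proof (rule L)
    have "\<gamma> t \<in> path_image \<gamma>" using that(3) by (simp add: path_image_def)
    then show "\<gamma> t \<in> slice D j \<inter> planar_resolvent_set T"
      using admissible_facts(2)[OF that(1) D] that(2) by (auto simp: closed_paths_in_def)
  qed (rule admissible_facts(1)[OF that(1) D])
  show "L j \<gamma> integrable_on {0..1}" if adm: "admissible T D U j \<Gamma>" "\<gamma> \<in> \<Gamma>"
  proof (rule integrable_eq)
    note a = admissible_facts[OF adm(1) D]
    note sq = unit_op_square[OF a(1)]
    show "slice_form (unit_op j) X0 X1 F0 F1 \<gamma> integrable_on {0..1}"
      unfolding slice_form_line_form[OF sq] using a(2) adm(2)
      by (intro line_form_integrable[OF slice_form_holomorphic[OF open_W sq pairs[OF a(1)]] open_W])
        (auto simp: closed_paths_in_def)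
  qed (use L'[OF adm] in simp)
  assume adm: "admissible T D U j \<Gamma>" and adm': "admissible T D U' j' \<Gamma>'"
  note a = admissible_facts[OF adm D] and a' = admissible_facts[OF adm' D]
  have eq: "slice D j' = slice D j" by (rule axially_symmetric_slice[OF D(2) a'(1) a(1)])
  have "(\<Sum>\<gamma>\<in>\<Gamma>. integral {0..1} (L j \<gamma>))
      = (\<Sum>\<gamma>\<in>\<Gamma>. integral {0..1} (slice_form (unit_op j) X0 X1 F0 F1 \<gamma>))"
    using L'[OF adm] by (intro sum.cong integral_cong) auto
  also have "\<dots> = (\<Sum>\<gamma>\<in>\<Gamma>'. integral {0..1} (slice_form (unit_op j') X0 X1 F0 F1 \<gamma>))"
    by (rule slice_form_integral_independent[OF open_W pairs[OF a(1)] unit_op_square[OF a(1)]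
          unit_op_square[OF a'(1)] a(2) a'(2)[unfolded eq] a(3) a'(3)[unfolded eq]])
      (auto simp: planar_resolvent_set_cnj)
  also have "\<dots> = (\<Sum>\<gamma>\<in>\<Gamma>'. integral {0..1} (L j' \<gamma>))"
    using L'[OF adm'] by (intro sum.cong integral_cong) auto
  finally show "(\<Sum>\<gamma>\<in>\<Gamma>. integral {0..1} (L j \<gamma>)) = (\<Sum>\<gamma>\<in>\<Gamma>'. integral {0..1} (L j' \<gamma>))" .
qed

lemma slice_pairs_on_slice:
  fixes T :: "('v::banach, 'n::{finite,linorder}) clifford_op"
  assumes "open D" "axially_symmetric D" "slice_components D f0 f1" "j \<in> \<S>"
  defines "W \<equiv> slice D j \<inter> planar_resolvent_set T"
  shows "slice_pair W (resolvent0 T) (resolvent1 T)"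
    "slice_pair W (\<lambda>z. cscalar (f0 (Re z) (Im z)) :: ('v, 'n) clifford_op) (\<lambda>z. cscalar (f1 (Re z) (Im z)))"
proof -
  have sym: "cnj z \<in> W" if "z \<in> W" for z
    using that axially_symmetric_slice_cnj[OF assms(2,4)] by (auto simp: W_def planar_resolvent_set_cnj)
  show "slice_pair W (resolvent0 T) (resolvent1 T)"
    by (rule slice_pair_subset[OF resolvent_components_slice_pair _ sym]) (auto simp: W_def)
  show "slice_pair W (\<lambda>z. cscalar (f0 (Re z) (Im z)) :: ('v, 'n) clifford_op) (\<lambda>z. cscalar (f1 (Re z) (Im z)))"
    by (rule slice_pair_subset[OF slice_pair_bounded_linear[OF
          slice_components_slice_pair[OF assms(1,2,4,3)] bounded_linear_cscalar] _ sym]) (auto simp: W_def)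
qed

theorem theorem4p11:
  fixes T :: "('v::banach, 'n::{finite,linorder}) clifford_op"
  shows
    "(\<forall>D f. left_slice_monogenic D f \<and> S_spectrum T \<subseteq> D \<longrightarrow>
        (\<forall>U j \<Gamma>. admissible T D U j \<Gamma> \<longrightarrow>
           (\<forall>\<gamma>\<in>\<Gamma>. left_integrand T f j \<gamma> integrable_on {0..1})) \<and>
        (\<forall>U j \<Gamma> U' j' \<Gamma>'. admissible T D U j \<Gamma> \<and> admissible T D U' j' \<Gamma>' \<longrightarrow>
           left_calculus T f j \<Gamma> = left_calculus T f j' \<Gamma>')) \<and>
     (\<forall>D f. right_slice_monogenic D f \<and> S_spectrum T \<subseteq> D \<longrightarrow>
        (\<forall>U j \<Gamma>. admissible T D U j \<Gamma> \<longrightarrow>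
           (\<forall>\<gamma>\<in>\<Gamma>. right_integrand T f j \<gamma> integrable_on {0..1})) \<and>
        (\<forall>U j \<Gamma> U' j' \<Gamma>'. admissible T D U j \<Gamma> \<and> admissible T D U' j' \<Gamma>' \<longrightarrow>
           right_calculus T f j \<Gamma> = right_calculus T f j' \<Gamma>'))"
proof (rule conjI; intro allI impI; elim conjE)
  fix D :: "'n paravector set" and f :: "'n paravector \<Rightarrow> real ^ 'n set"
  assume "left_slice_monogenic D f"
  then obtain f0 f1 where D: "open D" "axially_symmetric D" and f01: "slice_components D f0 f1"
    and f: "\<And>u v j. j \<in> \<S> \<Longrightarrow> (u, v *\<^sub>R j) \<in> D \<Longrightarrow> f (u, v *\<^sub>R j) = f0 u v + paravec (0, j) \<odot> f1 u v"
    unfolding left_slice_monogenic_def by blast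
  have form: "left_integrand T f j \<gamma> t = slice_form (unit_op j) (resolvent0 T) (resolvent1 T)
      (\<lambda>z. cscalar (f0 (Re z) (Im z))) (\<lambda>z. cscalar (f1 (Re z) (Im z))) \<gamma> t"
    if j: "j \<in> \<S>" and t: "\<gamma> t \<in> slice D j \<inter> planar_resolvent_set T" for j \<gamma> t
  proof -
    have "f (slice_pt j (\<gamma> t)) = f0 (Re (\<gamma> t)) (Im (\<gamma> t)) + paravec (0, j) \<odot> f1 (Re (\<gamma> t)) (Im (\<gamma> t))"
      using t f[OF j] by (simp add: slice_def slice_pt_def)
    then show ?thesis
      by (simp add: left_integrand_def slice_form_def SL_resolvent_components[OF j] cscalar_ds
          cscalar_add cscalar_mult unit_op_def)
  qed
  note main = calculus_independent[where L = "left_integrand T f", OF D slice_pairs_on_slice[OF D f01] form]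
  have int: "left_integrand T f j \<gamma> integrable_on {0..1}"
    if "admissible T D U j \<Gamma>" "\<gamma> \<in> \<Gamma>" for U j \<Gamma> \<gamma>
    by (rule main(1)[OF _ _ _ _ that])
  have eq: "left_calculus T f j \<Gamma> = left_calculus T f j' \<Gamma>'"
    if "admissible T D U j \<Gamma>" "admissible T D U' j' \<Gamma>'" for U j \<Gamma> U' j' \<Gamma>'
    unfolding left_calculus_def by (rule arg_cong[OF main(2)[OF _ _ _ _ that]])
  show "(\<forall>U j \<Gamma>. admissible T D U j \<Gamma> \<longrightarrow> (\<forall>\<gamma>\<in>\<Gamma>. left_integrand T f j \<gamma> integrable_on {0..1})) \<and>
        (\<forall>U j \<Gamma> U' j' \<Gamma>'. admissible T D U j \<Gamma> \<and> admissible T D U' j' \<Gamma>' \<longrightarrow>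
           left_calculus T f j \<Gamma> = left_calculus T f j' \<Gamma>')"
    using int eq by blast
next
  fix D :: "'n paravector set" and f :: "'n paravector \<Rightarrow> real ^ 'n set"
  assume "right_slice_monogenic D f"
  then obtain f0 f1 where D: "open D" "axially_symmetric D" and f01: "slice_components D f0 f1"
    and f: "\<And>u v j. j \<in> \<S> \<Longrightarrow> (u, v *\<^sub>R j) \<in> D \<Longrightarrow> f (u, v *\<^sub>R j) = f0 u v + f1 u v \<odot> paravec (0, j)"
    unfolding right_slice_monogenic_def by blast
  have form: "right_integrand T f j \<gamma> t = slice_form (unit_op j)
      (\<lambda>z. cscalar (f0 (Re z) (Im z))) (\<lambda>z. cscalar (f1 (Re z) (Im z))) (resolvent0 T) (resolvent1 T) \<gamma> t"
    if j: "j \<in> \<S>" and t: "\<gamma> t \<in> slice D j \<inter> planar_resolvent_set T" for j \<gamma> t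
  proof -
    have "f (slice_pt j (\<gamma> t)) = f0 (Re (\<gamma> t)) (Im (\<gamma> t)) + f1 (Re (\<gamma> t)) (Im (\<gamma> t)) \<odot> paravec (0, j)"
      using t f[OF j] by (simp add: slice_def slice_pt_def)
    then show ?thesis
      using t by (simp add: right_integrand_def slice_form_def SR_resolvent_components[OF j] cscalar_ds
          cscalar_add cscalar_mult unit_op_def)
  qed
  note main = calculus_independent[where L = "right_integrand T f", OF D
      slice_pairs_on_slice(2,1)[OF D f01] form]
  have int: "right_integrand T f j \<gamma> integrable_on {0..1}"
    if "admissible T D U j \<Gamma>" "\<gamma> \<in> \<Gamma>" for U j \<Gamma> \<gamma>
    by (rule main(1)[OF _ _ _ _ that])
  have eq: "right_calculus T f j \<Gamma> = right_calculus T f j' \<Gamma>'"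
    if "admissible T D U j \<Gamma>" "admissible T D U' j' \<Gamma>'" for U j \<Gamma> U' j' \<Gamma>'
    unfolding right_calculus_def by (rule arg_cong[OF main(2)[OF _ _ _ _ that]])
  show "(\<forall>U j \<Gamma>. admissible T D U j \<Gamma> \<longrightarrow> (\<forall>\<gamma>\<in>\<Gamma>. right_integrand T f j \<gamma> integrable_on {0..1})) \<and>
        (\<forall>U j \<Gamma> U' j' \<Gamma>'. admissible T D U j \<Gamma> \<and> admissible T D U' j' \<Gamma>' \<longrightarrow>
           right_calculus T f j \<Gamma> = right_calculus T f j' \<Gamma>')"
    using int eq by blast
qed

end
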